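(* Let $K$ be a field of characteristic zero, $S=K[X_1,\dots,X_n]$, and let $(A,C,\rho)$ be an admissible binomial system of degree $d$ in $n$ indeterminates. Let $F(A,C,\rho)\subset S$ be the ideal generated by $\{X^a\mid a\in A\}\cup\{X^c-X^{c+\rho}\mid c\in C\}$. Then the $S$-modules $S/F(A,C,\rho)^{\mathrm{sat}}$ and $S/F(A,C,\rho)$ are sequentially Cohen-Macaulay.
   Context: $n,d\geq1$ are integers; $\mathbb{N}$ is the set of nonnegative integers; $e_1,\dots,e_n$ are the standard vectors. For $a\in\mathbb{Z}^n$: $|a|=\sum_i a_i$, $m(a)=\max(\{1\leq i\leq n\mid a_i\neq0\}\cup\{1\})$, $X^a=X_1^{a_1}\cdots X_n^{a_n}$. $\mathbb{N}^n_d=\{c\in\mathbb{N}^n\mid |c|=d\}$. For a homogeneous ideal $\mathfrak{a}\subset S$, $\mathfrak{a}^{\mathrm{sat}}=(\mathfrak{a}:S_+^\infty)$ with $S_+=\langle X_1,\dots,X_n\rangle$. Borel order on $\mathbb{N}^n_d$: $a\geq_{\mathrm{Bor}}b$ iff there are $\alpha_1,\dots,\alpha_{n-1}\in\mathbb{N}$ with $a-b=\sum_{j=1}^{n-1}\alpha_j(e_j-e_{j+1})$. A set $B\subset\mathbb{N}^n_d$ is a Borel set if $a\in B$, $b\in\mathbb{N}^n_d$, $b\geq_{\mathrm{Bor}}a$ imply $b\in B$. A binomial system (of degree $d$ in $n$ indeterminates) is a triple $(A,C,\rho)$ with $A,C\subset\mathbb{N}^n_d$, $\rho\in\mathbb{Z}^n$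 such that (i) $C+\rho\subset\mathbb{N}^n_d$; (ii) $A\cap C=A\cap(C+\rho)=C\cap(C+\rho)=\emptyset$; (iii) $A\cup C$ and $A\cup(C+\rho)$ are Borel sets. It is admissible if $C=\emptyset$ or $\rho_{m(\rho)}>0$. A finitely generated graded module $M$ over a graded ring is sequentially Cohen-Macaulay if there is a finite filtration $0=M_0\subsetneq M_1\subsetneq\dots\subsetneq M_r=M$ by graded submodules such that each $M_i/M_{i-1}$ ($1\leq i\leq r$) is Cohen-Macaulay and $\dim(M_i/M_{i-1})<\dim(M_{i+1}/M_i)$ for $1\leq i<r$. (Here $r=0$ is allowed, so the zero module is sequentially Cohen-Macaulay.) *)

theory Defs
  imports "HOL-Algebra.Module" "HOL-Algebra.QuotRing" "HOL-Algebra.Ideal_Product"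
    "HOL-Library.Poly_Mapping" "HOL-Library.Extended_Nat"
begin

section \<open>Modules: submodules, quotients, dimension and depth\<close>

definition gen_submodule :: "('a, 'c) ring_scheme \<Rightarrow> ('a, 'b, 'd) module_scheme \<Rightarrow> 'b set \<Rightarrow> 'b set"
  where "gen_submodule R M B = \<Inter>{N. submodule N R M \<and> B \<subseteq> N}"

definition finitely_generated :: "('a, 'c) ring_scheme \<Rightarrow> ('a, 'b, 'd) module_scheme \<Rightarrow> bool"
  where "finitely_generated R M \<longleftrightarrow>
    (\<exists>B. finite B \<and> B \<subseteq> carrier M \<and> gen_submodule R M B = carrier M)"

definition regular_module :: "('a, 'c) ring_scheme \<Rightarrow> ('a, 'a) module"
  where "regular_module R =
    \<lparr>carrier = carrier R, mult = mult R, one = one R, zero = zero R, add = add R, smult = mult R\<rparr>"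

text \<open>Module records inherit the fields \<open>mult\<close> and \<open>one\<close> from ring records; a module does not
  use them, and they are given dummy values here. On cosets, \<open>r \<odot> (N +> x) = N +> r \<odot> x\<close>.\<close>

definition quot_module :: "('a, 'b, 'd) module_scheme \<Rightarrow> 'b set \<Rightarrow> ('a, 'b set) module"
  where "quot_module M N =
    \<lparr>carrier = a_rcosets\<^bsub>M\<^esub> N, mult = (\<lambda>_ _. N), one = N, zero = N, add = set_add M,
     smult = (\<lambda>r U. \<Union>x\<in>U. N +>\<^bsub>M\<^esub> (r \<odot>\<^bsub>M\<^esub> x))\<rparr>"

definition annihilator :: "('a, 'c) ring_scheme \<Rightarrow> ('a, 'b, 'd) module_scheme \<Rightarrow> 'a set"
  where "annihilator R M = {r \<in> carrier R. \<forall>x \<in> carrier M. r \<odot>\<^bsub>M\<^esub> x = \<zero>\<^bsub>M\<^esub>}"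

text \<open>Suprema are taken in \<^typ>\<open>enat\<close>, so the zero ring and the zero module get dimension
  (and depth) \<open>0\<close> instead of \<open>-\<infinity>\<close>. The successive quotients of a strict filtration are
  nonzero, so this convention plays no role below.\<close>

definition krull_dim :: "('a, 'c) ring_scheme \<Rightarrow> enat"
  where "krull_dim R = Sup {enat k | k.
    \<exists>P. (\<forall>i\<le>k. primeideal (P i) R) \<and> (\<forall>i<k. P i \<subset> P (Suc i))}"

definition module_dim :: "('a, 'c) ring_scheme \<Rightarrow> ('a, 'b, 'd) module_scheme \<Rightarrow> enat"
  where "module_dim R M = krull_dim (R Quot annihilator R M)"

text \<open>The submodule \<open>(r\<^sub>1, \<dots>, r\<^sub>k) M\<close> for \<open>rs = [r\<^sub>1, \<dots>, r\<^sub>k]\<close>.\<close>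

definition seq_submodule ::
  "('a, 'c) ring_scheme \<Rightarrow> ('a, 'b, 'd) module_scheme \<Rightarrow> 'a list \<Rightarrow> 'b set"
  where "seq_submodule R M rs =
    gen_submodule R M {r \<odot>\<^bsub>M\<^esub> x | r x. r \<in> set rs \<and> x \<in> carrier M}"

definition nonzerodivisor_on :: "('a, 'b, 'd) module_scheme \<Rightarrow> 'a \<Rightarrow> bool"
  where "nonzerodivisor_on M r \<longleftrightarrow>
    (\<forall>x \<in> carrier M. r \<odot>\<^bsub>M\<^esub> x = \<zero>\<^bsub>M\<^esub> \<longrightarrow> x = \<zero>\<^bsub>M\<^esub>)"

definition regular_sequence ::
  "('a, 'c) ring_scheme \<Rightarrow> ('a, 'b, 'd) module_scheme \<Rightarrow> 'a list \<Rightarrow> bool"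
  where "regular_sequence R M rs \<longleftrightarrow>
    set rs \<subseteq> carrier R \<and>
    (\<forall>k < length rs. nonzerodivisor_on (quot_module M (seq_submodule R M (take k rs))) (rs ! k)) \<and>
    seq_submodule R M rs \<noteq> carrier M"

definition depth_in ::
  "('a, 'c) ring_scheme \<Rightarrow> 'a set \<Rightarrow> ('a, 'b, 'd) module_scheme \<Rightarrow> enat"
  where "depth_in R I M = Sup {enat (length rs) | rs. regular_sequence R M rs \<and> set rs \<subseteq> I}"


section \<open>Graded rings and modules\<close>

text \<open>Gradings are indexed by \<^typ>\<open>int\<close>; an \<open>\<nat>\<close>-grading is one whose negative parts are \<open>{\<zero>}\<close>.\<close>

definition is_direct_sum :: "('a, 'c) ring_scheme \<Rightarrow> (int \<Rightarrow> 'a set) \<Rightarrow> bool"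
  where "is_direct_sum M G \<longleftrightarrow>
    (\<forall>i. additive_subgroup (G i) M) \<and>
    (\<forall>x \<in> carrier M. \<exists>!f. (\<forall>i. f i \<in> G i) \<and> finite {i. f i \<noteq> \<zero>\<^bsub>M\<^esub>} \<and>
       x = (\<Oplus>\<^bsub>M\<^esub>i \<in> {i. f i \<noteq> \<zero>\<^bsub>M\<^esub>}. f i))"

definition graded_ring :: "('a, 'c) ring_scheme \<Rightarrow> (int \<Rightarrow> 'a set) \<Rightarrow> bool"
  where "graded_ring R RG \<longleftrightarrow> cring R \<and> is_direct_sum R RG \<and> \<one>\<^bsub>R\<^esub> \<in> RG 0 \<and>
    (\<forall>i j. \<forall>r \<in> RG i. \<forall>s \<in> RG j. r \<otimes>\<^bsub>R\<^esub> s \<in> RG (i + j))"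

definition irrelevant_ideal :: "('a, 'c) ring_scheme \<Rightarrow> (int \<Rightarrow> 'a set) \<Rightarrow> 'a set"
  where "irrelevant_ideal R RG = Idl\<^bsub>R\<^esub> (\<Union>i\<in>{0<..}. RG i)"

definition graded_module :: "('a, 'c) ring_scheme \<Rightarrow> (int \<Rightarrow> 'a set) \<Rightarrow>
    ('a, 'b, 'd) module_scheme \<Rightarrow> (int \<Rightarrow> 'b set) \<Rightarrow> bool"
  where "graded_module R RG M MG \<longleftrightarrow>
    graded_ring R RG \<and> Module.module R M \<and> is_direct_sum M MG \<and>
    (\<forall>i j. \<forall>r \<in> RG i. \<forall>x \<in> MG j. r \<odot>\<^bsub>M\<^esub> x \<in> MG (i + j))"

definition graded_submodule :: "('a, 'c) ring_scheme \<Rightarrow>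
    ('a, 'b, 'd) module_scheme \<Rightarrow> (int \<Rightarrow> 'b set) \<Rightarrow> 'b set \<Rightarrow> bool"
  where "graded_submodule R M MG N \<longleftrightarrow>
    submodule N R M \<and> is_direct_sum (M\<lparr>carrier := N\<rparr>) (\<lambda>i. MG i \<inter> N)"

definition quot_grading :: "('b, 'c) ring_scheme \<Rightarrow> (int \<Rightarrow> 'b set) \<Rightarrow> 'b set \<Rightarrow> int \<Rightarrow> 'b set set"
  where "quot_grading M MG N i = (\<lambda>x. N +>\<^bsub>M\<^esub> x) ` MG i"

text \<open>Cohen-Macaulayness of a finitely generated graded module over a Noetherian graded ring whose
  degree \<open>0\<close> part is a field and whose negative parts vanish: depth (with respect to the
  irrelevant ideal) equals Krull dimension.\<close>

definition cohen_macaulay :: "('a, 'c) ring_scheme \<Rightarrow> (int \<Rightarrow> 'a set) \<Rightarrow>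
    ('a, 'b, 'd) module_scheme \<Rightarrow> bool"
  where "cohen_macaulay R RG M \<longleftrightarrow> depth_in R (irrelevant_ideal R RG) M = module_dim R M"

definition sequentially_cohen_macaulay :: "('a, 'c) ring_scheme \<Rightarrow> (int \<Rightarrow> 'a set) \<Rightarrow>
    ('a, 'b, 'd) module_scheme \<Rightarrow> (int \<Rightarrow> 'b set) \<Rightarrow> bool"
  where "sequentially_cohen_macaulay R RG M MG \<longleftrightarrow>
    graded_module R RG M MG \<and> finitely_generated R M \<and>
    (\<exists>(r :: nat) N.
      N 0 = {\<zero>\<^bsub>M\<^esub>} \<and> N r = carrier M \<and>
      (\<forall>i \<le> r. graded_submodule R M MG (N i)) \<and>
      (\<forall>i < r. N i \<subset> N (Suc i)) \<and>
      (\<forall>i < r. cohen_macaulay R RG (quot_module (M\<lparr>carrier := N (Suc i)\<rparr>) (N i))) \<and>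
      (\<forall>i. Suc i < r \<longrightarrow>
         module_dim R (quot_module (M\<lparr>carrier := N (Suc i)\<rparr>) (N i)) <
         module_dim R (quot_module (M\<lparr>carrier := N (Suc (Suc i))\<rparr>) (N (Suc i)))))"


section \<open>The polynomial ring \<open>K[X\<^sub>1, \<dots>, X\<^sub>n]\<close>\<close>

text \<open>Polynomials are finitely supported functions from exponents to coefficients; those in
  \<open>X\<^sub>1, \<dots>, X\<^sub>n\<close> have all their exponents supported in \<open>{1..n}\<close>.\<close>

type_synonym 'k mpoly = "(nat \<Rightarrow>\<^sub>0 nat) \<Rightarrow>\<^sub>0 'k"

definition poly_ring :: "nat \<Rightarrow> 'k::comm_ring_1 mpoly ring"
  where "poly_ring n =
    \<lparr>carrier = {p. \<forall>u \<in> Poly_Mapping.keys p. Poly_Mapping.keys u \<subseteq> {1..n}},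
     mult = (*), one = 1, zero = 0, add = (+)\<rparr>"

definition poly_grading :: "nat \<Rightarrow> int \<Rightarrow> 'k::comm_ring_1 mpoly set"
  where "poly_grading n i = {p \<in> carrier (poly_ring n).
    \<forall>u \<in> Poly_Mapping.keys p. int (\<Sum>j = 1..n. Poly_Mapping.lookup u j) = i}"

definition Xvar :: "nat \<Rightarrow> 'k::comm_ring_1 mpoly"
  where "Xvar i = Poly_Mapping.single (Poly_Mapping.single i 1) 1"

text \<open>\<open>X\<^sup>a\<close>, used only for vectors \<open>a\<close> with nonnegative entries.\<close>

definition Xmon :: "nat \<Rightarrow> (nat \<Rightarrow> int) \<Rightarrow> 'k::comm_ring_1 mpoly"
  where "Xmon n a = (\<Prod>i = 1..n. Xvar i ^ nat (a i))"

text \<open>\<open>\<aa>\<^sup>s\<^sup>a\<^sup>t = (\<aa> : S\<^sub>+\<^sup>\<infinity>) = \<Union>\<^sub>k (\<aa> : S\<^sub>+\<^sup>k)\<close>, where \<open>S\<^sub>+ = \<langle>X\<^sub>1, \<dots>, X\<^sub>n\<rangle>\<close>. The power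
  \<open>S\<^sub>+\<^sup>k\<close> is formed in the multiplicative monoid of ideals.\<close>

definition saturation :: "nat \<Rightarrow> 'k::comm_ring_1 mpoly set \<Rightarrow> 'k mpoly set"
  where "saturation n I =
    (let S = poly_ring n; Splus = Idl\<^bsub>S\<^esub> (Xvar ` {1..n}) in
     {f \<in> carrier S. \<exists>k::nat. \<forall>g \<in> Splus [^]\<^bsub>ideals_set S\<^esub> k. f \<otimes>\<^bsub>S\<^esub> g \<in> I})"


section \<open>Binomial systems\<close>

text \<open>Vectors in \<open>\<int>\<^sup>n\<close> are functions on the naturals vanishing outside \<open>{1..n}\<close>.\<close>

definition Zvec :: "nat \<Rightarrow> (nat \<Rightarrow> int) set"
  where "Zvec n = {a. \<forall>i. i \<notin> {1..n} \<longrightarrow> a i = 0}"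

definition Nvec :: "nat \<Rightarrow> nat \<Rightarrow> (nat \<Rightarrow> int) set"
  where "Nvec n d = {a \<in> Zvec n. (\<forall>i. a i \<ge> 0) \<and> (\<Sum>i = 1..n. a i) = int d}"

definition mvec :: "nat \<Rightarrow> (nat \<Rightarrow> int) \<Rightarrow> nat"
  where "mvec n a = Max ({i. 1 \<le> i \<and> i \<le> n \<and> a i \<noteq> 0} \<union> {1})"

definition evec :: "nat \<Rightarrow> nat \<Rightarrow> int"
  where "evec j i = (if i = j then 1 else 0)"

definition borel_ge :: "nat \<Rightarrow> (nat \<Rightarrow> int) \<Rightarrow> (nat \<Rightarrow> int) \<Rightarrow> bool"
  where "borel_ge n a b \<longleftrightarrow>
    (\<exists>\<alpha> :: nat \<Rightarrow> nat. \<forall>i. a i - b i = (\<Sum>j \<in> {1..<n}. int (\<alpha> j) * (evec j i - evec (j + 1) i)))"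

definition borel_set :: "nat \<Rightarrow> nat \<Rightarrow> (nat \<Rightarrow> int) set \<Rightarrow> bool"
  where "borel_set n d B \<longleftrightarrow> B \<subseteq> Nvec n d \<and>
    (\<forall>a \<in> B. \<forall>b \<in> Nvec n d. borel_ge n b a \<longrightarrow> b \<in> B)"

definition vshift :: "(nat \<Rightarrow> int) set \<Rightarrow> (nat \<Rightarrow> int) \<Rightarrow> (nat \<Rightarrow> int) set"
  where "vshift C \<rho> = (\<lambda>c i. c i + \<rho> i) ` C"

definition binomial_system ::
  "nat \<Rightarrow> nat \<Rightarrow> (nat \<Rightarrow> int) set \<Rightarrow> (nat \<Rightarrow> int) set \<Rightarrow> (nat \<Rightarrow> int) \<Rightarrow> bool"
  where "binomial_system n d A C \<rho> \<longleftrightarrow>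
    A \<subseteq> Nvec n d \<and> C \<subseteq> Nvec n d \<and> \<rho> \<in> Zvec n \<and>
    vshift C \<rho> \<subseteq> Nvec n d \<and>
    A \<inter> C = {} \<and> A \<inter> vshift C \<rho> = {} \<and> C \<inter> vshift C \<rho> = {} \<and>
    borel_set n d (A \<union> C) \<and> borel_set n d (A \<union> vshift C \<rho>)"

definition admissible :: "nat \<Rightarrow> (nat \<Rightarrow> int) set \<Rightarrow> (nat \<Rightarrow> int) \<Rightarrow> bool"
  where "admissible n C \<rho> \<longleftrightarrow> C = {} \<or> \<rho> (mvec n \<rho>) > 0"

definition Fideal :: "nat \<Rightarrow> (nat \<Rightarrow> int) set \<Rightarrow> (nat \<Rightarrow> int) set \<Rightarrow> (nat \<Rightarrow> int) \<Rightarrow>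
    'k::comm_ring_1 mpoly set"
  where "Fideal n A C \<rho> = Idl\<^bsub>poly_ring n\<^esub>
    ({Xmon n a | a. a \<in> A} \<union> {Xmon n c - Xmon n (\<lambda>i. c i + \<rho> i) | c. c \<in> C})"

text \<open>For a homogeneous ideal \<open>I\<close> of \<open>S = K[X\<^sub>1, \<dots>, X\<^sub>n]\<close>: the graded \<open>S\<close>-module \<open>S/I\<close> is
  sequentially Cohen-Macaulay. It is graded by the images of the \<open>S\<^sub>i\<close>.\<close>

definition quotient_seq_CM :: "nat \<Rightarrow> 'k::comm_ring_1 mpoly set \<Rightarrow> bool"
  where "quotient_seq_CM n I \<longleftrightarrow>
    sequentially_cohen_macaulay (poly_ring n) (poly_grading n)
      (quot_module (regular_module (poly_ring n)) I)
      (quot_grading (poly_ring n) (poly_grading n) I)"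

end

theory Submission
  imports Defs
begin

text \<open>Let \<open>I\<close> and \<open>J\<close> be the monomial ideals generated by the Borel sets \<open>A \<union> C\<close> and
  \<open>A \<union> (C + \<rho>)\<close>. Modulo \<open>F = F(A, C, \<rho>)\<close> a monomial \<open>X\<^sup>u\<close> in \<open>I\<close> either vanishes or equals
  \<open>X\<^sup>u\<^sup>+\<^sup>\<rho>\<close>, which lies in \<open>J\<close>. Because the set \<open>A\<close> is itself Borel and because the last nonzero
  entry of \<open>\<rho>\<close> is positive, these identifications never collide: every monomial is either zero, or
  outside \<open>I\<close>, or identified with exactly one monomial outside \<open>I\<close>. So the monomials outside \<open>I\<close>
  are a basis of \<open>S/F\<close>, and multiplication in that basis is explicit.

  The same picture persists after inverting a variable. For a Borel set \<open>B\<close> of degree \<open>d\<close>, the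
  monomial \<open>X\<^sup>u\<close> lies in \<open>(B) : X\<^sub>k\<^sup>\<infinity>\<close> if and only if the product of the first \<open>d\<close> letters of the
  infinite word \<open>X\<^sub>1 \<dots> X\<^sub>1 X\<^sub>2 \<dots> X\<^sub>k\<^sub>-\<^sub>1 X\<^sub>k X\<^sub>k X\<^sub>k \<dots>\<close>, with \<open>u\<^sub>i\<close> letters \<open>X\<^sub>i\<close> for \<open>i < k\<close>, has its
  exponent in \<open>B\<close>; call this exponent the truncation of \<open>u\<close> at \<open>k\<close>. Testing truncations instead of
  exponents turns the rewriting above into a rule \<open>nf k\<close> for every \<open>k\<close> from \<open>1\<close> to \<open>n + 1\<close>. The
  kernel \<open>F k\<close> of its linear extension is an ideal, a concrete model of \<open>F : X\<^sub>k\<^sup>\<infinity>\<close> for \<open>k \<le> n\<close>, and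
  \<open>F (n + 1) \<subseteq> F n \<subseteq> \<dots> \<subseteq> F 1 \<subseteq> F 0\<close>, where \<open>F (n + 1) = F\<close>, \<open>F n\<close> is the saturation of \<open>F\<close>, and
  \<open>F 0 = S\<close> by convention. Three properties of the rules carry the proof (lemmas \<open>nf_step\<close>,
  \<open>nf_nilpotent\<close>, \<open>nf_free\<close>): they are compatible with multiplication and with decreasing \<open>k\<close>; a
  fixed power of each of \<open>X\<^sub>1, \<dots>, X\<^sub>k\<close> maps \<open>F k\<close> into \<open>F (k + 1)\<close>; and the rule for \<open>k\<close> commutes
  with multiplication by \<open>X\<^sub>k, \<dots>, X\<^sub>n\<close>.

  Consequently \<open>F k / F (k + 1)\<close> is killed by powers of \<open>X\<^sub>1, \<dots>, X\<^sub>k\<close> and has a basis of monomials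
  that is stable under multiplication and division by \<open>X\<^sub>k\<^sub>+\<^sub>1, \<dots>, X\<^sub>n\<close>. Hence these variables form a
  regular sequence, and the quotient is zero or Cohen-Macaulay of dimension \<open>n - k\<close>. Dropping
  repetitions from the chain \<open>F (n + 1) \<subseteq> \<dots> \<subseteq> F 0\<close>, or from \<open>F n \<subseteq> \<dots> \<subseteq> F 0\<close>, gives the required
  filtrations, since \<open>n - k\<close> grows along them (lemma \<open>quotient_seq_CM_F\<close>).

  The dimension theory needed is obtained from one elementary argument: \<open>r + 1\<close> polynomials in \<open>r\<close>
  variables satisfy an algebraic relation, and such a relation bounds by \<open>r\<close> both the length of a
  chain of primes and the length of a regular sequence (lemma \<open>relation_chain\<close>).\<close>

section \<open>Partial sums, the Borel order and admissible binomial systems\<close>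

definition psum :: "(nat \<Rightarrow> int) \<Rightarrow> nat \<Rightarrow> int"
  where "psum a i = (\<Sum>l = 1..i. a l)"

definition capsum :: "nat \<Rightarrow> nat \<Rightarrow> (nat \<Rightarrow> int) \<Rightarrow> nat \<Rightarrow> int"
  where "capsum d k a i = (if i = 0 then 0 else if i < k then min (int d) (psum a i) else int d)"

text \<open>The truncation of \<open>a\<close> at \<open>k\<close> is defined through its partial sums \<open>capsum d k a\<close>. For \<open>k = n + 1\<close> the missing
  degree is filled up with a variable outside \<open>1, \<dots>, n\<close>, so that a vector of degree less than \<open>d\<close>
  has a truncation outside every set of vectors of length \<open>n\<close>; this makes the case \<open>k = n + 1\<close> an
  ordinary instance, describing membership in the ideal itself.\<close>
definition trunc :: "nat \<Rightarrow> nat \<Rightarrow> (nat \<Rightarrow> int) \<Rightarrow> nat \<Rightarrow> int"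
  where "trunc d k a i = (if i = 0 then 0 else capsum d k a i - capsum d k a (i - 1))"

definition nonneg_vec :: "nat \<Rightarrow> (nat \<Rightarrow> int) \<Rightarrow> bool"
  where "nonneg_vec n a \<longleftrightarrow> a \<in> Zvec n \<and> (\<forall>i. 0 \<le> a i)"

lemma psum_0 [simp]: "psum a 0 = 0"
  by (simp add: psum_def)

lemma psum_Suc [simp]: "psum a (Suc i) = psum a i + a (Suc i)"
  by (simp add: psum_def)

lemma psum_add: "psum (\<lambda>i. a i + b i) j = psum a j + psum b j"
  by (simp add: psum_def sum.distrib)

lemma psum_mono:
  assumes "nonneg_vec n a" "i \<le> j" shows "psum a i \<le> psum a j"
  using assms(2)
proof (induction rule: dec_induct)
  case (step m)
  then show ?case using assms(1) unfolding nonneg_vec_def by (simp add: add_increasing2)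
qed simp

lemma psum_nonneg: "nonneg_vec n a \<Longrightarrow> 0 \<le> psum a i"
  using psum_mono[of n a 0 i] by simp

lemma psum_const:
  assumes "\<And>l. i < l \<Longrightarrow> l \<le> j \<Longrightarrow> a l = 0" "i \<le> j" shows "psum a j = psum a i"
  using assms(2,1) by (induction rule: dec_induct) auto

lemma Zvec_psum_inj:
  assumes "a \<in> Zvec n" "b \<in> Zvec n" "\<And>i. psum a i = psum b i" shows "a = b"
proof
  fix i show "a i = b i"
  proof (cases i)
    case 0 then show ?thesis using assms(1,2) by (simp add: Zvec_def)
  next
    case (Suc j)
    then show ?thesis using assms(3)[of i] assms(3)[of j] by simp
  qed
qed

lemma Nvec_iff: "a \<in> Nvec n d \<longleftrightarrow> nonneg_vec n a \<and> psum a n = int d"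
  by (auto simp: Nvec_def nonneg_vec_def psum_def)

lemma psum_top: "a \<in> Zvec n \<Longrightarrow> n \<le> i \<Longrightarrow> psum a i = psum a n"
  by (rule psum_const) (auto simp: Zvec_def)

lemma Nvec_psum_le: "a \<in> Nvec n d \<Longrightarrow> psum a i \<le> int d"
  by (metis Nvec_iff linorder_le_cases nonneg_vec_def order.refl psum_mono psum_top)

lemma Nvec_psum_top: "a \<in> Nvec n d \<Longrightarrow> n \<le> i \<Longrightarrow> psum a i = int d"
  by (metis Nvec_iff nonneg_vec_def psum_top)

text \<open>The coefficients \<open>\<alpha>\<^sub>j\<close> of the Borel order are the differences of the partial sums, by
  summation by parts.\<close>
lemma borel_ge_psum:
  assumes "a \<in> Nvec n d" "b \<in> Nvec n d" "\<And>i. psum a i \<le> psum b i"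
  shows "borel_ge n b a"
  unfolding borel_ge_def
proof (intro exI allI)
  define \<alpha> where "\<alpha> j = nat (psum b j - psum a j)" for j
  fix i
  have int_\<alpha>: "int (\<alpha> j) = psum b j - psum a j" for j
    using assms(3)[of j] by (simp add: \<alpha>_def)
  have "(\<Sum>j\<in>{1..<n}. int (\<alpha> j) * (evec j i - evec (j + 1) i)) =
      (\<Sum>j\<in>{1..<n}. if j = i then int (\<alpha> j) else 0) - (\<Sum>j\<in>{1..<n}. if j + 1 = i then int (\<alpha> j) else 0)"
    unfolding sum_subtractf[symmetric] by (rule sum.cong) (auto simp: evec_def)
  also have "(\<Sum>j\<in>{1..<n}. if j = i then int (\<alpha> j) else 0) = (if 1 \<le> i \<and> i < n then int (\<alpha> i) else 0)"
    by (simp add: sum.delta)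
  also have "(\<Sum>j\<in>{1..<n}. if j + 1 = i then int (\<alpha> j) else 0) = (if 2 \<le> i \<and> i \<le> n then int (\<alpha> (i - 1)) else 0)"
  proof -
    have "(\<Sum>j\<in>{1..<n}. if j + 1 = i then int (\<alpha> j) else 0) =
        (\<Sum>j\<in>{1..<n}. if j = i - 1 then (if i = 0 then 0 else int (\<alpha> j)) else 0)"
      by (rule sum.cong) auto
    then show ?thesis by (auto simp: sum.delta)
  qed
  finally have *: "(\<Sum>j\<in>{1..<n}. int (\<alpha> j) * (evec j i - evec (j + 1) i)) =
     (if 1 \<le> i \<and> i < n then int (\<alpha> i) else 0) - (if 2 \<le> i \<and> i \<le> n then int (\<alpha> (i - 1)) else 0)" .
  have zero: "a i = 0" "b i = 0" if "i \<notin> {1..n}"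
    using assms(1,2) that by (auto simp: Nvec_def Zvec_def)
  have diff: "b i - a i = (psum b i - psum a i) - (psum b (i - 1) - psum a (i - 1))" if "1 \<le> i"
    using that by (cases i) auto
  have "psum b n = psum a n" using assms(1,2) by (simp add: Nvec_iff)
  then show "b i - a i = (\<Sum>j\<in>{1..<n}. int (\<alpha> j) * (evec j i - evec (j + 1) i))"
    unfolding * unfolding int_\<alpha> using zero diff by (cases "i = n"; cases "i = 1") auto
qed

lemma psum_trunc: "psum (trunc d k a) i = capsum d k a i"
  by (induction i) (auto simp: trunc_def capsum_def)

lemma capsum_le: "capsum d k a i \<le> int d"
  by (auto simp: capsum_def)

lemma capsum_mono_index:
  assumes "nonneg_vec n a" "i \<le> j" shows "capsum d k a i \<le> capsum d k a j"
  using psum_mono[OF assms] psum_nonneg[OF assms(1)] assms(2) by (auto simp: capsum_def)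

lemma trunc_nonneg: "nonneg_vec n a \<Longrightarrow> 0 \<le> trunc d k a i"
  using capsum_mono_index[of n a "i - 1" i d k] by (auto simp: trunc_def)

lemma trunc_le:
  assumes "nonneg_vec n a" "i < k" shows "trunc d k a i \<le> a i"
proof (cases i)
  case (Suc j)
  moreover have "0 \<le> a i" using assms(1) by (simp add: nonneg_vec_def)
  ultimately show ?thesis using assms psum_nonneg[OF assms(1), of j]
    by (auto simp: trunc_def capsum_def)
qed (use assms in \<open>auto simp: trunc_def nonneg_vec_def\<close>)

lemma trunc_Nvec:
  assumes "nonneg_vec n a" "capsum d k a n = int d" "n > 0"
  shows "trunc d k a \<in> Nvec n d"
proof -
  have top: "capsum d k a i = int d" if "n \<le> i" for i
    using capsum_mono_index[OF assms(1) that, of d k] capsum_le[of d k a i] assms(2) by simp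
  have "trunc d k a i = 0" if "n < i" for i
    using top[of i] top[of "i - 1"] that by (simp add: trunc_def)
  then have "trunc d k a \<in> Zvec n"
    by (auto simp: Zvec_def trunc_def)
  then show ?thesis
    using trunc_nonneg[OF assms(1)] assms(2) by (simp add: Nvec_iff nonneg_vec_def psum_trunc)
qed

text \<open>The source of all monotonicity below: since the Borel order compares partial sums,
  membership of a truncation survives every operation that does not decrease the partial sums.\<close>
lemma trunc_borel:
  assumes B: "borel_set n d B" and a: "trunc d k a \<in> B" and b: "nonneg_vec n b" and "n > 0"
    and le: "\<And>i. 1 \<le> i \<Longrightarrow> i \<le> n \<Longrightarrow> capsum d k a i \<le> capsum d k' b i"
  shows "trunc d k' b \<in> B"
proof -
  have aN: "trunc d k a \<in> Nvec n d" using B a by (auto simp: borel_set_def)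
  then have "capsum d k a n = int d" by (simp add: Nvec_iff psum_trunc)
  then have bd: "capsum d k' b n = int d"
    using le[of n] capsum_le[of d k' b n] \<open>n > 0\<close> by simp
  have bN: "trunc d k' b \<in> Nvec n d" by (rule trunc_Nvec[OF b bd \<open>n > 0\<close>])
  have "psum (trunc d k a) i \<le> psum (trunc d k' b) i" for i
  proof (cases "i = 0 \<or> n < i")
    case True
    then show ?thesis
      using Nvec_psum_top[OF aN, of i] Nvec_psum_top[OF bN, of i] by auto
  next
    case False
    then show ?thesis using le[of i] by (auto simp: psum_trunc)
  qed
  then have "borel_ge n (trunc d k' b) (trunc d k a)" using borel_ge_psum aN bN by blast
  then show ?thesis using B a bN by (auto simp: borel_set_def)
qed

locale admissible_binomial_system =
  fixes n d :: nat and A C :: "(nat \<Rightarrow> int) set" and \<rho> :: "nat \<Rightarrow> int"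
  assumes n_pos: "0 < n"
    and system: "binomial_system n d A C \<rho>"
    and adm: "admissible n C \<rho>"
begin

abbreviation shifted :: "(nat \<Rightarrow> int) set" ("C\<rho>") where "C\<rho> \<equiv> vshift C \<rho>"
abbreviation mr :: nat where "mr \<equiv> mvec n \<rho>"

lemma borel: "borel_set n d (A \<union> C)" "borel_set n d (A \<union> C\<rho>)"
  and disjoint: "A \<inter> C = {}" "A \<inter> C\<rho> = {}" "C \<inter> C\<rho> = {}"
  and Nvec: "A \<subseteq> Nvec n d" "C \<subseteq> Nvec n d" "C\<rho> \<subseteq> Nvec n d"
  and \<rho>_Zvec: "\<rho> \<in> Zvec n"
  using system by (auto simp: binomial_system_def)

text \<open>The disjointness conditions make \<open>A\<close> the intersection of the two given Borel sets.\<close>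
lemma borel_A: "borel_set n d A"
  using borel disjoint unfolding borel_set_def by blast

lemma shift_mem: "c \<in> C \<Longrightarrow> (\<lambda>i. c i + \<rho> i) \<in> C\<rho>"
  by (auto simp: vshift_def)

lemma shift_Nvec: "c \<in> C \<Longrightarrow> (\<lambda>i. c i + \<rho> i) \<in> Nvec n d"
  using shift_mem Nvec(3) by blast

lemma psum_\<rho>_top:
  assumes "c \<in> C" shows "psum \<rho> n = 0"
proof -
  have "c \<in> Nvec n d" using assms Nvec by blast
  then show ?thesis
    using shift_Nvec[OF assms] by (simp add: Nvec_iff psum_add)
qed

lemma psum_\<rho>_ge:
  assumes "c \<in> C" shows "- int d \<le> psum \<rho> i"
proof -
  have "c \<in> Nvec n d" using assms Nvec by blast
  moreover have "0 \<le> psum c i + psum \<rho> i"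
    using shift_Nvec[OF assms] psum_nonneg[of n "\<lambda>i. c i + \<rho> i" i] by (simp add: Nvec_iff psum_add)
  ultimately show ?thesis using Nvec_psum_le[of c n d i] by simp
qed

lemma mr_ge: "1 \<le> mr"
  by (auto simp: mvec_def)

lemma \<rho>_above: "mr < i \<Longrightarrow> \<rho> i = 0"
proof (rule ccontr)
  assume i: "mr < i" and "\<rho> i \<noteq> 0"
  then have "i \<in> {i. 1 \<le> i \<and> i \<le> n \<and> \<rho> i \<noteq> 0} \<union> {1}"
    using \<rho>_Zvec by (auto simp: Zvec_def)
  then have "i \<le> mr" unfolding mvec_def by (intro Max_ge) auto
  with i show False by simp
qed

lemma \<rho>_mr: "c \<in> C \<Longrightarrow> 0 < \<rho> mr"
  using adm by (auto simp: admissible_def)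

text \<open>This is the point where admissibility enters: if \<open>c\<close> had support beyond \<open>i\<close> while
  \<open>c + \<rho>\<close> has none, then the last nonzero entry of \<open>\<rho>\<close> would be negative.\<close>
lemma psum_shift_full:
  assumes "c \<in> C" "psum (\<lambda>i. c i + \<rho> i) i = int d"
  shows "psum c i = int d"
proof (rule ccontr)
  assume ne: "psum c i \<noteq> int d"
  have cN: "c \<in> Nvec n d" using assms Nvec by blast
  have sN: "(\<lambda>i. c i + \<rho> i) \<in> Nvec n d" using shift_Nvec assms by blast
  let ?s = "\<lambda>i. c i + \<rho> i"
  have full: "psum ?s j = int d" if "i \<le> j" for j
  proof (rule antisym)
    show "psum ?s j \<le> int d" by (rule Nvec_psum_le[OF sN])
    have "nonneg_vec n ?s" using sN unfolding Nvec_iff by blast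
    then show "int d \<le> psum ?s j" using psum_mono[of n ?s i j] assms(2) that by simp
  qed
  have zero: "c l + \<rho> l = 0" if "i < l" for l
    using full[of l] full[of "l - 1"] that by (cases l) auto
  have "\<exists>l>i. c l \<noteq> 0"
  proof (rule ccontr)
    assume "\<not> (\<exists>l>i. c l \<noteq> 0)"
    then have "psum c (max i n) = psum c i" by (intro psum_const) auto
    then show False using Nvec_psum_top[OF cN, of "max i n"] ne by simp
  qed
  then obtain l where "l > i" "c l \<noteq> 0" by blast
  then have "\<rho> l \<noteq> 0" using zero by fastforce
  then have "i < mr" using \<rho>_above[of l] \<open>l > i\<close> by (meson linorder_not_less order_less_le_trans)
  moreover have "0 \<le> c mr" using cN by (simp add: Nvec_iff nonneg_vec_def)
  ultimately have "\<rho> mr \<le> 0" using zero[of mr] by simp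
  then show False using \<rho>_mr[OF assms(1)] by simp
qed

text \<open>Truncation commutes with the shift backwards along \<open>\<rho>\<close>. Below degree \<open>d\<close> the partial
  sums of the two truncations differ by those of \<open>\<rho>\<close>; where the shifted one is full, admissibility
  forces the unshifted one to be full as well.\<close>
lemma target_source:
  assumes a: "nonneg_vec n a" and b: "nonneg_vec n (\<lambda>i. a i + \<rho> i)"
    and "trunc d k (\<lambda>i. a i + \<rho> i) \<in> C\<rho>"
  shows "trunc d k a \<in> C"
proof -
  obtain c where c: "c \<in> C" and eq: "trunc d k (\<lambda>i. a i + \<rho> i) = (\<lambda>i. c i + \<rho> i)"
    using assms(3) by (auto simp: vshift_def)
  have cN: "c \<in> Nvec n d" using c Nvec by blast
  have sums: "capsum d k (\<lambda>i. a i + \<rho> i) i = psum c i + psum \<rho> i" for i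
    using arg_cong[OF eq, of "\<lambda>f. psum f i"] by (simp add: psum_trunc psum_add)
  have key: "psum c i = capsum d k a i" for i
  proof (cases "i = 0")
    case False
    show ?thesis
    proof (cases "i < k \<and> psum a i + psum \<rho> i \<le> int d")
      case True
      then show ?thesis using sums[of i] False Nvec_psum_le[OF cN, of i]
        by (auto simp: capsum_def psum_add)
    next
      case full: False
      then have "capsum d k (\<lambda>i. a i + \<rho> i) i = int d"
        using False by (auto simp: capsum_def psum_add)
      then have ci: "psum c i = int d"
        using psum_shift_full[OF c, of i] sums[of i] by (simp add: psum_add)
      then have "psum \<rho> i = 0" using sums[of i] \<open>capsum d k (\<lambda>i. a i + \<rho> i) i = int d\<close> by simp
      then show ?thesis using full ci False by (auto simp: capsum_def)
    qed
  qed (simp add: capsum_def)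
  have "capsum d k a n = int d" using key[of n] cN by (simp add: Nvec_iff)
  then have "trunc d k a \<in> Nvec n d" by (rule trunc_Nvec[OF a _ n_pos])
  then have "trunc d k a = c"
    using cN by (intro Zvec_psum_inj[of _ n]) (auto simp: Nvec_iff nonneg_vec_def psum_trunc key)
  then show ?thesis using c by simp
qed

text \<open>Below \<open>k\<close> the truncation, an element of \<open>C\<close>, is bounded by \<open>a\<close>; from \<open>k\<close> on, all
  entries of \<open>\<rho>\<close> are nonnegative because \<open>\<rho>\<close> ends at \<open>m(\<rho>)\<close> with a positive entry.\<close>
lemma source_shift_nonneg:
  assumes a: "nonneg_vec n a" and "mr \<le> k" and c: "trunc d k a \<in> C"
  shows "nonneg_vec n (\<lambda>i. a i + \<rho> i)"
proof -
  have "0 \<le> a i + \<rho> i" for i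
  proof (cases "i < k")
    case True
    have "0 \<le> trunc d k a i + \<rho> i" using shift_Nvec[OF c] unfolding Nvec_iff nonneg_vec_def by blast
    then show ?thesis using trunc_le[OF a True, of d] by linarith
  next
    case False
    then have "mr = i \<or> mr < i" using assms(2) by linarith
    then have "0 \<le> \<rho> i" using \<rho>_mr[OF c] \<rho>_above[of i] by (metis order.refl order_less_imp_le)
    then show ?thesis using a unfolding nonneg_vec_def by (meson add_nonneg_nonneg)
  qed
  moreover have "(\<lambda>i. a i + \<rho> i) \<in> Zvec n" using a \<rho>_Zvec by (simp add: nonneg_vec_def Zvec_def)
  ultimately show ?thesis unfolding nonneg_vec_def by blast
qed

text \<open>Forwards the shift commutes with truncation only up to the Borel order, so the result may
  leave \<open>C + \<rho>\<close> and fall into \<open>A\<close>.\<close>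
lemma source_shift_trunc:
  assumes a: "nonneg_vec n a" and b: "nonneg_vec n (\<lambda>i. a i + \<rho> i)" and c: "trunc d k a \<in> C"
  shows "trunc d k (\<lambda>i. a i + \<rho> i) \<in> A \<union> C\<rho>"
proof -
  let ?c = "\<lambda>i. trunc d k a i + \<rho> i"
  have cN: "?c \<in> Nvec n d" using shift_Nvec[OF c] .
  have tN: "trunc d k a \<in> Nvec n d" using c Nvec by blast
  have le: "psum ?c i \<le> capsum d k (\<lambda>i. a i + \<rho> i) i" for i
    using Nvec_psum_le[OF cN, of i] by (auto simp: capsum_def psum_add psum_trunc)
  have top: "capsum d k (\<lambda>i. a i + \<rho> i) n = int d"
    using le[of n] capsum_le[of d k "\<lambda>i. a i + \<rho> i" n] Nvec_psum_top[OF cN, of n] by simp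
  have "trunc d k (\<lambda>i. a i + \<rho> i) \<in> Nvec n d" by (rule trunc_Nvec[OF b top n_pos])
  moreover have "borel_ge n (trunc d k (\<lambda>i. a i + \<rho> i)) ?c"
    by (rule borel_ge_psum[OF cN calculation]) (use le in \<open>simp add: psum_trunc\<close>)
  moreover have "?c \<in> A \<union> C\<rho>" using shift_mem[OF c] by simp
  ultimately show ?thesis using borel(2) by (auto simp: borel_set_def)
qed

text \<open>A vector of \<open>C + \<rho>\<close> is positive at \<open>m(\<rho>)\<close>, whereas a truncation vanishes as soon as its
  partial sums have reached \<open>d\<close>.\<close>
lemma target_mr_le:
  assumes v: "nonneg_vec n v" and t: "trunc d k v \<in> C\<rho>" and j: "1 \<le> j" "k \<le> j \<or> int d \<le> psum v j"
  shows "mr \<le> j"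
proof (rule ccontr)
  assume "\<not> mr \<le> j"
  then have less: "j < mr" by simp
  obtain c where c: "c \<in> C" and eq: "trunc d k v = (\<lambda>i. c i + \<rho> i)"
    using t by (auto simp: vshift_def)
  have full: "capsum d k v i = int d" if "j \<le> i" for i
    using j that psum_mono[OF v that] by (auto simp: capsum_def)
  have "trunc d k v mr = 0"
    using full[of mr] full[of "mr - 1"] less by (simp add: trunc_def)
  moreover have "c mr \<ge> 0" using c Nvec by (auto simp: Nvec_def)
  ultimately show False using \<rho>_mr[OF c] fun_cong[OF eq, of mr] by simp
qed

end

section \<open>Truncated exponents and the reduction rules\<close>

abbreviation single :: "'a \<Rightarrow> 'b \<Rightarrow> 'a \<Rightarrow>\<^sub>0 'b::zero" where "single \<equiv> Poly_Mapping.single"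
abbreviation lookup :: "('a \<Rightarrow>\<^sub>0 'b::zero) \<Rightarrow> 'a \<Rightarrow> 'b" where "lookup \<equiv> Poly_Mapping.lookup"
abbreviation keys :: "('a \<Rightarrow>\<^sub>0 'b::zero) \<Rightarrow> 'a set" where "keys \<equiv> Poly_Mapping.keys"

type_synonym expo = "nat \<Rightarrow>\<^sub>0 nat"

definition vec :: "expo \<Rightarrow> nat \<Rightarrow> int"
  where "vec u i = int (lookup u i)"

definition expos :: "nat \<Rightarrow> expo set"
  where "expos n = {u. keys u \<subseteq> {1..n}}"

lemma vec_add: "vec (u + v) = (\<lambda>i. vec u i + vec v i)"
  by (simp add: vec_def lookup_add fun_eq_iff)

lemma vec_inj: "vec u = vec v \<longleftrightarrow> u = v"
  by (auto simp: vec_def fun_eq_iff poly_mapping_eq_iff)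

lemma nonneg_vec_vec: "nonneg_vec n (vec u) \<longleftrightarrow> u \<in> expos n"
proof -
  have "(\<forall>i. i \<notin> {1..n} \<longrightarrow> lookup u i = 0) \<longleftrightarrow> keys u \<subseteq> {1..n}"
    unfolding subset_iff in_keys_iff by metis
  then show ?thesis unfolding nonneg_vec_def Zvec_def vec_def expos_def by simp
qed

lemma keys_add_expo: "keys (u + v) = keys u \<union> keys (v :: expo)"
  by (auto simp: in_keys_iff lookup_add)

lemma expos_add [simp]: "u + v \<in> expos n \<longleftrightarrow> u \<in> expos n \<and> v \<in> expos n"
  by (auto simp: expos_def keys_add_expo)

lemma expos_single: "j \<in> {1..n} \<Longrightarrow> single j t \<in> expos n"
  by (auto simp: expos_def)

lemma expos_zero [simp]: "0 \<in> expos n"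
  by (simp add: expos_def)

lemma psum_single: "1 \<le> j \<Longrightarrow> psum (vec (single j t)) i = (if j \<le> i then int t else 0)"
proof (induction i)
  case (Suc i)
  then show ?case by (auto simp: vec_def lookup_single when_def)
qed auto

lemma trunc_full: "a \<in> Nvec n d \<Longrightarrow> trunc d (Suc n) a = a"
proof (rule Zvec_psum_inj)
  assume a: "a \<in> Nvec n d"
  then show "a \<in> Zvec n" by (simp add: Nvec_def)
  show eq: "psum (trunc d (Suc n) a) i = psum a i" for i
    using a Nvec_psum_le[OF a, of i] Nvec_psum_top[OF a, of i] by (auto simp: psum_trunc capsum_def)
  show "trunc d (Suc n) a \<in> Zvec n"
    using a Nvec_psum_top[OF a] by (auto simp: Zvec_def trunc_def capsum_def Nvec_def)
qed

context admissible_binomial_system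
begin

definition shift :: "expo \<Rightarrow> expo"
  where "shift u = Abs_poly_mapping (\<lambda>i. nat (vec u i + \<rho> i))"

definition shiftable :: "expo \<Rightarrow> bool"
  where "shiftable u \<longleftrightarrow> nonneg_vec n (\<lambda>i. vec u i + \<rho> i)"

text \<open>Membership of \<open>X\<^sup>u\<close> in \<open>(B) : X\<^sub>k\<^sup>\<infinity>\<close> for a Borel set \<open>B\<close>. Declaring everything to be a member
  for \<open>k = 0\<close> makes the whole ring the last term of the chain.\<close>
definition in_colon :: "(nat \<Rightarrow> int) set \<Rightarrow> nat \<Rightarrow> expo \<Rightarrow> bool"
  where "in_colon B k u \<longleftrightarrow> k = 0 \<or> trunc d k (vec u) \<in> B"

text \<open>Normal form of a monomial: \<open>None\<close> stands for zero. The shift is tested on the shifted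
  monomial, since by \<open>target_source\<close> this already ensures that the original one came from \<open>C\<close>.\<close>
definition nf :: "nat \<Rightarrow> expo \<Rightarrow> expo option"
  where "nf k u = (if \<not> in_colon (A \<union> C) k u then Some u
     else if 0 < k \<and> shiftable u \<and> trunc d k (vec (shift u)) \<in> C\<rho> then Some (shift u) else None)"

lemma vec_shift:
  assumes "shiftable u" shows "vec (shift u) = (\<lambda>i. vec u i + \<rho> i)"
proof -
  have nn: "0 \<le> vec u i + \<rho> i" for i using assms by (simp add: shiftable_def nonneg_vec_def)
  have "finite {i. nat (vec u i + \<rho> i) \<noteq> 0}"
    by (rule finite_subset[of _ "{1..n}"]) (use assms in \<open>auto simp: shiftable_def nonneg_vec_def Zvec_def\<close>)
  then have "lookup (shift u) = (\<lambda>i. nat (vec u i + \<rho> i))"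
    by (simp add: shift_def)
  then show ?thesis using nn by (simp add: vec_def fun_eq_iff)
qed

lemma shift_eqI:
  assumes "vec v = (\<lambda>i. vec u i + \<rho> i)" "v \<in> expos n" shows "shiftable u" "shift u = v"
proof -
  show s: "shiftable u" using assms nonneg_vec_vec[of n v] by (simp add: shiftable_def)
  show "shift u = v" using vec_shift[OF s] assms(1) by (simp flip: vec_inj)
qed

lemma shift_expos: "shiftable u \<Longrightarrow> shift u \<in> expos n"
  using vec_shift[of u] by (simp add: shiftable_def flip: nonneg_vec_vec)

lemma shift_add:
  assumes "shiftable u" "w \<in> expos n" shows "shiftable (w + u)" "shift (w + u) = w + shift u"
proof -
  have "vec (w + shift u) = (\<lambda>i. vec (w + u) i + \<rho> i)"
    unfolding vec_add vec_shift[OF assms(1)] by (simp only: add.assoc)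
  moreover have "w + shift u \<in> expos n" using assms shift_expos by simp
  ultimately show "shiftable (w + u)" "shift (w + u) = w + shift u" using shift_eqI by blast+
qed

lemma target_source':
  assumes "u \<in> expos n" "shiftable u" "trunc d k (vec (shift u)) \<in> C\<rho>"
  shows "trunc d k (vec u) \<in> C"
  using target_source[of "vec u" k] assms by (simp add: nonneg_vec_vec shiftable_def vec_shift)

lemma in_colon_add:
  assumes B: "borel_set n d B" and u: "u \<in> expos n" "w \<in> expos n" and "in_colon B k u" "k' \<le> k"
  shows "in_colon B k' (w + u)"
proof (cases "k' = 0")
  case False
  have nn: "nonneg_vec n (vec (w + u))" using u by (simp add: nonneg_vec_vec)
  have t: "trunc d k (vec u) \<in> B" using assms False by (simp add: in_colon_def)
  have "trunc d k' (vec (w + u)) \<in> B"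
    by (rule trunc_borel[OF B t nn n_pos])
       (use assms psum_nonneg[of n "vec w"] in \<open>auto simp: capsum_def vec_add psum_add nonneg_vec_vec min_def add_increasing\<close>)
  then show ?thesis by (simp add: in_colon_def)
qed (simp add: in_colon_def)

lemma in_colon_single:
  assumes B: "borel_set n d B" and u: "u \<in> expos n" and "in_colon B k u" "1 \<le> j" "j \<le> k" "k \<le> n" "d \<le> t"
  shows "in_colon B (Suc k) (single j t + u)"
proof -
  have jn: "j \<in> {1..n}" using assms by simp
  have nn: "nonneg_vec n (vec (single j t + u))" using u expos_single[OF jn] by (simp add: nonneg_vec_vec)
  have t: "trunc d k (vec u) \<in> B" using assms by (simp add: in_colon_def)
  have nn': "0 \<le> psum (vec u) i" for i using psum_nonneg[of n "vec u"] u by (simp add: nonneg_vec_vec)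
  have "trunc d (Suc k) (vec (single j t + u)) \<in> B"
    by (rule trunc_borel[OF B t nn n_pos])
      (use assms nn' in \<open>auto simp: capsum_def vec_add psum_add psum_single[OF assms(4)] min_def add_increasing add_increasing2\<close>)
  then show ?thesis by (simp add: in_colon_def)
qed

text \<open>If the shifted monomial stays outside the ideal of \<open>A\<close>, it is the common normal form;
  otherwise both sides vanish, the second one because a further shift would need its truncation to
  lie in \<open>C\<close>.\<close>
lemma nf_shift_eq:
  assumes u: "u \<in> expos n" "shiftable u" and I: "in_colon (A \<union> C) k u" and J: "in_colon (A \<union> C\<rho>) k (shift u)"
  shows "nf k u = nf k (shift u)"
proof (cases "k = 0")
  case False
  show ?thesis
  proof (cases "trunc d k (vec (shift u)) \<in> C\<rho>")
    case True
    then have "\<not> in_colon (A \<union> C) k (shift u)" using disjoint False by (auto simp: in_colon_def)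
    then show ?thesis using True I u False by (simp add: nf_def)
  next
    case no: False
    then have inA: "trunc d k (vec (shift u)) \<in> A" using J False by (auto simp: in_colon_def)
    have "\<not> (shiftable (shift u) \<and> trunc d k (vec (shift (shift u))) \<in> C\<rho>)"
      using target_source'[OF shift_expos[OF u(2)]] inA disjoint by blast
    then show ?thesis using inA no I by (auto simp: nf_def in_colon_def)
  qed
qed (simp add: nf_def in_colon_def)

text \<open>Reducing \<open>u\<close> with rule \<open>k\<close> before reducing \<open>w + u\<close> with rule \<open>k'\<close> changes nothing. Only two
  properties of the passage from \<open>(k, u)\<close> to \<open>(k', w + u)\<close> matter: membership in Borel ideals is
  preserved, and if \<open>w + u\<close> admits a shift then \<open>m(\<rho>) \<le> k\<close>, which guarantees that \<open>u\<close> itself can be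
  shifted.\<close>
lemma nf_bind:
  assumes u: "u \<in> expos n" "w \<in> expos n"
    and up: "\<And>B v. borel_set n d B \<Longrightarrow> v \<in> expos n \<Longrightarrow> in_colon B k v \<Longrightarrow> in_colon B k' (w + v)"
    and mr: "shiftable (w + u) \<Longrightarrow> 0 < k' \<Longrightarrow> trunc d k' (vec (shift (w + u))) \<in> C\<rho> \<Longrightarrow> mr \<le> k"
  shows "nf k' (w + u) = Option.bind (nf k u) (\<lambda>v. nf k' (w + v))"
proof -
  consider (normal) "\<not> in_colon (A \<union> C) k u"
    | (shift) "in_colon (A \<union> C) k u" "0 < k" "shiftable u" "trunc d k (vec (shift u)) \<in> C\<rho>"
    | (zero) "in_colon (A \<union> C) k u" "\<not> (0 < k \<and> shiftable u \<and> trunc d k (vec (shift u)) \<in> C\<rho>)"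
    by blast
  then show ?thesis
  proof cases
    case normal
    then show ?thesis by (simp add: nf_def)
  next
    case shift
    have "in_colon (A \<union> C) k' (w + u)" using up borel u shift by blast
    moreover have "in_colon (A \<union> C\<rho>) k (shift u)" using shift by (simp add: in_colon_def)
    then have "in_colon (A \<union> C\<rho>) k' (shift (w + u))"
      using up borel shift_expos[OF shift(3)] shift_add(2)[OF shift(3) u(2)] by simp
    ultimately have "nf k' (w + u) = nf k' (shift (w + u))"
      using u shift_add(1)[OF shift(3) u(2)] by (intro nf_shift_eq) auto
    then show ?thesis using shift shift_add(2)[OF shift(3) u(2)] by (simp add: nf_def[of k])
  next
    case zero
    have I: "in_colon (A \<union> C) k' (w + u)" using up borel u zero by blast
    have "False" if t: "0 < k'" "shiftable (w + u)" "trunc d k' (vec (shift (w + u))) \<in> C\<rho>"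
    proof -
      \<comment> \<open>a monomial killed by rule \<open>k\<close> cannot be revived by rule \<open>k'\<close>: if \<open>w + u\<close> could be shifted, then so could \<open>u\<close>, but the shift of \<open>u\<close> lies in the ideal of \<open>A\<close>, and so does the shift of \<open>w + u\<close>\<close>
      have src: "trunc d k' (vec (w + u)) \<in> C" using target_source' t u by simp
      have "mr \<le> k" using mr t by blast
      then have "k > 0" using mr_ge by simp
      have "\<not> in_colon A k' (w + u)" using src disjoint t by (auto simp: in_colon_def)
      then have "\<not> in_colon A k u" using up borel_A u by blast
      then have kC: "trunc d k (vec u) \<in> C" using zero \<open>k > 0\<close> by (auto simp: in_colon_def)
      have nn: "nonneg_vec n (vec u)" using u by (simp add: nonneg_vec_vec)
      have s: "shiftable u"
        using source_shift_nonneg[OF nn \<open>mr \<le> k\<close> kC] by (simp add: shiftable_def)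
      have "trunc d k (vec (shift u)) \<in> A \<union> C\<rho>"
        using source_shift_trunc[OF nn _ kC] s by (simp add: shiftable_def vec_shift)
      then have "in_colon A k (shift u)" using zero(2) s \<open>k > 0\<close> by (auto simp: in_colon_def)
      then have "in_colon A k' (shift (w + u))"
        using up borel_A shift_expos[OF s] shift_add(2)[OF s u(2)] by simp
      then show False using t disjoint by (auto simp: in_colon_def)
    qed
    then have "nf k' (w + u) = None" using I by (auto simp: nf_def)
    moreover have "nf k u = None" using zero by (auto simp: nf_def)
    ultimately show ?thesis by simp
  qed
qed

lemma nf_step:
  assumes "u \<in> expos n" "w \<in> expos n" "k' \<le> k"
  shows "nf k' (w + u) = Option.bind (nf k u) (\<lambda>v. nf k' (w + v))"
proof (rule nf_bind[OF assms(1,2)])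
  show "in_colon B k' (w + v)" if "borel_set n d B" "v \<in> expos n" "in_colon B k v" for B v
    using in_colon_add that assms by blast
  assume "shiftable (w + u)" "0 < k'" "trunc d k' (vec (shift (w + u))) \<in> C\<rho>"
  then have "mr \<le> k'"
    using target_mr_le[of "vec (shift (w + u))" k' k'] shift_expos by (simp add: nonneg_vec_vec)
  then show "mr \<le> k" using assms by simp
qed

text \<open>The exponent \<open>2 * d\<close> serves twice: \<open>d\<close> fills the truncation at \<open>j\<close>, and another \<open>d\<close>
  compensates for the partial sums of \<open>\<rho>\<close>, which are at least \<open>-d\<close>. A shiftable product then has
  \<open>m(\<rho>) \<le> j\<close>.\<close>
lemma nf_nilpotent:
  assumes "u \<in> expos n" "1 \<le> j" "j \<le> k" "k \<le> n"
  shows "nf (Suc k) (single j (2 * d) + u) =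
    Option.bind (nf k u) (\<lambda>v. nf (Suc k) (single j (2 * d) + v))"
proof (rule nf_bind[OF assms(1)])
  show w: "single j (2 * d) \<in> expos n" using assms by (intro expos_single) auto
  show "in_colon B (Suc k) (single j (2 * d) + v)" if "borel_set n d B" "v \<in> expos n" "in_colon B k v" for B v
    using in_colon_single that assms by simp
  let ?v = "single j (2 * d) + u"
  assume t: "shiftable ?v" "0 < Suc k" "trunc d (Suc k) (vec (shift ?v)) \<in> C\<rho>"
  obtain c where c: "c \<in> C" using t by (auto simp: vshift_def)
  have "psum (vec (shift ?v)) j = int (2 * d) + psum (vec u) j + psum \<rho> j"
    using assms by (simp add: vec_shift[OF t(1)] psum_add vec_add psum_single)
  also have "\<dots> \<ge> int d"
    using psum_\<rho>_ge[OF c, of j] psum_nonneg[of n "vec u" j] assms by (simp add: nonneg_vec_vec)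
  finally have "mr \<le> j"
    using target_mr_le[of "vec (shift ?v)" "Suc k" j] t shift_expos assms by (simp add: nonneg_vec_vec)
  then show "mr \<le> k" using assms by simp
qed

lemma trunc_add_above:
  assumes "keys w \<subseteq> {k..n}" shows "trunc d k (vec (w + u)) = trunc d k (vec u)"
proof -
  have "psum (vec w) i = psum (vec w) 0" if "i < k" for i
    using assms that by (intro psum_const) (auto simp: vec_def in_keys_iff subset_iff)
  then have "capsum d k (vec (w + u)) = capsum d k (vec u)"
    by (auto simp: capsum_def vec_add psum_add fun_eq_iff)
  then show ?thesis by (simp add: trunc_def fun_eq_iff)
qed

text \<open>Truncation at \<open>k\<close> only sees the first \<open>k - 1\<close> entries. The remaining condition, that the
  shift be nonnegative, is automatic from entry \<open>k\<close> on, because \<open>m(\<rho>) \<le> k\<close> whenever the rule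
  shifts.\<close>
lemma nf_free:
  assumes u: "u \<in> expos n" and w: "w \<in> expos n" "keys w \<subseteq> {k..n}"
  shows "nf k (w + u) = map_option ((+) w) (nf k u)"
proof (cases "k = 0")
  case False
  note tr = trunc_add_above[OF w(2)]
  have "shiftable (w + u) \<and> trunc d k (vec (shift (w + u))) \<in> C\<rho> \<longleftrightarrow>
      shiftable u \<and> trunc d k (vec (shift u)) \<in> C\<rho>"
  proof
    assume t: "shiftable (w + u) \<and> trunc d k (vec (shift (w + u))) \<in> C\<rho>"
    then have "trunc d k (vec u) \<in> C" using target_source'[of "w + u" k] u w tr by simp
    moreover have "mr \<le> k"
      using target_mr_le[of "vec (shift (w + u))" k k] t shift_expos False by (simp add: nonneg_vec_vec)
    ultimately have "shiftable u"
      using source_shift_nonneg[of "vec u" k] u by (simp add: nonneg_vec_vec shiftable_def)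
    then show "shiftable u \<and> trunc d k (vec (shift u)) \<in> C\<rho>"
      using t shift_add(2)[OF _ w(1)] tr by simp
  qed (use shift_add[OF _ w(1)] tr in auto)
  then show ?thesis using tr shift_add(2)[OF _ w(1), of u] by (auto simp: nf_def in_colon_def)
qed (simp add: nf_def in_colon_def)

lemma nf_expos: "u \<in> expos n \<Longrightarrow> nf k u = Some v \<Longrightarrow> v \<in> expos n"
  by (auto simp: nf_def shift_expos split: if_splits)

lemma nf_idem:
  assumes "nf k u = Some v" shows "nf k v = Some v"
  using assms disjoint by (auto simp: nf_def in_colon_def split: if_splits)

lemma nf_zero: "nf 0 u = None"
  by (simp add: nf_def in_colon_def)

lemma nf_Suc_normal:
  assumes u: "u \<in> expos n" and "nf k u = Some u" shows "nf (Suc k) u = Some u"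
proof -
  have "\<not> in_colon (A \<union> C) k u"
    using assms(2) disjoint by (auto simp: nf_def in_colon_def split: if_splits)
  then have "\<not> in_colon (A \<union> C) (Suc k) u"
    using in_colon_add[OF borel(1) u expos_zero, of "Suc k" k] by auto
  then show ?thesis by (simp add: nf_def)
qed

lemma nf_degree:
  assumes "nf k u = Some v"
  shows "(\<Sum>j = 1..n. lookup v j) = (\<Sum>j = 1..n. lookup u j)"
proof (cases "v = u")
  case False
  then have s: "v = shift u" "shiftable u" "trunc d k (vec (shift u)) \<in> C\<rho>"
    using assms by (auto simp: nf_def split: if_splits)
  then obtain c where "c \<in> C" by (auto simp: vshift_def)
  then have "psum (vec v) n = psum (vec u) n"
    using s psum_\<rho>_top by (simp add: vec_shift psum_add)
  then have "int (\<Sum>j = 1..n. lookup v j) = int (\<Sum>j = 1..n. lookup u j)"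
    by (simp add: psum_def vec_def)
  then show ?thesis by linarith
qed simp

end

section \<open>Polynomials and the ideals cut out by a reduction system\<close>

abbreviation polys :: "nat \<Rightarrow> 'k::comm_ring_1 mpoly set" where "polys n \<equiv> carrier (poly_ring n)"

lemma carrier_poly_ring: "polys n = {p. keys p \<subseteq> expos n}"
  by (auto simp: poly_ring_def expos_def)

lemma poly_ring_simps [simp]:
  "mult (poly_ring n) = (*)" "one (poly_ring n) = 1" "zero (poly_ring n) = 0" "add (poly_ring n) = (+)"
  by (simp_all add: poly_ring_def)

lemma poly_carrier_intros [intro, simp]:
  "0 \<in> polys n" "1 \<in> polys n"
  "p \<in> polys n \<Longrightarrow> q \<in> polys n \<Longrightarrow> p + q \<in> polys n"
  "p \<in> polys n \<Longrightarrow> q \<in> polys n \<Longrightarrow> p * q \<in> polys n"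
  "p \<in> polys n \<Longrightarrow> - p \<in> polys n"
  "p \<in> polys n \<Longrightarrow> q \<in> polys n \<Longrightarrow> p - q \<in> polys n"
proof -
  show "0 \<in> polys n" "1 \<in> polys n" by (auto simp: carrier_poly_ring)
  assume p: "p \<in> polys n"
  show "- p \<in> polys n" using p by (auto simp: carrier_poly_ring in_keys_iff subset_iff)
  assume q: "q \<in> polys n"
  show "p + q \<in> polys n" using p q Poly_Mapping.keys_add[of p q] by (auto simp: carrier_poly_ring)
  show "p * q \<in> polys n" using p q keys_mult[of p q] by (force simp: carrier_poly_ring)
  have "keys (p - q) \<subseteq> keys p \<union> keys q"
    by (auto simp: in_keys_iff lookup_minus)
  then show "p - q \<in> polys n" using p q by (auto simp: carrier_poly_ring)
qed

lemma poly_carrier_power [intro, simp]: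
  "p \<in> polys n \<Longrightarrow> p ^ t \<in> polys n"
  by (induction t) auto

lemma poly_carrier_sum [intro]:
  "(\<And>x. x \<in> B \<Longrightarrow> f x \<in> polys n) \<Longrightarrow> sum f B \<in> polys n"
  by (induction B rule: infinite_finite_induct) auto

lemma poly_carrier_prod [intro]:
  "(\<And>x. x \<in> B \<Longrightarrow> f x \<in> polys n) \<Longrightarrow> prod f B \<in> polys n"
  by (induction B rule: infinite_finite_induct) auto

lemma poly_carrier_single: "u \<in> expos n \<Longrightarrow> single u c \<in> polys n"
  by (auto simp: carrier_poly_ring)

lemma Xvar_carrier: "i \<in> {1..n} \<Longrightarrow> Xvar i \<in> polys n"
  unfolding Xvar_def by (intro poly_carrier_single expos_single)

lemma Xvar_power: "Xvar i ^ t = (single (single i t) 1 :: 'k::comm_ring_1 mpoly)"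
  by (induction t) (simp_all add: Xvar_def mult_single flip: single_add)

lemma cring_poly_ring: "cring (poly_ring n :: 'k::comm_ring_1 mpoly ring)"
proof (rule cringI)
  show "abelian_group (poly_ring n :: 'k mpoly ring)"
  proof (rule abelian_groupI)
    fix x :: "'k mpoly" assume "x \<in> polys n"
    then show "\<exists>y\<in>polys n. y \<oplus>\<^bsub>poly_ring n\<^esub> x = \<zero>\<^bsub>poly_ring n\<^esub>"
      by (intro bexI[of _ "- x"]) auto
  qed (auto simp: algebra_simps)
  show "comm_monoid (poly_ring n :: 'k mpoly ring)"
    by (rule comm_monoidI) (auto simp: algebra_simps)
qed (auto simp: algebra_simps)

lemma poly_ring_uminus: "p \<in> polys n \<Longrightarrow> \<ominus>\<^bsub>poly_ring n\<^esub> p = - p"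
proof -
  assume p: "p \<in> polys n"
  interpret cring "poly_ring n" by (rule cring_poly_ring)
  show ?thesis using p by (intro minus_equality) auto
qed

lemma poly_idealI:
  fixes I :: "'k::comm_ring_1 mpoly set"
  assumes "I \<subseteq> polys n" "0 \<in> I" "\<And>x y. x \<in> I \<Longrightarrow> y \<in> I \<Longrightarrow> x + y \<in> I"
    and m: "\<And>r x. r \<in> polys n \<Longrightarrow> x \<in> I \<Longrightarrow> r * x \<in> I"
  shows "ideal I (poly_ring n)"
proof (rule idealI)
  show "ring (poly_ring n)" using cring_poly_ring cring.axioms(1) by blast
  have neg: "- x \<in> I" if "x \<in> I" for x using m[of "- 1" x] that by simp
  show "subgroup I (add_monoid (poly_ring n))"
  proof
    fix x assume x: "x \<in> I"
    then have "inv\<^bsub>add_monoid (poly_ring n)\<^esub> x = - x"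
      using poly_ring_uminus[of x n] assms(1) by (auto simp: a_inv_def)
    then show "inv\<^bsub>add_monoid (poly_ring n)\<^esub> x \<in> I" using neg[OF x] by simp
  qed (use assms(1-3) in auto)
  fix a x :: "'k mpoly" assume "a \<in> I" "x \<in> polys n"
  then have "x * a \<in> I" by (rule m[rotated])
  then show "x \<otimes>\<^bsub>poly_ring n\<^esub> a \<in> I" "a \<otimes>\<^bsub>poly_ring n\<^esub> x \<in> I" by (simp_all add: mult.commute[of a x])
qed

lemma poly_idealD:
  assumes "ideal I (poly_ring n)"
  shows "I \<subseteq> polys n" "0 \<in> I" "x \<in> I \<Longrightarrow> y \<in> I \<Longrightarrow> x + y \<in> I"
    "r \<in> polys n \<Longrightarrow> x \<in> I \<Longrightarrow> r * x \<in> I"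
    "x \<in> I \<Longrightarrow> y \<in> I \<Longrightarrow> x - y \<in> I" "x \<in> I \<Longrightarrow> - x \<in> I"
proof -
  interpret ideal I "poly_ring n" by fact
  show sub: "I \<subseteq> polys n" by (rule a_subset)
  show "0 \<in> I" using additive_subgroup.zero_closed[OF additive_subgroup_axioms] by simp
  show add: "x \<in> I \<Longrightarrow> y \<in> I \<Longrightarrow> x + y \<in> I" for x y
    using additive_subgroup.a_closed[OF additive_subgroup_axioms, of x y] by simp
  show m: "r \<in> polys n \<Longrightarrow> x \<in> I \<Longrightarrow> r * x \<in> I" for r x using I_l_closed[of x r] by simp
  show neg: "x \<in> I \<Longrightarrow> - x \<in> I" for x using m[of "- 1" x] by simp
  show "x \<in> I \<Longrightarrow> y \<in> I \<Longrightarrow> x - y \<in> I" using add[of x "- y"] neg by simp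
qed

lemma poly_ideal_sum:
  assumes "ideal I (poly_ring n)" "\<And>x. x \<in> B \<Longrightarrow> f x \<in> I" shows "sum f B \<in> I"
  using assms(2) by (induction B rule: infinite_finite_induct) (auto intro: poly_idealD[OF assms(1)])

lemma poly_expand: "(p :: 'a \<Rightarrow>\<^sub>0 'b::comm_monoid_add) =
    (\<Sum>u\<in>keys p. single u (lookup p u))"
  by (rule poly_mapping_eqI)
    (auto simp: lookup_sum lookup_single when_def sum.delta in_keys_iff cong: if_cong)

lemma poly_induct_single:
  assumes "\<And>u c. u \<in> keys p \<Longrightarrow> P (single u c)" "P 0"
    "\<And>p q. P p \<Longrightarrow> P q \<Longrightarrow> P (p + q)"
  shows "P (p :: 'a \<Rightarrow>\<^sub>0 'b::comm_monoid_add)"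
proof -
  have "P (\<Sum>u\<in>U. single u (lookup p u))" if "U \<subseteq> keys p" for U
    using finite_subset[OF that finite_keys] that by (induction U rule: finite_induct) (auto intro: assms)
  from this[OF order.refl] show ?thesis by (simp only: poly_expand[of p, symmetric])
qed

text \<open>Identities between additive maps only have to be checked on monomials; most properties of
  the rules pass to polynomials in this way.\<close>
lemma additive_eqI:
  fixes f g :: "('a \<Rightarrow>\<^sub>0 'b::comm_monoid_add) \<Rightarrow> 'c::cancel_comm_monoid_add"
  assumes "\<And>p q. f (p + q) = f p + f q" "\<And>p q. g (p + q) = g p + g q"
    and "\<And>u c. u \<in> keys p \<Longrightarrow> f (single u c) = g (single u c)"
  shows "f p = g p"
proof -
  have "f 0 = 0" "g 0 = 0" using assms(1)[of 0 0] assms(2)[of 0 0] by auto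
  then show ?thesis
    by (intro poly_induct_single[of p "\<lambda>p. f p = g p"]) (simp_all add: assms)
qed

definition lin_ext :: "(expo \<Rightarrow> 'k::comm_ring_1 mpoly) \<Rightarrow> 'k mpoly \<Rightarrow> 'k mpoly"
  where "lin_ext \<phi> p = (\<Sum>u\<in>keys p. single 0 (lookup p u) * \<phi> u)"

lemma lin_ext_superset:
  assumes "finite U" "keys p \<subseteq> U"
  shows "lin_ext \<phi> p = (\<Sum>u\<in>U. single 0 (lookup p u) * \<phi> u)"
  unfolding lin_ext_def by (rule sum.mono_neutral_left) (use assms in \<open>auto simp: in_keys_iff\<close>)

lemma lin_ext_add: "lin_ext \<phi> (p + q) = lin_ext \<phi> p + lin_ext \<phi> q"
proof -
  let ?U = "keys p \<union> keys q"
  have "lin_ext \<phi> r = (\<Sum>u\<in>?U. single 0 (lookup r u) * \<phi> u)"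
    if "r \<in> {p, q, p + q}" for r
    by (rule lin_ext_superset) (use that Poly_Mapping.keys_add[of p q] in auto)
  then show ?thesis by (simp add: lookup_add single_add algebra_simps sum.distrib)
qed

lemma lin_ext_single: "lin_ext \<phi> (single u c) = single 0 c * \<phi> u"
  by (simp add: lin_ext_def)

lemma additive_hom:
  fixes f :: "'a::ab_group_add \<Rightarrow> 'b::ab_group_add"
  assumes "\<And>p q. f (p + q) = f p + f q"
  shows "f 0 = 0" "f (- p) = - f p" "f (p - q) = f p - f q" "f (sum g B) = (\<Sum>b\<in>B. f (g b))"
proof -
  show 0: "f 0 = 0" using assms[of 0 0] by simp
  show m: "f (- p) = - f p" for p using assms[of p "- p"] 0 by (simp add: eq_neg_iff_add_eq_0 add.commute)
  show "f (p - q) = f p - f q" using assms[of p "- q"] m by simp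
  show "f (sum g B) = (\<Sum>b\<in>B. f (g b))"
    by (induction B rule: infinite_finite_induct) (simp_all add: 0 assms)
qed

definition restr :: "'a set \<Rightarrow> ('a \<Rightarrow>\<^sub>0 'b::comm_ring_1) \<Rightarrow> 'a \<Rightarrow>\<^sub>0 'b"
  where "restr U p = Abs_poly_mapping (\<lambda>u. lookup p u when u \<in> U)"

lemma lookup_restr: "lookup (restr U p) u = (lookup p u when u \<in> U)"
proof -
  have "finite {u. (lookup p u when u \<in> U) \<noteq> 0}"
    by (rule finite_subset[OF _ finite_keys[of p]]) (auto simp: in_keys_iff)
  then show ?thesis by (simp add: restr_def)
qed

lemma keys_restr: "keys (restr U p) = keys p \<inter> U"
  by (auto simp: in_keys_iff lookup_restr)

lemma restr_add: "restr U (p + q) = restr U p + restr U q"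
  by (rule poly_mapping_eqI) (simp add: lookup_restr lookup_add when_add_distrib)

lemma restr_single: "restr U (single u c) = (if u \<in> U then single u c else 0)"
  by (rule poly_mapping_eqI) (auto simp: lookup_restr lookup_single when_def)

lemma restr_id: "keys p \<subseteq> U \<Longrightarrow> restr U p = p"
  by (rule poly_mapping_eqI) (auto simp: lookup_restr when_def in_keys_iff)

lemma restr_zero: "keys p \<inter> U = {} \<Longrightarrow> restr U p = 0"
  using keys_restr[of U p] by simp

lemma restr_carrier: "p \<in> polys n \<Longrightarrow> restr U p \<in> polys n"
  by (auto simp: carrier_poly_ring keys_restr)

lemma lookup_monomial_mult:
  fixes p :: "'k::comm_ring_1 mpoly"
  shows "lookup (single w c * p) (w + u) = c * lookup p u"
  by (rule additive_eqI[of "\<lambda>p. lookup (single w c * p) (w + u)"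
        "\<lambda>p. c * lookup p u" p])
    (auto simp: algebra_simps lookup_add mult_single lookup_single when_def)

lemma divide_var:
  fixes p :: "'k::comm_ring_1 mpoly"
  assumes "\<And>u. u \<in> keys p \<Longrightarrow> 0 < lookup u j"
  shows "\<exists>q. p = Xvar j * q \<and> (\<forall>u\<in>keys q. single j 1 + u \<in> keys p)"
proof (intro exI conjI ballI)
  let ?e = "single j (1::nat)"
  have e: "?e + (u - ?e) = u" if "u \<in> keys p" for u
    using assms[OF that] by (intro poly_mapping_eqI) (auto simp: lookup_add lookup_minus lookup_single when_def)
  define q where "q = (\<Sum>u\<in>keys p. single (u - ?e) (lookup p u))"
  have "Xvar j * q = (\<Sum>u\<in>keys p. single u (lookup p u))"
    unfolding q_def sum_distrib_left Xvar_def mult_single by (rule sum.cong) (simp_all only: e mult_1_left)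
  then show pq: "p = Xvar j * q" using poly_expand[of p] by simp
  show "?e + u \<in> keys p" if "u \<in> keys q" for u
    unfolding in_keys_iff using that lookup_monomial_mult[of ?e "1::'k" q u]
    by (subst pq) (simp add: Xvar_def in_keys_iff)
qed

text \<open>What the rest of the proof uses of the reduction rules. The index \<open>k\<close> orders the rules by
  strength: rule \<open>0\<close> kills everything, and a smaller index kills more. The ideal \<open>F k\<close> below consists
  of the polynomials that rule \<open>k\<close> reduces to zero.\<close>
locale reduction_system =
  fixes n T :: nat and nf :: "nat \<Rightarrow> expo \<Rightarrow> expo option"
  assumes nf_expos: "u \<in> expos n \<Longrightarrow> nf k u = Some v \<Longrightarrow> v \<in> expos n"
    and nf_degree: "nf k u = Some v \<Longrightarrow>
      (\<Sum>j = 1..n. lookup v j) = (\<Sum>j = 1..n. lookup u j)"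
    and nf_idem: "nf k u = Some v \<Longrightarrow> nf k v = Some v"
    and nf_step: "u \<in> expos n \<Longrightarrow> w \<in> expos n \<Longrightarrow> k' \<le> k \<Longrightarrow>
      nf k' (w + u) = Option.bind (nf k u) (\<lambda>v. nf k' (w + v))"
    and nf_free: "u \<in> expos n \<Longrightarrow> w \<in> expos n \<Longrightarrow> keys w \<subseteq> {k..n} \<Longrightarrow>
      nf k (w + u) = map_option ((+) w) (nf k u)"
    and nf_nilpotent: "u \<in> expos n \<Longrightarrow> 1 \<le> j \<Longrightarrow> j \<le> k \<Longrightarrow> k \<le> n \<Longrightarrow>
      nf (Suc k) (single j T + u) =
        Option.bind (nf k u) (\<lambda>v. nf (Suc k) (single j T + v))"
    and nf_zero: "nf 0 u = None"
    and nf_Suc_normal: "u \<in> expos n \<Longrightarrow> nf k u = Some u \<Longrightarrow> nf (Suc k) u = Some u"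
begin

definition mono_nf :: "nat \<Rightarrow> expo \<Rightarrow> 'k::field mpoly"
  where "mono_nf k u = (case nf k u of None \<Rightarrow> 0 | Some v \<Rightarrow> single v 1)"

definition NF :: "nat \<Rightarrow> 'k::field mpoly \<Rightarrow> 'k mpoly"
  where "NF k = lin_ext (mono_nf k)"

lemma NF_add: "NF k (p + q) = NF k p + NF k q"
  by (simp add: NF_def lin_ext_add)

lemmas NF_hom = additive_hom[of "NF k" for k, OF NF_add]

lemma NF_single: "NF k (single u c) =
    (case nf k u of None \<Rightarrow> 0 | Some v \<Rightarrow> single v c)"
  by (simp add: NF_def lin_ext_single mono_nf_def mult_single split: option.split)

lemma keys_NF:
  assumes "v \<in> keys (NF k p)"
  shows "\<exists>u\<in>keys p. nf k u = Some v"
proof -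
  have "v \<in> (\<Union>u\<in>keys p. keys (single 0 (lookup p u) * mono_nf k u))"
    using assms Poly_Mapping.keys_sum unfolding NF_def lin_ext_def by fastforce
  then obtain u where u: "u \<in> keys p"
    "v \<in> keys (single 0 (lookup p u) * mono_nf k u)" by blast
  then have "nf k u = Some v" by (auto simp: mono_nf_def mult_single split: option.splits if_splits)
  then show ?thesis using u by blast
qed

lemma NF_carrier: "p \<in> polys n \<Longrightarrow> NF k p \<in> polys n"
  using keys_NF nf_expos by (fastforce simp: carrier_poly_ring)

lemma NF_normal: "v \<in> keys (NF k p) \<Longrightarrow> nf k v = Some v"
  using keys_NF nf_idem by blast

lemma NF_id:
  assumes "\<And>u. u \<in> keys p \<Longrightarrow> nf k u = Some u" shows "NF k p = p"
  by (rule additive_eqI[of "NF k" "\<lambda>p. p"]) (auto simp: NF_add NF_single assms)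

lemma NF_mult_step:
  assumes p: "p \<in> polys n" and q: "q \<in> polys n" and "k' \<le> k"
  shows "NF k' (q * p) = NF k' (q * NF k p)"
proof (rule additive_eqI[of "\<lambda>q. NF k' (q * p)" "\<lambda>q. NF k' (q * NF k p)" q])
  fix w :: expo and a :: 'a assume w: "w \<in> keys q"
  show "NF k' (single w a * p) = NF k' (single w a * NF k p)"
  proof (rule additive_eqI[of "\<lambda>p. NF k' (single w a * p)" 
          "\<lambda>p. NF k' (single w a * NF k p)" p])
    fix u :: expo and c :: 'a assume u: "u \<in> keys p"
    have "nf k' (w + u) = Option.bind (nf k u) (\<lambda>v. nf k' (w + v))"
      using u w p q assms(3) by (intro nf_step) (auto simp: carrier_poly_ring)
    then show "NF k' (single w a * single u c) =
        NF k' (single w a * NF k (single u c))"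
      by (cases "nf k u") (simp_all add: mult_single NF_single NF_hom)
  qed (simp_all add: distrib_left NF_add)
qed (simp_all add: distrib_right NF_add)

lemma NF_step: "p \<in> polys n \<Longrightarrow> k' \<le> k \<Longrightarrow> NF k' (NF k p) = NF k' p"
  using NF_mult_step[of p 1 k' k] by simp

lemma NF_nilpotent:
  assumes p: "p \<in> polys n" and "1 \<le> j" "j \<le> k" "k \<le> n"
  shows "NF (Suc k) (Xvar j ^ T * p) = NF (Suc k) (Xvar j ^ T * NF k p)"
  unfolding Xvar_power
proof (rule additive_eqI[of "\<lambda>p. NF (Suc k) (single (single j T) 1 * p)" 
          "\<lambda>p. NF (Suc k) (single (single j T) 1 * NF k p)" p])
  fix u :: expo and c :: 'a assume u: "u \<in> keys p"
  have "u \<in> expos n" using u p by (auto simp: carrier_poly_ring)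
  note * = nf_nilpotent[OF this assms(2-4)]
  then show "NF (Suc k) (single (single j T) 1 * single u c) =
      NF (Suc k) (single (single j T) 1 * NF k (single u c))"
    by (cases "nf k u") (simp_all add: mult_single NF_single NF_hom)
qed (simp_all add: distrib_left NF_add)

lemma NF_mult_free:
  assumes p: "p \<in> polys n" and q: "q \<in> polys n"
    and "\<And>w. w \<in> keys q \<Longrightarrow> keys w \<subseteq> {k..n}"
  shows "NF k (q * p) = q * NF k p"
proof (rule additive_eqI[of "\<lambda>q. NF k (q * p)" "\<lambda>q. q * NF k p" q])
  fix w :: expo and a :: 'a assume w: "w \<in> keys q"
  show "NF k (single w a * p) = single w a * NF k p"
  proof (rule additive_eqI[of "\<lambda>p. NF k (single w a * p)" 
          "\<lambda>p. single w a * NF k p" p])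
    fix u :: expo and c :: 'a assume u: "u \<in> keys p"
    have "nf k (w + u) = map_option ((+) w) (nf k u)"
      using u w p q assms(3)[OF w] by (intro nf_free) (auto simp: carrier_poly_ring)
    then show "NF k (single w a * single u c) =
        single w a * NF k (single u c)"
      by (cases "nf k u") (simp_all add: mult_single NF_single)
  qed (simp_all add: distrib_left NF_add)
qed (simp_all add: distrib_right NF_add)

definition F :: "nat \<Rightarrow> 'k::field mpoly set"
  where "F k = {p \<in> polys n. NF k p = 0}"

lemma ideal_F: "ideal (F k) (poly_ring n)"
proof (rule poly_idealI)
  fix r x :: "'a mpoly" assume "r \<in> polys n" "x \<in> F k"
  then show "r * x \<in> F k" using NF_mult_step[of x r k k] by (auto simp: F_def NF_hom)
qed (auto simp: F_def NF_add NF_hom)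

lemma F_subset: "F k \<subseteq> polys n"
  by (auto simp: F_def)

lemma F_0: "F 0 = polys n"
proof -
  have "NF 0 p = 0" for p :: "'a mpoly"
    using keys_NF[of _ 0 p] nf_zero by (auto simp flip: Poly_Mapping.keys_eq_empty)
  then show ?thesis by (auto simp: F_def)
qed

lemma F_antimono: "k' \<le> k \<Longrightarrow> F k \<subseteq> F k'"
  using NF_step[of _ k' k] by (fastforce simp: F_def NF_hom)

lemma F_nilpotent: "p \<in> F k \<Longrightarrow> 1 \<le> j \<Longrightarrow> j \<le> k \<Longrightarrow> k \<le> n \<Longrightarrow> Xvar j ^ T * p \<in> F (Suc k)"
  using NF_nilpotent[of p j k] Xvar_carrier[of j n] by (auto simp: F_def NF_hom)

text \<open>A basis of \<open>F k / F (k + 1)\<close>: a new normal monomial \<open>u\<close> represents the class of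
  \<open>X\<^sup>u - NF k X\<^sup>u\<close> (see \<open>lift_new_normals\<close>), and the map \<open>proj k\<close> reads off coordinates.\<close>
definition new_normals :: "nat \<Rightarrow> expo set"
  where "new_normals k = {u \<in> expos n. nf (Suc k) u = Some u \<and> nf k u \<noteq> Some u}"

definition proj :: "nat \<Rightarrow> 'k::field mpoly \<Rightarrow> 'k mpoly"
  where "proj k p = restr (new_normals k) (NF (Suc k) p)"

lemma proj_add: "proj k (p + q) = proj k p + proj k q"
  by (simp add: proj_def NF_add restr_add)

lemmas proj_hom = additive_hom[of "proj k" for k, OF proj_add]

lemma keys_proj: "keys (proj k p) \<subseteq> new_normals k"
  by (auto simp: proj_def keys_restr)

text \<open>A polynomial of \<open>F k\<close> whose reduction by rule \<open>k + 1\<close> only involves monomials normal for \<open>k\<close>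
  is reduced to itself by rule \<open>k\<close>, hence to zero.\<close>
lemma proj_eq_0_iff:
  assumes "p \<in> F k" shows "proj k p = 0 \<longleftrightarrow> p \<in> F (Suc k)"
proof
  assume 0: "proj k p = 0"
  have c: "p \<in> polys n" using assms F_subset by blast
  let ?q = "NF (Suc k) p"
  have "nf k u = Some u" if "u \<in> keys ?q" for u
  proof (rule ccontr)
    assume "nf k u \<noteq> Some u"
    then have "u \<in> new_normals k"
      using NF_normal[OF that] that NF_carrier[OF c, of "Suc k"] by (auto simp: new_normals_def carrier_poly_ring)
    then show False using 0 that keys_restr[of "new_normals k" ?q] by (auto simp: proj_def)
  qed
  then have "?q = NF k ?q" by (simp add: NF_id)
  also have "\<dots> = 0" using NF_step[OF c, of k "Suc k"] assms by (simp add: F_def)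
  finally show "p \<in> F (Suc k)" using c by (simp add: F_def)
qed (simp add: proj_def F_def restr_zero)

lemma new_normals_add:
  assumes "w \<in> expos n" "keys w \<subseteq> {Suc k..n}"
  shows "w + u \<in> new_normals k \<longleftrightarrow> u \<in> new_normals k"
proof (cases "u \<in> expos n")
  case True
  have "nf k (w + u) = map_option ((+) w) (nf k u)" "nf (Suc k) (w + u) = map_option ((+) w) (nf (Suc k) u)"
    using assms True by (auto intro!: nf_free)
  then show ?thesis using assms True by (auto simp: new_normals_def)
qed (auto simp: new_normals_def)

lemma proj_mult_free:
  assumes p: "p \<in> polys n" and q: "q \<in> polys n"
    and w: "\<And>w. w \<in> keys q \<Longrightarrow> keys w \<subseteq> {Suc k..n}"
  shows "proj k (q * p) = q * proj k p"
proof -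
  have "restr (new_normals k) (q * r) = q * restr (new_normals k) r" for r :: "'a mpoly"
  proof (rule additive_eqI[of "\<lambda>q. restr (new_normals k) (q * r)" "\<lambda>q. q * restr (new_normals k) r" q])
    fix w :: expo and a :: 'a assume "w \<in> keys q"
    then have "w + u \<in> new_normals k \<longleftrightarrow> u \<in> new_normals k" for u
      using w q by (intro new_normals_add) (auto simp: carrier_poly_ring)
    then show "restr (new_normals k) (single w a * r) = single w a * restr (new_normals k) r"
      by (intro additive_eqI[of "\<lambda>r. restr (new_normals k) (single w a * r)"
             "\<lambda>r. single w a * restr (new_normals k) r" r])
         (auto simp: distrib_left restr_add restr_single mult_single)
  qed (simp_all add: distrib_right restr_add)
  then show ?thesis using NF_mult_free[OF p q, of "Suc k"] w by (simp add: proj_def)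
qed

lemma proj_Xvar:
  assumes "p \<in> polys n" "k < j" "j \<le> n" shows "proj k (Xvar j * p) = Xvar j * proj k p"
  by (rule proj_mult_free) (use assms Xvar_carrier[of j n] in \<open>auto simp: Xvar_def\<close>)

lemma lift_new_normals:
  assumes "keys q \<subseteq> new_normals k"
  shows "q - NF k q \<in> F k" "proj k (q - NF k q) = q"
proof -
  have q: "q \<in> polys n" using assms by (auto simp: carrier_poly_ring new_normals_def)
  then show "q - NF k q \<in> F k" using NF_step[OF q, of k k] by (auto simp: F_def NF_hom NF_carrier)
  have "NF (Suc k) q = q" using assms by (intro NF_id) (auto simp: new_normals_def)
  then have 1: "proj k q = q" using assms by (simp add: proj_def restr_id)
  have n: "nf k u = Some u" "nf (Suc k) u = Some u" if "u \<in> keys (NF k q)" for u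
    using NF_normal[OF that] nf_Suc_normal[of u k] NF_carrier[OF q, of k] that by (auto simp: carrier_poly_ring)
  then have "NF (Suc k) (NF k q) = NF k q" by (intro NF_id) auto
  then have "proj k (NF k q) = 0" using n(1) by (auto simp: proj_def new_normals_def intro!: restr_zero)
  then show "proj k (q - NF k q) = q" using 1 by (simp add: proj_hom)
qed

text \<open>The submodule \<open>F (k + 1) + (X\<^sub>k\<^sub>+\<^sub>1, \<dots>, X\<^sub>j) F k\<close> in terms of coordinates, as \<open>D_base\<close> and
  \<open>D_step\<close> confirm. Since the basis is stable under multiplication and division by the variables
  involved, regularity becomes a statement about monomials.\<close>
definition D :: "nat \<Rightarrow> nat \<Rightarrow> 'k::field mpoly set"
  where "D k j = {p \<in> F k. \<forall>u\<in>keys (proj k p). \<exists>l\<in>{Suc k..j}. 0 < lookup u l}"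

lemma D_base: "D k k = F (Suc k)"
  using proj_eq_0_iff[of _ k] F_antimono[of k "Suc k"] by (fastforce simp: D_def)

lemma keys_Xvar_mult:
  fixes q :: "'k::field mpoly"
  shows "keys (Xvar j * q) = (+) (single j 1) ` keys q"
proof
  show "keys (Xvar j * q) \<subseteq> (+) (single j 1) ` keys q"
    using keys_mult[of "Xvar j" q] by (auto simp: Xvar_def)
  show "(+) (single j 1) ` keys q \<subseteq> keys (Xvar j * q)"
    by (auto simp: in_keys_iff Xvar_def lookup_monomial_mult)
qed

lemma D_step:
  assumes "k \<le> j" "j < n"
  shows "D k (Suc j) = {a + Xvar (Suc j) * w | a w. a \<in> D k j \<and> w \<in> F k}" (is "_ = ?R")
proof
  have X: "Xvar (Suc j) \<in> polys n" using assms by (intro Xvar_carrier) auto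
  show "?R \<subseteq> D k (Suc j)"
  proof clarify
    fix a w :: "'a mpoly" assume a: "a \<in> D k j" and w: "w \<in> F k"
    have "proj k (a + Xvar (Suc j) * w) = proj k a + Xvar (Suc j) * proj k w"
      using subsetD[OF F_subset w] assms by (simp add: proj_add proj_Xvar)
    then have "keys (proj k (a + Xvar (Suc j) * w)) \<subseteq>
        keys (proj k a) \<union> (+) (single (Suc j) 1) ` keys (proj k w)"
      using Poly_Mapping.keys_add[of "proj k a" "Xvar (Suc j) * proj k w"] keys_Xvar_mult by metis
    moreover have "\<exists>l\<in>{Suc k..Suc j}. 0 < lookup u l"
      if "u \<in> keys (proj k a)" for u
    proof -
      have "\<exists>l\<in>{Suc k..j}. 0 < lookup u l"
        using a that unfolding D_def mem_Collect_eq by (elim conjE) (rule bspec)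
      then show ?thesis by (rule bexE) (rule bexI, assumption, simp)
    qed
    moreover have "\<exists>l\<in>{Suc k..Suc j}. 0 < lookup (single (Suc j) 1 + u) l" for u :: expo
      using assms by (intro bexI[of _ "Suc j"]) (auto simp: lookup_add)
    ultimately have "\<exists>l\<in>{Suc k..Suc j}. 0 < lookup u l"
      if "u \<in> keys (proj k (a + Xvar (Suc j) * w))" for u using that by blast
    moreover have "a + Xvar (Suc j) * w \<in> F k"
      using a w X by (intro poly_idealD[OF ideal_F]) (auto simp: D_def)
    ultimately show "a + Xvar (Suc j) * w \<in> D k (Suc j)" by (auto simp: D_def)
  qed
  show "D k (Suc j) \<subseteq> ?R"
  proof
    fix p :: "'a mpoly" assume p: "p \<in> D k (Suc j)"
    define U where "U = {u :: expo. \<exists>l\<in>{Suc k..j}. 0 < lookup u l}"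
    \<comment> \<open>the monomials divisible by one of the earlier variables stay in \<open>D k j\<close>, the others are divided by the last variable and lifted back to \<open>F k\<close>\<close>
    have split: "proj k p = restr U (proj k p) + restr (- U) (proj k p)"
      by (rule poly_mapping_eqI) (simp add: lookup_add lookup_restr when_def)
    have pos: "0 < lookup u (Suc j)" if "u \<in> keys (restr (- U) (proj k p))" for u
    proof -
      have "u \<in> keys (proj k p)" "u \<notin> U" using that by (auto simp: keys_restr)
      then obtain l where l: "l \<in> {Suc k..Suc j}" "0 < lookup u l" using p by (auto simp: D_def)
      then have "l \<notin> {Suc k..j}" using \<open>u \<notin> U\<close> unfolding U_def by blast
      then have "l = Suc j" using l(1) by simp
      then show ?thesis using l by simp
    qed
    have "\<exists>q. restr (- U) (proj k p) = Xvar (Suc j) * q \<and> (\<forall>u\<in>keys q.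
        single (Suc j) 1 + u \<in> keys (restr (- U) (proj k p)))"
      by (rule divide_var) (rule pos)
    then obtain q where q: "restr (- U) (proj k p) = Xvar (Suc j) * q"
      and kq: "\<forall>u\<in>keys q. single (Suc j) 1 + u \<in> keys (restr (- U) (proj k p))"
      by (elim exE conjE)
    have "keys q \<subseteq> new_normals k"
    proof
      fix u assume "u \<in> keys q"
      then have "single (Suc j) 1 + u \<in> new_normals k"
        using kq keys_proj[of k p] by (auto simp: keys_restr)
      then show "u \<in> new_normals k" using assms by (subst (asm) new_normals_add) (auto intro!: expos_single)
    qed
    note lift = lift_new_normals[OF this]
    let ?w = "q - NF k q"
    have pF: "p \<in> F k" using p by (simp add: D_def)
    have aF: "p - Xvar (Suc j) * ?w \<in> F k"
      by (rule poly_idealD(5)[OF ideal_F pF poly_idealD(4)[OF ideal_F X lift(1)]])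
    have "proj k (Xvar (Suc j) * ?w) = Xvar (Suc j) * q"
      using proj_Xvar[OF subsetD[OF F_subset lift(1)], of k "Suc j"] assms lift(2) by simp
    then have "proj k (p - Xvar (Suc j) * ?w) = proj k p - restr (- U) (proj k p)"
      using q by (simp only: proj_hom)
    also have "\<dots> = restr U (proj k p)" by (subst split) simp
    finally have "proj k (p - Xvar (Suc j) * ?w) = restr U (proj k p)" .
    then have "p - Xvar (Suc j) * ?w \<in> D k j"
      using aF by (auto simp: D_def keys_restr U_def)
    moreover have "p = (p - Xvar (Suc j) * ?w) + Xvar (Suc j) * ?w" by simp
    ultimately show "p \<in> ?R" using lift(1) by blast
  qed
qed

lemma D_regular:
  assumes "p \<in> F k" "k \<le> j" "j < n" "Xvar (Suc j) * p \<in> D k j" shows "p \<in> D k j"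
proof -
  have X: "proj k (Xvar (Suc j) * p) = Xvar (Suc j) * proj k p"
    using assms F_subset by (intro proj_Xvar) auto
  have "\<exists>l\<in>{Suc k..j}. 0 < lookup u l" if "u \<in> keys (proj k p)" for u
  proof -
    have "single (Suc j) 1 + u \<in> keys (proj k (Xvar (Suc j) * p))"
      using that X by (simp add: keys_Xvar_mult)
    then obtain l where "l \<in> {Suc k..j}" "0 < lookup (single (Suc j) 1 + u) l"
      using assms(4) by (auto simp: D_def)
    then show ?thesis by (intro bexI[of _ l]) (auto simp: lookup_add lookup_single when_def split: if_splits)
  qed
  then show ?thesis using assms by (auto simp: D_def)
qed

text \<open>Removing the variables \<open>X\<^sub>k\<^sub>+\<^sub>1, \<dots>, X\<^sub>n\<close> from a new normal monomial leaves a new normal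
  monomial, and its class is not in the submodule generated by these variables.\<close>
lemma D_proper:
  assumes "F (Suc k) \<noteq> (F k :: 'k::field mpoly set)" "k \<le> n" shows "D k n \<noteq> (F k :: 'k mpoly set)"
proof -
  obtain p :: "'k mpoly" where p: "p \<in> F k" "p \<notin> F (Suc k)" using assms F_antimono[of k "Suc k"] by auto
  then have "proj k p \<noteq> 0" using proj_eq_0_iff by blast
  then obtain u where "u \<in> keys (proj k p)" by (auto simp flip: Poly_Mapping.keys_eq_empty)
  then have u: "u \<in> new_normals k" using keys_proj by blast
  then have un: "u \<in> expos n" by (simp add: new_normals_def)
  define w v where "w = (\<Sum>i\<in>{Suc k..n}. single i (lookup u i))"
    and "v = (\<Sum>i\<in>{1..k}. single i (lookup u i))"
  have lw: "lookup w i = (if i \<in> {Suc k..n} then lookup u i else 0)" for i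
    by (simp add: w_def lookup_sum lookup_single when_def sum.delta)
  have lv: "lookup v i = (if i \<in> {1..k} then lookup u i else 0)" for i
    by (simp add: v_def lookup_sum lookup_single when_def sum.delta)
  have z: "lookup u i = 0" if "i \<notin> {1..n}" for i
  proof -
    have "i \<notin> keys u" using un that by (auto simp: expos_def)
    then show ?thesis by (simp add: in_keys_iff)
  qed
  have "u = w + v"
    by (rule poly_mapping_eqI) (use assms(2) z in \<open>auto simp: lookup_add lw lv\<close>)
  moreover have "w \<in> expos n" "keys w \<subseteq> {Suc k..n}"
    by (auto simp: expos_def in_keys_iff lw split: if_splits)
  ultimately have v: "v \<in> new_normals k" using u new_normals_add by metis
  let ?q = "single v (1::'k)"
  have q: "keys ?q \<subseteq> new_normals k" using v by simp
  have "\<not> (\<exists>l\<in>{Suc k..n}. 0 < lookup v l)" by (simp add: lv)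
  then have "?q - NF k ?q \<notin> D k n" using lift_new_normals(2)[OF q] by (simp add: D_def)
  then show ?thesis using lift_new_normals(1)[OF q] by blast
qed

text \<open>In coordinates, \<open>g\<close> acts by multiplication of polynomials, and the polynomial ring is a
  domain.\<close>
lemma F_torsion_free:
  assumes "g \<in> polys n" "g \<noteq> 0" "\<And>w. w \<in> keys g \<Longrightarrow> keys w \<subseteq> {Suc k..n}"
    and "p \<in> F k" "g * p \<in> F (Suc k)"
  shows "p \<in> F (Suc k)"
proof -
  have "g * p \<in> F k" using assms(5) F_antimono[of k "Suc k"] by auto
  then have "g * proj k p = 0"
    using proj_eq_0_iff[of "g * p" k] assms proj_mult_free[of p g k] F_subset by auto
  then show ?thesis using assms proj_eq_0_iff[of p k] by simp
qed

end

section \<open>Algebraic dependence, chains of primes and regular sequences\<close>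

text \<open>A homogeneous linear system with more unknowns than equations, by eliminating one unknown
  per equation.\<close>
lemma exists_nontrivial_solution:
  fixes a :: "'i \<Rightarrow> 'q \<Rightarrow> 'k::field"
  assumes "finite Q" "finite A" "card Q < card A"
  shows "\<exists>c. (\<exists>\<alpha>\<in>A. c \<alpha> \<noteq> 0) \<and> (\<forall>q\<in>Q. (\<Sum>\<alpha>\<in>A. c \<alpha> * a \<alpha> q) = 0)"
  using assms
proof (induction Q arbitrary: A a rule: finite_induct)
  case empty
  then have "A \<noteq> {}" by auto
  then show ?case by (intro exI[of _ "\<lambda>_. 1"]) auto
next
  case (insert q Q)
  show ?case
  proof (cases "\<forall>\<alpha>\<in>A. a \<alpha> q = 0")
    case True
    have "card Q < card A" using insert by simp
    then obtain c where c: "\<exists>\<alpha>\<in>A. c \<alpha> \<noteq> 0" "\<forall>r\<in>Q. (\<Sum>\<alpha>\<in>A. c \<alpha> * a \<alpha> r) = 0"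
      using insert.IH[OF insert.prems(1), of a] by blast
    moreover have "(\<Sum>\<alpha>\<in>A. c \<alpha> * a \<alpha> q) = 0" using True by simp
    ultimately show ?thesis by blast
  next
    case False
    then obtain \<beta> where \<beta>: "\<beta> \<in> A" "a \<beta> q \<noteq> 0" by blast
    define A' where "A' = A - {\<beta>}"
    have A: "A = insert \<beta> A'" "\<beta> \<notin> A'" "finite A'" using \<beta> insert.prems by (auto simp: A'_def)
    have "card Q < card A'" using insert A by simp
    then obtain c where c: "\<exists>\<alpha>\<in>A'. c \<alpha> \<noteq> 0"
      "\<forall>r\<in>Q. (\<Sum>\<alpha>\<in>A'. c \<alpha> * (a \<alpha> r - a \<alpha> q / a \<beta> q * a \<beta> r)) = 0"
      using insert.IH[OF A(3), of "\<lambda>\<alpha> r. a \<alpha> r - a \<alpha> q / a \<beta> q * a \<beta> r"] by blast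
    define c' where "c' = c(\<beta> := - (\<Sum>\<alpha>\<in>A'. c \<alpha> * a \<alpha> q / a \<beta> q))"
    have c'A: "(\<Sum>\<alpha>\<in>A'. c' \<alpha> * a \<alpha> r) = (\<Sum>\<alpha>\<in>A'. c \<alpha> * a \<alpha> r)" for r
      by (rule sum.cong) (use A in \<open>auto simp: c'_def\<close>)
    have sum: "(\<Sum>\<alpha>\<in>A. c' \<alpha> * a \<alpha> r) = (\<Sum>\<alpha>\<in>A'. c \<alpha> * (a \<alpha> r - a \<alpha> q / a \<beta> q * a \<beta> r))" for r
    proof -
      have "(\<Sum>\<alpha>\<in>A. c' \<alpha> * a \<alpha> r) = c' \<beta> * a \<beta> r + (\<Sum>\<alpha>\<in>A'. c \<alpha> * a \<alpha> r)"
        using A c'A by simp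
      also have "c' \<beta> * a \<beta> r = - (\<Sum>\<alpha>\<in>A'. c \<alpha> * a \<alpha> q / a \<beta> q * a \<beta> r)"
        by (simp add: c'_def sum_distrib_right)
      also have "\<dots> + (\<Sum>\<alpha>\<in>A'. c \<alpha> * a \<alpha> r) = (\<Sum>\<alpha>\<in>A'. c \<alpha> * (a \<alpha> r - a \<alpha> q / a \<beta> q * a \<beta> r))"
        by (simp add: algebra_simps sum_subtractf)
      finally show ?thesis .
    qed
    have "(\<Sum>\<alpha>\<in>A. c' \<alpha> * a \<alpha> q) = 0" unfolding sum using \<beta> by simp
    moreover have "\<exists>\<alpha>\<in>A. c' \<alpha> \<noteq> 0" using c(1) A by (auto simp: c'_def)
    ultimately show ?thesis using c(2) sum by (intro exI[of _ c']) auto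
  qed
qed

definition exp_bound :: "nat \<Rightarrow> 'k::comm_ring_1 mpoly \<Rightarrow> bool"
  where "exp_bound N p \<longleftrightarrow> (\<forall>u\<in>keys p. \<forall>j. lookup u j \<le> N)"

lemma exp_bound_mono: "exp_bound N p \<Longrightarrow> N \<le> N' \<Longrightarrow> exp_bound N' p"
  unfolding exp_bound_def by (meson order_trans)

lemma exp_bound_one: "exp_bound 0 1"
  by (simp add: exp_bound_def)

lemma exp_bound_mult:
  assumes "exp_bound N p" "exp_bound N' q" shows "exp_bound (N + N') (p * q)"
  unfolding exp_bound_def
proof (intro ballI allI)
  fix u j assume "u \<in> keys (p * q)"
  then obtain v w where "v \<in> keys p" "w \<in> keys q" "u = v + w"
    using keys_mult by blast
  then show "lookup u j \<le> N + N'"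
    using assms by (auto simp: exp_bound_def lookup_add intro: add_mono)
qed

lemma exp_bound_power: "exp_bound N p \<Longrightarrow> exp_bound (e * N) (p ^ e)"
  by (induction e) (auto simp: exp_bound_one intro: exp_bound_mult)

lemma exp_bound_prod:
  assumes "finite I" "\<And>i. i \<in> I \<Longrightarrow> exp_bound N (f i)" shows "exp_bound (card I * N) (prod f I)"
  using assms by (induction I rule: finite_induct) (auto simp: exp_bound_one intro: exp_bound_mult)

lemma exp_bound_exists: "\<exists>N. exp_bound N p"
proof -
  define N where "N = (\<Sum>u\<in>keys p. \<Sum>j\<in>keys u. lookup u j)"
  have "lookup u j \<le> N" if u: "u \<in> keys p" for u j
  proof (cases "j \<in> keys u")
    case True
    then have "lookup u j \<le> (\<Sum>j\<in>keys u. lookup u j)"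
      by (intro member_le_sum) auto
    also have "\<dots> \<le> N" unfolding N_def by (rule member_le_sum[OF u]) auto
    finally show ?thesis .
  qed (simp add: in_keys_iff)
  then show ?thesis by (auto simp: exp_bound_def)
qed

text \<open>Any \<open>n - k + 1\<close> polynomials satisfy a polynomial relation modulo \<open>(X\<^sub>1\<^sup>T, \<dots>, X\<^sub>k\<^sup>T)\<close>. If
  each exponent of the relation ranges over \<open>B\<close> values, there are \<open>B\<^sup>n\<^sup>-\<^sup>k\<^sup>+\<^sup>1\<close> products, while the
  monomials they can involve modulo these powers number at most a constant times \<open>B\<^sup>n\<^sup>-\<^sup>k\<close>.\<close>
lemma algebraic_relation:
  fixes x :: "nat \<Rightarrow> 'k::field mpoly"
  assumes "k \<le> n" and x: "\<And>i. i \<le> n - k \<Longrightarrow> x i \<in> polys n"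
  shows "\<exists>B (c :: (nat \<Rightarrow> nat) \<Rightarrow> 'k). (\<exists>\<alpha>\<in>PiE {..n - k} (\<lambda>_. {..<B}). c \<alpha> \<noteq> 0) \<and>
    (\<forall>u\<in>keys (\<Sum>\<alpha>\<in>PiE {..n - k} (\<lambda>_. {..<B}).
        single 0 (c \<alpha>) * (\<Prod>l\<in>{..n - k}. x l ^ \<alpha> l)).
      \<exists>j\<in>{1..k}. T \<le> lookup u j)"
proof -
  define r where "r = n - k"
  have "\<forall>i. \<exists>N. exp_bound N (x i)" using exp_bound_exists by blast
  then obtain N where N: "\<And>i. exp_bound (N i) (x i)" by metis
  define E where "E = (\<Sum>i\<le>r. N i)"
  have E: "exp_bound E (x i)" if "i \<le> r" for i
    by (rule exp_bound_mono[OF N[of i]]) (use that in \<open>auto simp: E_def intro!: member_le_sum\<close>)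
  \<comment> \<open>\<open>E\<close> bounds all exponents in the \<open>x i\<close>, so \<open>L\<close> bounds those in the products; \<open>B\<close> is chosen to beat the resulting constant\<close>
  define B where "B = T ^ k * (Suc r * Suc E) ^ r + 1"
  define L where "L = Suc r * Suc E * B"
  define Al where "Al = PiE {..r} (\<lambda>_. {..<B})"
  define m where "m \<alpha> = (\<Prod>l\<in>{..r}. x l ^ \<alpha> l)" for \<alpha> :: "nat \<Rightarrow> nat"
  have m_bound: "lookup u j < L"
    if \<alpha>: "\<alpha> \<in> Al" and u: "u \<in> keys (m \<alpha>)" for \<alpha> u j
  proof -
    have "exp_bound (card {..r} * (B * E)) (m \<alpha>)" unfolding m_def
    proof (rule exp_bound_prod)
      fix l assume l: "l \<in> {..r}"
      then have "exp_bound (\<alpha> l * E) (x l ^ \<alpha> l)" using E by (intro exp_bound_power) auto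
      moreover have "\<alpha> l \<le> B" using PiE_mem[OF \<alpha>[unfolded Al_def] l] by simp
      ultimately show "exp_bound (B * E) (x l ^ \<alpha> l)" using exp_bound_mono mult_le_mono1 by blast
    qed simp
    then have "lookup u j \<le> Suc r * (B * E)" using u by (auto simp: exp_bound_def)
    also have "\<dots> < L" by (simp add: L_def B_def algebra_simps)
    finally show ?thesis .
  qed
  have m_carrier: "m \<alpha> \<in> polys n" for \<alpha>
    unfolding m_def using x by (intro poly_carrier_prod poly_carrier_power) (auto simp: r_def)
  define Q where "Q = {u \<in> expos n. (\<forall>j\<in>{1..k}. lookup u j < T) \<and> (\<forall>j\<in>{Suc k..n}. lookup u j < L)}"
  define P where "P = PiE {1..n} (\<lambda>j. if j \<le> k then {..<T} else {..<L})"
  have "finite P" unfolding P_def by (intro finite_PiE) auto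
  have inj: "inj_on (\<lambda>u. restrict (lookup u) {1..n}) Q"
  proof (rule inj_onI)
    fix u v assume uv: "u \<in> Q" "v \<in> Q"
      and eq: "restrict (lookup u) {1..n} = restrict (lookup v) {1..n}"
    show "u = v"
    proof (rule poly_mapping_eqI)
      fix i show "lookup u i = lookup v i"
      proof (cases "i \<in> {1..n}")
        case True then show ?thesis using fun_cong[OF eq, of i] by simp
      next
        case False
        then have "i \<notin> keys u" "i \<notin> keys v"
          using uv unfolding Q_def expos_def by auto
        then show ?thesis by (simp add: in_keys_iff)
      qed
    qed
  qed
  have sub: "(\<lambda>u. restrict (lookup u) {1..n}) ` Q \<subseteq> P"
    unfolding P_def Q_def by (intro image_subsetI PiE_I) auto
  have finQ: "finite Q" using inj_on_finite[OF inj sub \<open>finite P\<close>] .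
  have "card Q \<le> card P" by (rule card_inj_on_le[OF inj sub \<open>finite P\<close>])
  also have "card P = (\<Prod>j\<in>{1..n}. if j \<le> k then T else L)"
    unfolding P_def by (subst card_PiE) (auto intro!: prod.cong)
  also have "\<dots> = (\<Prod>j\<in>{1..k} \<union> {Suc k..n}. if j \<le> k then T else L)"
    by (rule arg_cong[where f = "prod _"]) (use assms(1) in auto)
  also have "\<dots> = T ^ k * L ^ r" by (subst prod.union_disjoint) (auto simp: r_def)
  also have "\<dots> = T ^ k * (Suc r * Suc E) ^ r * B ^ r"
    unfolding L_def power_mult_distrib by (simp add: mult.assoc)
  also have "\<dots> < B * B ^ r"
    by (rule mult_strict_right_mono) (simp_all add: B_def)
  also have "\<dots> = card Al" unfolding Al_def by (subst card_PiE) auto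
  finally have "card Q < card Al" .
  moreover have finA: "finite Al" unfolding Al_def by (intro finite_PiE) auto
  ultimately obtain c where c: "\<exists>\<alpha>\<in>Al. c \<alpha> \<noteq> 0"
    "\<And>u. u \<in> Q \<Longrightarrow> (\<Sum>\<alpha>\<in>Al. c \<alpha> * lookup (m \<alpha>) u) = 0"
    using exists_nontrivial_solution[OF finQ finA, of "\<lambda>\<alpha> u. lookup (m \<alpha>) u"] by blast
  have lc: "lookup (single 0 a * p) u = a * lookup p u" for a u and p :: "'k mpoly"
    using lookup_monomial_mult[of 0 a p u] by simp
  show ?thesis
  proof (intro exI conjI ballI)
    show "\<exists>\<alpha>\<in>PiE {..n - k} (\<lambda>_. {..<B}). c \<alpha> \<noteq> 0" using c(1) by (simp add: Al_def r_def)
    fix u assume "u \<in> keys (\<Sum>\<alpha>\<in>PiE {..n - k} (\<lambda>_. {..<B}).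
        single 0 (c \<alpha>) * (\<Prod>l\<in>{..n - k}. x l ^ \<alpha> l))"
    then have "lookup (\<Sum>\<alpha>\<in>Al. single 0 (c \<alpha>) * m \<alpha>) u \<noteq> 0"
      by (simp add: Al_def m_def r_def in_keys_iff)
    then have ne: "(\<Sum>\<alpha>\<in>Al. c \<alpha> * lookup (m \<alpha>) u) \<noteq> 0" by (simp add: lookup_sum lc)
    then have "u \<notin> Q" using c(2) by blast
    obtain \<alpha> where \<alpha>: "\<alpha> \<in> Al" "lookup (m \<alpha>) u \<noteq> 0"
      using ne by (metis (mono_tags, lifting) mult_zero_right sum.neutral)
    then have k: "u \<in> keys (m \<alpha>)" by (simp add: in_keys_iff)
    then have "u \<in> expos n" using m_carrier[of \<alpha>] by (auto simp: carrier_poly_ring)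
    then have "\<not> (\<forall>j\<in>{1..k}. lookup u j < T)" using \<open>u \<notin> Q\<close> m_bound[OF \<alpha>(1) k] by (simp add: Q_def)
    then show "\<exists>j\<in>{1..k}. T \<le> lookup u j" by (meson not_less)
  qed
qed

text \<open>The set of exponents occurring in the relation is thinned out one variable at a time. At stage \<open>i\<close>
  the smallest power of \<open>x i\<close> is cancelled by regularity, and the terms that still contain \<open>x i\<close> are
  absorbed into \<open>V (i + 1)\<close>. In the end a single term remains, a nonzero constant times \<open>z\<close>. With
  \<open>V i\<close> a chain of primes and \<open>z = 1\<close> this bounds Krull dimension, and with \<open>V i\<close> the submodules
  generated by the initial segments of a regular sequence it bounds depth.\<close>
lemma relation_chain:
  fixes x :: "nat \<Rightarrow> 'k::field mpoly"
  assumes V: "\<And>i. i \<le> Suc r \<Longrightarrow> ideal (V i) (poly_ring n)" and W: "ideal W (poly_ring n)"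
    and inc: "\<And>i. i \<le> r \<Longrightarrow> V i \<subseteq> V (Suc i)"
    and x: "\<And>i. i \<le> r \<Longrightarrow> x i \<in> polys n" and z: "z \<in> W"
    and reg: "\<And>i y. i \<le> r \<Longrightarrow> y \<in> W \<Longrightarrow> x i * y \<in> V i \<Longrightarrow> y \<in> V i"
    and up: "\<And>i y. i \<le> r \<Longrightarrow> y \<in> W \<Longrightarrow> x i * y \<in> V (Suc i)"
    and Al: "finite Al" "Al \<subseteq> extensional {..r}" "\<exists>\<alpha>\<in>Al. c \<alpha> \<noteq> 0"
    and rel: "(\<Sum>\<alpha>\<in>Al. single 0 (c \<alpha>) * (\<Prod>l\<in>{..r}. x l ^ \<alpha> l)) * z \<in> V 0"
  shows "z \<in> V (Suc r)"
proof -
  define t where "t i \<alpha> = single 0 (c \<alpha>) * (\<Prod>l\<in>{i..r}. x l ^ \<alpha> l)" for i and \<alpha> :: "nat \<Rightarrow> nat"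
  have const: "single 0 a \<in> polys n" for a :: 'k
    by (rule poly_carrier_single) simp
  have t_carrier: "t i \<alpha> \<in> polys n" for i \<alpha>
    unfolding t_def using x const by (intro poly_carrier_intros(4) poly_carrier_prod poly_carrier_power) auto
  have cancel: "y \<in> V i" if "i \<le> r" "y \<in> W" "x i ^ e * y \<in> V i" for i e y
    using that
  proof (induction e)
    case (Suc e)
    have "x i ^ e * y \<in> W" using Suc x by (intro poly_idealD(4)[OF W]) auto
    then have "x i ^ e * y \<in> V i" using Suc reg[of i "x i ^ e * y"] by (simp add: mult.assoc)
    then show ?case using Suc by blast
  qed simp
  have "\<exists>G\<subseteq>Al. G \<noteq> {} \<and> (\<forall>\<alpha>\<in>G. c \<alpha> \<noteq> 0) \<and> (\<forall>\<alpha>\<in>G. \<forall>\<beta>\<in>G. \<forall>l<i. \<alpha> l = \<beta> l) \<and>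
      (\<Sum>\<alpha>\<in>G. t i \<alpha>) * z \<in> V i" if "i \<le> Suc r" for i
    using that
  proof (induction i)
    case 0
    define G where "G = {\<alpha>\<in>Al. c \<alpha> \<noteq> 0}"
    have "(\<Sum>\<alpha>\<in>G. t 0 \<alpha>) = (\<Sum>\<alpha>\<in>Al. t 0 \<alpha>)"
      by (rule sum.mono_neutral_left) (use Al in \<open>auto simp: G_def t_def\<close>)
    also have "\<dots> * z \<in> V 0" using rel by (simp add: t_def atLeast0AtMost)
    finally show ?case using Al(3) by (intro exI[of _ G]) (auto simp: G_def)
  next
    case (Suc i)
    then have i: "i \<le> r" by simp
    from Suc obtain G where G: "G \<subseteq> Al" "G \<noteq> {}" "\<forall>\<alpha>\<in>G. c \<alpha> \<noteq> 0"
      "\<forall>\<alpha>\<in>G. \<forall>\<beta>\<in>G. \<forall>l<i. \<alpha> l = \<beta> l" "(\<Sum>\<alpha>\<in>G. t i \<alpha>) * z \<in> V i" by auto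
    have finG: "finite G" using G(1) Al(1) finite_subset by blast
    \<comment> \<open>factor out the smallest power of \<open>x i\<close>; \<open>G'\<close> collects the exponents attaining it\<close>
    define a where "a = Min ((\<lambda>\<alpha>. \<alpha> i) ` G)"
    have a_le: "a \<le> \<alpha> i" if "\<alpha> \<in> G" for \<alpha> using that finG by (auto simp: a_def)
    have "a \<in> (\<lambda>\<alpha>. \<alpha> i) ` G" unfolding a_def using finG G(2) by (intro Min_in) auto
    then obtain \<beta> where \<beta>: "\<beta> \<in> G" "\<beta> i = a" by auto
    define G' where "G' = {\<alpha>\<in>G. \<alpha> i = a}"
    define y where "y = (\<Sum>\<alpha>\<in>G. x i ^ (\<alpha> i - a) * t (Suc i) \<alpha>) * z"
    have split_t: "t i \<alpha> = x i ^ a * (x i ^ (\<alpha> i - a) * t (Suc i) \<alpha>)" if "\<alpha> \<in> G" for \<alpha>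
    proof -
      have "{i..r} = insert i {Suc i..r}" using i by auto
      then have "t i \<alpha> = x i ^ \<alpha> i * t (Suc i) \<alpha>" by (simp add: t_def)
      also have "x i ^ \<alpha> i = x i ^ a * x i ^ (\<alpha> i - a)" using a_le[OF that] by (simp flip: power_add)
      finally show ?thesis by (simp add: mult.assoc)
    qed
    have zc: "z \<in> polys n" using z poly_idealD(1)[OF W] by blast
    have tz: "p * z \<in> W" if "p \<in> polys n" for p using poly_idealD(4)[OF W that z] .
    have yW: "y \<in> W" unfolding y_def using t_carrier x[OF i]
      by (intro tz poly_carrier_sum poly_carrier_intros(4) poly_carrier_power) auto
    have "(\<Sum>\<alpha>\<in>G. t i \<alpha>) * z = x i ^ a * y"
      by (simp add: y_def split_t sum_distrib_left sum_distrib_right mult.assoc)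
    then have "y \<in> V i" using cancel[OF i yW] G(5) by simp
    then have yV: "y \<in> V (Suc i)" using inc[OF i] by blast
    have y_split: "y = (\<Sum>\<alpha>\<in>G'. t (Suc i) \<alpha>) * z + (\<Sum>\<alpha>\<in>G - G'. x i ^ (\<alpha> i - a) * t (Suc i) \<alpha>) * z"
    proof -
      have "(\<Sum>\<alpha>\<in>G. x i ^ (\<alpha> i - a) * t (Suc i) \<alpha>) =
          (\<Sum>\<alpha>\<in>G'. x i ^ (\<alpha> i - a) * t (Suc i) \<alpha>) + (\<Sum>\<alpha>\<in>G - G'. x i ^ (\<alpha> i - a) * t (Suc i) \<alpha>)"
        using finG by (intro sum.subset_diff[THEN trans, OF _ _ add.commute]) (auto simp: G'_def)
      moreover have "(\<Sum>\<alpha>\<in>G'. x i ^ (\<alpha> i - a) * t (Suc i) \<alpha>) = (\<Sum>\<alpha>\<in>G'. t (Suc i) \<alpha>)"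
        by (rule sum.cong) (auto simp: G'_def)
      ultimately show ?thesis by (simp add: y_def distrib_right)
    qed
    have "(\<Sum>\<alpha>\<in>G - G'. x i ^ (\<alpha> i - a) * t (Suc i) \<alpha>) * z \<in> V (Suc i)"
      unfolding sum_distrib_right
    proof (rule poly_ideal_sum[OF V])
      fix \<alpha> assume \<alpha>: "\<alpha> \<in> G - G'"
      then have "\<alpha> i - a = Suc (\<alpha> i - a - 1)" using a_le[of \<alpha>] by (auto simp: G'_def)
      then have "x i ^ (\<alpha> i - a) * t (Suc i) \<alpha> * z = x i * (x i ^ (\<alpha> i - a - 1) * t (Suc i) \<alpha> * z)"
        by (metis (no_types, lifting) mult.assoc power_Suc)
      moreover have "x i ^ (\<alpha> i - a - 1) * t (Suc i) \<alpha> * z \<in> W"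
        using t_carrier x[OF i] by (intro tz poly_carrier_intros(4) poly_carrier_power) auto
      ultimately show "x i ^ (\<alpha> i - a) * t (Suc i) \<alpha> * z \<in> V (Suc i)" using up[OF i] by (simp only:)
    qed (use i in simp)
    from poly_idealD(5)[OF V[OF Suc.prems] yV this]
    have "(\<Sum>\<alpha>\<in>G'. t (Suc i) \<alpha>) * z \<in> V (Suc i)" unfolding y_split by simp
    moreover have "G' \<subseteq> Al" "G' \<noteq> {}" "\<forall>\<alpha>\<in>G'. c \<alpha> \<noteq> 0" using G \<beta> by (auto simp: G'_def)
    moreover have "\<forall>\<alpha>\<in>G'. \<forall>\<beta>\<in>G'. \<forall>l<Suc i. \<alpha> l = \<beta> l"
      using G(4) by (auto simp: G'_def less_Suc_eq)
    ultimately show ?case by blast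
  qed
  from this[OF order.refl] obtain G where G: "G \<subseteq> Al" "G \<noteq> {}" "\<forall>\<alpha>\<in>G. c \<alpha> \<noteq> 0"
      "\<forall>\<alpha>\<in>G. \<forall>\<beta>\<in>G. \<forall>l<Suc r. \<alpha> l = \<beta> l" "(\<Sum>\<alpha>\<in>G. t (Suc r) \<alpha>) * z \<in> V (Suc r)" by auto
  obtain \<alpha> where \<alpha>: "\<alpha> \<in> G" using G(2) by blast
  have "\<beta> = \<alpha>" if "\<beta> \<in> G" for \<beta>
    by (rule extensionalityI[of _ "{..r}"]) (use that \<alpha> G Al(2) in \<open>auto simp: less_Suc_eq_le\<close>)
  then have "G = {\<alpha>}" using \<alpha> by blast
  then have "single 0 (c \<alpha>) * z \<in> V (Suc r)" using G(5) by (simp add: t_def)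
  then have "single 0 (1 / c \<alpha>) * (single 0 (c \<alpha>) * z) \<in> V (Suc r)"
    by (rule poly_idealD(4)[OF V[OF order.refl] const])
  moreover have "c \<alpha> \<noteq> 0" using G(3) \<alpha> by blast
  then have "single 0 (1 / c \<alpha>) * (single 0 (c \<alpha>) * z) = z"
    by (simp only: mult.assoc[symmetric] mult_single) simp
  ultimately show ?thesis by simp
qed

lemma power_multiples_mem:
  fixes p :: "'k::field mpoly"
  assumes V: "ideal V (poly_ring n)" and p: "p \<in> polys n"
    and keys: "\<And>u. u \<in> keys p \<Longrightarrow> \<exists>j\<in>J. t \<le> lookup u j"
    and w: "\<And>j. j \<in> J \<Longrightarrow> Xvar j ^ t * w \<in> V"
  shows "p * w \<in> V"
proof -
  have mono: "single u c * w \<in> V" if u: "u \<in> keys p" for u c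
  proof -
    obtain j where j: "j \<in> J" "t \<le> lookup u j" using keys[OF u] by blast
    let ?e = "single j t"
    have eu: "u = (u - ?e) + ?e"
      using j by (intro poly_mapping_eqI) (auto simp: lookup_add lookup_minus lookup_single when_def)
    have "u \<in> expos n" using u p by (auto simp: carrier_poly_ring)
    then have "u - ?e \<in> expos n" using eu expos_add[of "u - ?e" ?e n] by simp
    then have "single (u - ?e) c * (Xvar j ^ t * w) \<in> V"
      using poly_idealD(4)[OF V poly_carrier_single w[OF j(1)]] by blast
    moreover have "single u c = single (u - ?e) c * Xvar j ^ t"
      by (subst eu) (simp add: Xvar_power mult_single)
    ultimately show ?thesis by (simp add: mult.assoc)
  qed
  have "p * w = (\<Sum>u\<in>keys p. single u (lookup p u) * w)"
    by (subst poly_expand[of p]) (simp add: sum_distrib_right)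
  also have "\<dots> \<in> V" by (rule poly_ideal_sum[OF V]) (rule mono)
  finally show ?thesis .
qed

lemma no_long_chain:
  fixes V :: "nat \<Rightarrow> 'k::field mpoly set"
  assumes "k \<le> n" and V: "\<And>i. i \<le> Suc (n - k) \<Longrightarrow> ideal (V i) (poly_ring n)" and W: "ideal W (poly_ring n)"
    and inc: "\<And>i. i \<le> n - k \<Longrightarrow> V i \<subseteq> V (Suc i)"
    and x: "\<And>i. i \<le> n - k \<Longrightarrow> x i \<in> polys n"
    and reg: "\<And>i y. i \<le> n - k \<Longrightarrow> y \<in> W \<Longrightarrow> x i * y \<in> V i \<Longrightarrow> y \<in> V i"
    and up: "\<And>i y. i \<le> n - k \<Longrightarrow> y \<in> W \<Longrightarrow> x i * y \<in> V (Suc i)"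
    and nil: "\<And>j y. j \<in> {1..k} \<Longrightarrow> y \<in> W \<Longrightarrow> Xvar j ^ t * y \<in> V 0"
  shows "W \<subseteq> V (Suc (n - k))"
proof
  fix z assume z: "z \<in> W"
  obtain B and c :: "(nat \<Rightarrow> nat) \<Rightarrow> 'k" where c: "\<exists>\<alpha>\<in>PiE {..n - k} (\<lambda>_. {..<B}). c \<alpha> \<noteq> 0"
    and keys: "\<forall>u\<in>keys (\<Sum>\<alpha>\<in>PiE {..n - k} (\<lambda>_. {..<B}).
        single 0 (c \<alpha>) * (\<Prod>l\<in>{..n - k}. x l ^ \<alpha> l)).
      \<exists>j\<in>{1..k}. t \<le> lookup u j"
    using algebraic_relation[OF assms(1), where T = t and x = x] x by blast
  show "z \<in> V (Suc (n - k))"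
  proof (rule relation_chain[where V = V and W = W and x = x and c = c and Al = "PiE {..n - k} (\<lambda>_. {..<B})"])
    show "finite (PiE {..n - k} (\<lambda>_. {..<B}))" by (intro finite_PiE) auto
    show "PiE {..n - k} (\<lambda>_. {..<B}) \<subseteq> extensional {..n - k}" by (auto simp: PiE_def)
    show "\<exists>\<alpha>\<in>PiE {..n - k} (\<lambda>_. {..<B}). c \<alpha> \<noteq> 0" by (rule c)
    show "(\<Sum>\<alpha>\<in>PiE {..n - k} (\<lambda>_. {..<B}).
        single 0 (c \<alpha>) * (\<Prod>l\<in>{..n - k}. x l ^ \<alpha> l)) * z \<in> V 0"
    proof (rule power_multiples_mem[OF _ _ keys[rule_format]])
      show "ideal (V 0) (poly_ring n)" by (rule V) simp
      show "(\<Sum>\<alpha>\<in>PiE {..n - k} (\<lambda>_. {..<B}).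
        single 0 (c \<alpha>) * (\<Prod>l\<in>{..n - k}. x l ^ \<alpha> l)) \<in> polys n"
        using x by (intro poly_carrier_sum poly_carrier_intros(4) poly_carrier_prod poly_carrier_power poly_carrier_single) auto
    qed (use nil z in auto)
  qed (fact V W inc x z reg up)+
qed

text \<open>Apply \<open>no_long_chain\<close> to the whole ring, with \<open>x i\<close> chosen in \<open>P (i + 1)\<close> outside \<open>P i\<close>.\<close>
lemma prime_chain_length:
  fixes P :: "nat \<Rightarrow> 'k::field mpoly set"
  assumes "k \<le> n" and P: "\<And>i. i \<le> m \<Longrightarrow> primeideal (P i) (poly_ring n)"
    and strict: "\<And>i. i < m \<Longrightarrow> P i \<subset> P (Suc i)"
    and X: "\<And>j. j \<in> {1..k} \<Longrightarrow> Xvar j \<in> P 0"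
  shows "m \<le> n - k"
proof (rule ccontr)
  assume "\<not> m \<le> n - k"
  then have m: "Suc (n - k) \<le> m" by simp
  have id: "ideal (P i) (poly_ring n)" if "i \<le> m" for i using P[OF that] by (simp add: primeideal_def)
  have "\<exists>y. y \<in> P (Suc i) \<and> y \<notin> P i" if "i \<le> n - k" for i
    using strict[of i] that m by auto
  then obtain x where x: "\<And>i. i \<le> n - k \<Longrightarrow> x i \<in> P (Suc i) \<and> x i \<notin> P i" by metis
  have xc: "x i \<in> polys n" if "i \<le> n - k" for i
    using x[OF that] poly_idealD(1)[OF id[of "Suc i"]] that m by auto
  have "polys n \<subseteq> P (Suc (n - k))"
  proof (rule no_long_chain[OF assms(1), where x = x and t = 1])
    show "ideal (carrier (poly_ring n :: 'k mpoly ring)) (poly_ring n)"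
      using cring_poly_ring cring.axioms(1) ring.oneideal by blast
    fix i and y :: "'k mpoly" assume i: "i \<le> n - k"
    show "x i \<in> polys n" using xc i .
    show "P i \<subseteq> P (Suc i)" using strict[of i] i m by auto
    assume y: "y \<in> polys n"
    show "x i * y \<in> P (Suc i)"
    proof -
      have "Suc i \<le> m" using i m by simp
      then have "y * x i \<in> P (Suc i)" using poly_idealD(4)[OF id y] x[OF i] by blast
      then show ?thesis by (simp add: mult.commute)
    qed
    show "y \<in> P i" if "x i * y \<in> P i"
      using primeideal.I_prime[OF P[of i] xc[OF i] y] that x[OF i] i m by simp
  next
    fix j and y :: "'k mpoly" assume "j \<in> {1..k}" and y: "y \<in> polys n"
    then show "Xvar j ^ 1 * y \<in> P 0"
      using poly_idealD(4)[OF id[of 0] y X[of j]] by (simp add: mult.commute)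
  qed (use id m in auto)
  then show False
    using P[OF m] poly_idealD(1)[OF id[OF m]] primeideal.I_notcarr by blast
qed

text \<open>The prime ideal \<open>(X\<^sub>1, \<dots>, X\<^sub>j)\<close>.\<close>
definition var_ideal :: "nat \<Rightarrow> nat \<Rightarrow> 'k::field mpoly set"
  where "var_ideal n j = {p \<in> polys n. \<forall>u\<in>keys p. \<exists>l\<in>{1..j}. 0 < lookup u l}"

lemma ideal_var_ideal: "ideal (var_ideal n j) (poly_ring n)"
proof (rule poly_idealI)
  show "x + y \<in> var_ideal n j" if "x \<in> var_ideal n j" "y \<in> var_ideal n j" for x y :: "'a mpoly"
    using that Poly_Mapping.keys_add[of x y] unfolding var_ideal_def
    by (intro CollectI conjI ballI poly_carrier_intros(3)) (auto 0 3)
  show "r * x \<in> var_ideal n j" if r: "r \<in> polys n" and x: "x \<in> var_ideal n j" for r x :: "'a mpoly"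
    unfolding var_ideal_def
  proof (intro CollectI conjI ballI)
    show "r * x \<in> polys n" using that by (simp add: var_ideal_def)
    fix u assume "u \<in> keys (r * x)"
    then obtain v w where v: "u = v + w" "w \<in> keys x" using keys_mult[of r x] by blast
    then obtain l where "l \<in> {1..j}" "0 < lookup w l" using x unfolding var_ideal_def by blast
    then show "\<exists>l\<in>{1..j}. 0 < lookup u l" using v(1) by (intro bexI[of _ l]) (auto simp: lookup_add)
  qed
qed (auto simp: var_ideal_def)

text \<open>Modulo the ideal both factors can be replaced by polynomials in \<open>X\<^sub>j\<^sub>+\<^sub>1, X\<^sub>j\<^sub>+\<^sub>2, \<dots>\<close>, and their
  product is again one, so it lies in the ideal only if it is zero.\<close>
lemma primeideal_var_ideal: "primeideal (var_ideal n j :: 'k::field mpoly set) (poly_ring n)"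
proof (rule primeidealI[OF ideal_var_ideal cring_poly_ring])
  have "(1 :: 'k mpoly) \<notin> var_ideal n j" by (simp add: var_ideal_def)
  then show "polys n \<noteq> (var_ideal n j :: 'k mpoly set)" using poly_carrier_intros(2) by blast
  fix a b :: "'k mpoly"
  assume a: "a \<in> polys n" and b: "b \<in> polys n"
    and "a \<otimes>\<^bsub>poly_ring n\<^esub> b \<in> var_ideal n j"
  then have ab: "a * b \<in> var_ideal n j" by simp
  define U where "U = {u :: expo. \<exists>l\<in>{1..j}. 0 < lookup u l}"
  have dec: "p = restr U p + restr (- U) p" for p :: "'k mpoly"
    by (rule poly_mapping_eqI) (simp add: lookup_add lookup_restr when_def)
  have inU: "restr U p \<in> var_ideal n j" if "p \<in> polys n" for p :: "'k mpoly"
    using restr_carrier[OF that] unfolding var_ideal_def by (auto simp: keys_restr U_def)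
  have mem: "p \<in> var_ideal n j" if "restr (- U) p = 0" "p \<in> polys n" for p :: "'k mpoly"
    using dec[of p] inU[OF that(2)] that(1) by simp
  let ?a = "restr (- U) a" and ?b = "restr (- U) b"
  have "a\<^sub>2 * b\<^sub>2 = a * b - (b * a\<^sub>1 + a\<^sub>2 * b\<^sub>1)" if "a = a\<^sub>1 + a\<^sub>2" "b = b\<^sub>1 + b\<^sub>2" for a\<^sub>1 a\<^sub>2 b\<^sub>1 b\<^sub>2
    using that by (simp add: algebra_simps)
  from this[OF dec dec] have "?a * ?b = a * b - (b * restr U a + ?a * restr U b)" .
  also have "\<dots> \<in> var_ideal n j"
    using poly_idealD[OF ideal_var_ideal] ab inU a b restr_carrier by metis
  finally have "?a * ?b \<in> var_ideal n j" .
  moreover have "u \<notin> U" if "u \<in> keys (?a * ?b)" for u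
    using that keys_mult[of ?a ?b] by (force simp: keys_restr U_def lookup_add)
  ultimately have "keys (?a * ?b) = {}" unfolding var_ideal_def U_def by blast
  then have "?a * ?b = 0" by simp
  then show "a \<in> var_ideal n j \<or> b \<in> var_ideal n j" using mem a b by auto
qed

lemma var_ideal_strict: "j < n \<Longrightarrow> var_ideal n j \<subset> (var_ideal n (Suc j) :: 'k::field mpoly set)"
proof
  assume j: "j < n"
  show "var_ideal n j \<subseteq> (var_ideal n (Suc j) :: 'k mpoly set)"
    unfolding var_ideal_def by (intro Collect_mono conjI impI ballI) (meson atLeastAtMost_iff le_SucI)+
  have "(Xvar (Suc j) :: 'k mpoly) \<in> var_ideal n (Suc j)" "(Xvar (Suc j) :: 'k mpoly) \<notin> var_ideal n j"
    using Xvar_carrier[of "Suc j" n] j by (auto simp: var_ideal_def Xvar_def lookup_single when_def)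
  then show "var_ideal n j \<noteq> (var_ideal n (Suc j) :: 'k mpoly set)" by blast
qed

section \<open>Modules presented as quotients of two ideals\<close>

lemma module_hom_imageI:
  fixes R (structure)
  assumes M: "Module.module R M"
    and carr: "carrier Q = \<phi> ` carrier M" and zero: "\<zero>\<^bsub>Q\<^esub> = \<phi> \<zero>\<^bsub>M\<^esub>"
    and add: "\<And>x y. x \<in> carrier M \<Longrightarrow> y \<in> carrier M \<Longrightarrow> \<phi> x \<oplus>\<^bsub>Q\<^esub> \<phi> y = \<phi> (x \<oplus>\<^bsub>M\<^esub> y)"
    and smult: "\<And>r x. r \<in> carrier R \<Longrightarrow> x \<in> carrier M \<Longrightarrow> r \<odot>\<^bsub>Q\<^esub> \<phi> x = \<phi> (r \<odot>\<^bsub>M\<^esub> x)"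
  shows "Module.module R Q"
proof -
  interpret M: Module.module R M by fact
  show ?thesis
  proof (rule moduleI)
    show "cring R" by (rule M.R.is_cring)
    show "abelian_group Q"
    proof (rule abelian_groupI)
      fix x assume "x \<in> carrier Q"
      then obtain a where "a \<in> carrier M" "x = \<phi> a" using carr by auto
      then show "\<exists>y\<in>carrier Q. y \<oplus>\<^bsub>Q\<^esub> x = \<zero>\<^bsub>Q\<^esub>"
        by (intro bexI[of _ "\<phi> (\<ominus>\<^bsub>M\<^esub> a)"]) (auto simp: add zero carr M.M.l_neg)
    qed (auto simp: carr zero add M.M.a_ac)
  qed (auto simp: carr add smult M.smult_l_distr M.smult_r_distr M.smult_assoc1)
qed

lemma submodule_abelian_subgroup:
  assumes "Module.module R M" "submodule N R M" shows "abelian_subgroup N M"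
  using assms by (intro abelian_subgroupI3 additive_subgroupI) (auto simp: submodule_def Module.module_def)

lemma
  assumes M: "Module.module R M" and N: "submodule N R M"
  shows quot_module_carrier: "carrier (quot_module M N) = (\<lambda>x. N +>\<^bsub>M\<^esub> x) ` carrier M"
    and quot_module_zero: "\<zero>\<^bsub>quot_module M N\<^esub> = N +>\<^bsub>M\<^esub> \<zero>\<^bsub>M\<^esub>"
    and quot_module_add: "x \<in> carrier M \<Longrightarrow> y \<in> carrier M \<Longrightarrow>
      (N +>\<^bsub>M\<^esub> x) \<oplus>\<^bsub>quot_module M N\<^esub> (N +>\<^bsub>M\<^esub> y) = N +>\<^bsub>M\<^esub> (x \<oplus>\<^bsub>M\<^esub> y)"
    and quot_module_smult: "r \<in> carrier R \<Longrightarrow> x \<in> carrier M \<Longrightarrow>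
      r \<odot>\<^bsub>quot_module M N\<^esub> (N +>\<^bsub>M\<^esub> x) = N +>\<^bsub>M\<^esub> (r \<odot>\<^bsub>M\<^esub> x)"
    and quot_module_eq_zero: "x \<in> carrier M \<Longrightarrow> N +>\<^bsub>M\<^esub> x = \<zero>\<^bsub>quot_module M N\<^esub> \<longleftrightarrow> x \<in> N"
    and quot_module_module: "Module.module R (quot_module M N)"
proof -
  interpret M: Module.module R M by fact
  interpret N: abelian_subgroup N M by (rule submodule_abelian_subgroup[OF M N])
  show carr: "carrier (quot_module M N) = (\<lambda>x. N +>\<^bsub>M\<^esub> x) ` carrier M"
    by (auto simp: quot_module_def A_RCOSETS_def')
  have zeroN: "\<zero>\<^bsub>M\<^esub> \<in> N" using N.zero_closed .
  show zero: "\<zero>\<^bsub>quot_module M N\<^esub> = N +>\<^bsub>M\<^esub> \<zero>\<^bsub>M\<^esub>"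
    using N.a_rcos_const[OF zeroN] by (simp add: quot_module_def)
  show add: "(N +>\<^bsub>M\<^esub> x) \<oplus>\<^bsub>quot_module M N\<^esub> (N +>\<^bsub>M\<^esub> y) = N +>\<^bsub>M\<^esub> (x \<oplus>\<^bsub>M\<^esub> y)"
    if "x \<in> carrier M" "y \<in> carrier M" for x y
    using N.a_rcos_sum[OF that] by (simp add: quot_module_def)
  show eq0: "N +>\<^bsub>M\<^esub> x = \<zero>\<^bsub>quot_module M N\<^esub> \<longleftrightarrow> x \<in> N" if "x \<in> carrier M" for x
    using N.a_rcos_const[of x] N.a_rcos_self[OF that] by (auto simp: quot_module_def)
  show smult: "r \<odot>\<^bsub>quot_module M N\<^esub> (N +>\<^bsub>M\<^esub> x) = N +>\<^bsub>M\<^esub> (r \<odot>\<^bsub>M\<^esub> x)"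
    if r: "r \<in> carrier R" and x: "x \<in> carrier M" for r x
  proof -
    have "N +>\<^bsub>M\<^esub> (r \<odot>\<^bsub>M\<^esub> y) = N +>\<^bsub>M\<^esub> (r \<odot>\<^bsub>M\<^esub> x)" if y: "y \<in> N +>\<^bsub>M\<^esub> x" for y
    proof -
      obtain h where h: "h \<in> N" "y = h \<oplus>\<^bsub>M\<^esub> x" using y by (auto simp: a_r_coset_def')
      have rh: "r \<odot>\<^bsub>M\<^esub> h \<in> N" using M.submoduleE(4)[OF N r h(1)] .
      have "r \<odot>\<^bsub>M\<^esub> y = r \<odot>\<^bsub>M\<^esub> h \<oplus>\<^bsub>M\<^esub> r \<odot>\<^bsub>M\<^esub> x"
        using h r x N.a_Hcarr M.smult_r_distr by simp
      then have "r \<odot>\<^bsub>M\<^esub> y \<in> N +>\<^bsub>M\<^esub> (r \<odot>\<^bsub>M\<^esub> x)" using rh by (auto simp: a_r_coset_def')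
      then show ?thesis using N.a_repr_independence'[of _ "r \<odot>\<^bsub>M\<^esub> x"] r x by simp
    qed
    then have "(\<Union>y\<in>N +>\<^bsub>M\<^esub> x. N +>\<^bsub>M\<^esub> (r \<odot>\<^bsub>M\<^esub> y)) = N +>\<^bsub>M\<^esub> (r \<odot>\<^bsub>M\<^esub> x)"
      using N.a_rcos_self[OF x] by blast
    then show ?thesis by (simp add: quot_module_def)
  qed
  show "Module.module R (quot_module M N)"
    by (rule module_hom_imageI[OF M carr zero add smult])
qed

lemma gen_submodule_props:
  assumes M: "Module.module R M" and "B \<subseteq> carrier M"
  shows "submodule (gen_submodule R M B) R M" "B \<subseteq> gen_submodule R M B"
    "\<And>N. submodule N R M \<Longrightarrow> B \<subseteq> N \<Longrightarrow> gen_submodule R M B \<subseteq> N"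
proof -
  interpret M: Module.module R M by fact
  show "submodule (gen_submodule R M B) R M"
  proof (rule M.submoduleI)
    show "gen_submodule R M B \<subseteq> carrier M"
      using M.carrier_is_submodule assms(2) by (auto simp: gen_submodule_def)
    show "\<zero>\<^bsub>M\<^esub> \<in> gen_submodule R M B"
      using submodule_abelian_subgroup[OF M] unfolding gen_submodule_def
      by (auto intro: additive_subgroup.zero_closed abelian_subgroup.axioms(1))
  qed (auto simp: gen_submodule_def dest: M.submoduleE)
qed (auto simp: gen_submodule_def)

lemma seq_submodule_props:
  assumes M: "Module.module R M" and rs: "set rs \<subseteq> carrier R"
  shows "submodule (seq_submodule R M rs) R M"
    and "r \<in> set rs \<Longrightarrow> x \<in> carrier M \<Longrightarrow> r \<odot>\<^bsub>M\<^esub> x \<in> seq_submodule R M rs"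
    and "submodule N R M \<Longrightarrow> (\<And>r x. r \<in> set rs \<Longrightarrow> x \<in> carrier M \<Longrightarrow> r \<odot>\<^bsub>M\<^esub> x \<in> N) \<Longrightarrow>
      seq_submodule R M rs \<subseteq> N"
proof -
  interpret M: Module.module R M by fact
  have sub: "{r \<odot>\<^bsub>M\<^esub> x | r x. r \<in> set rs \<and> x \<in> carrier M} \<subseteq> carrier M" using rs by auto
  note p = gen_submodule_props[OF M sub, folded seq_submodule_def]
  show "submodule (seq_submodule R M rs) R M" by (rule p(1))
  show "r \<in> set rs \<Longrightarrow> x \<in> carrier M \<Longrightarrow> r \<odot>\<^bsub>M\<^esub> x \<in> seq_submodule R M rs" using p(2) by blast
  show "submodule N R M \<Longrightarrow> (\<And>r x. r \<in> set rs \<Longrightarrow> x \<in> carrier M \<Longrightarrow> r \<odot>\<^bsub>M\<^esub> x \<in> N) \<Longrightarrow>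
      seq_submodule R M rs \<subseteq> N" by (rule p(3)) auto
qed

lemma seq_submodule_mono:
  assumes M: "Module.module R M" and "set rs \<subseteq> set rs'" "set rs' \<subseteq> carrier R"
  shows "seq_submodule R M rs \<subseteq> seq_submodule R M rs'"
  using assms seq_submodule_props(1,2)[OF M, of rs'] by (intro seq_submodule_props(3)[OF M]) auto

lemma seq_submodule_Nil:
  assumes M: "Module.module R M" shows "seq_submodule R M [] = {\<zero>\<^bsub>M\<^esub>}"
proof -
  interpret M: Module.module R M by fact
  have "submodule {\<zero>\<^bsub>M\<^esub>} R M" by (rule M.submoduleI) auto
  then have "seq_submodule R M [] \<subseteq> {\<zero>\<^bsub>M\<^esub>}" by (rule seq_submodule_props(3)[OF M, rotated]) auto
  moreover have "\<zero>\<^bsub>M\<^esub> \<in> seq_submodule R M []"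
    using submodule_abelian_subgroup[OF M seq_submodule_props(1)[OF M, of "[]"]]
    by (auto intro: additive_subgroup.zero_closed abelian_subgroup.axioms(1))
  ultimately show ?thesis by blast
qed

text \<open>This one-step description makes \<open>(r\<^sub>1, \<dots>, r\<^sub>k) M\<close> computable by induction along the
  sequence.\<close>
lemma seq_submodule_snoc:
  assumes M: "Module.module R M" and rs: "set rs \<subseteq> carrier R" "r \<in> carrier R"
  shows "seq_submodule R M (rs @ [r]) = {a \<oplus>\<^bsub>M\<^esub> r \<odot>\<^bsub>M\<^esub> x | a x. a \<in> seq_submodule R M rs \<and> x \<in> carrier M}"
    (is "?L = ?R")
proof
  interpret M: Module.module R M by fact
  note S = seq_submodule_props[OF M rs(1)]
  have L: "submodule ?L R M" by (rule seq_submodule_props(1)[OF M]) (use rs in auto)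
  have sub: "seq_submodule R M rs \<subseteq> carrier M" using M.submoduleE(1)[OF S(1)] .
  have z: "\<zero>\<^bsub>M\<^esub> \<in> seq_submodule R M rs"
    using submodule_abelian_subgroup[OF M S(1)]
    by (auto intro: additive_subgroup.zero_closed abelian_subgroup.axioms(1))
  show "?R \<subseteq> ?L"
  proof clarify
    fix a x assume a: "a \<in> seq_submodule R M rs" and x: "x \<in> carrier M"
    have "a \<in> ?L" using seq_submodule_mono[OF M, of rs "rs @ [r]"] rs a by auto
    moreover have "r \<odot>\<^bsub>M\<^esub> x \<in> ?L" using rs x by (intro seq_submodule_props(2)[OF M]) auto
    ultimately show "a \<oplus>\<^bsub>M\<^esub> r \<odot>\<^bsub>M\<^esub> x \<in> ?L" by (rule M.submoduleE(5)[OF L])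
  qed
  have "submodule ?R R M"
  proof (rule M.submoduleI)
    show "?R \<subseteq> carrier M" using sub rs by auto
    show "\<zero>\<^bsub>M\<^esub> \<in> ?R" using z rs by (auto intro!: exI[of _ "\<zero>\<^bsub>M\<^esub>"])
    show "\<ominus>\<^bsub>M\<^esub> a \<in> ?R" if a: "a \<in> ?R" for a
    proof -
      obtain b x where b: "a = b \<oplus>\<^bsub>M\<^esub> r \<odot>\<^bsub>M\<^esub> x" "b \<in> seq_submodule R M rs" "x \<in> carrier M" using a by blast
      then have "\<ominus>\<^bsub>M\<^esub> a = \<ominus>\<^bsub>M\<^esub> b \<oplus>\<^bsub>M\<^esub> r \<odot>\<^bsub>M\<^esub> (\<ominus>\<^bsub>M\<^esub> x)"
        using rs sub by (auto simp: M.smult_r_minus M.M.minus_add)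
      then show ?thesis using M.submoduleE(3)[OF S(1) b(2)] b(3) by blast
    qed
    show "a \<oplus>\<^bsub>M\<^esub> b \<in> ?R" if a: "a \<in> ?R" and b: "b \<in> ?R" for a b
    proof -
      obtain a' x where a': "a = a' \<oplus>\<^bsub>M\<^esub> r \<odot>\<^bsub>M\<^esub> x" "a' \<in> seq_submodule R M rs" "x \<in> carrier M" using a by blast
      obtain b' y where b': "b = b' \<oplus>\<^bsub>M\<^esub> r \<odot>\<^bsub>M\<^esub> y" "b' \<in> seq_submodule R M rs" "y \<in> carrier M" using b by blast
      have "a' \<in> carrier M" "b' \<in> carrier M" using a' b' sub by auto
      then have "a \<oplus>\<^bsub>M\<^esub> b = (a' \<oplus>\<^bsub>M\<^esub> b') \<oplus>\<^bsub>M\<^esub> r \<odot>\<^bsub>M\<^esub> (x \<oplus>\<^bsub>M\<^esub> y)"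
        using a' b' rs by (simp add: M.smult_r_distr M.M.a_ac)
      then show ?thesis using M.submoduleE(5)[OF S(1) a'(2) b'(2)] a' b' M.M.a_closed by blast
    qed
    show "s \<odot>\<^bsub>M\<^esub> a \<in> ?R" if s: "s \<in> carrier R" and a: "a \<in> ?R" for s a
    proof -
      obtain b x where b: "a = b \<oplus>\<^bsub>M\<^esub> r \<odot>\<^bsub>M\<^esub> x" "b \<in> seq_submodule R M rs" "x \<in> carrier M" using a by blast
      have bM: "b \<in> carrier M" using b sub by auto
      have "s \<odot>\<^bsub>M\<^esub> (r \<odot>\<^bsub>M\<^esub> x) = r \<odot>\<^bsub>M\<^esub> (s \<odot>\<^bsub>M\<^esub> x)"
        using s rs b by (simp add: M.R.m_comm flip: M.smult_assoc1)
      then have "s \<odot>\<^bsub>M\<^esub> a = s \<odot>\<^bsub>M\<^esub> b \<oplus>\<^bsub>M\<^esub> r \<odot>\<^bsub>M\<^esub> (s \<odot>\<^bsub>M\<^esub> x)"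
        using b bM s rs by (simp add: M.smult_r_distr)
      then show ?thesis using M.submoduleE(4)[OF S(1) s b(2)] b(3) s M.smult_closed by blast
    qed
  qed
  then show "?L \<subseteq> ?R"
  proof (rule seq_submodule_props(3)[OF M, rotated])
    fix s x assume s: "s \<in> set (rs @ [r])" and x: "x \<in> carrier M"
    show "s \<odot>\<^bsub>M\<^esub> x \<in> ?R"
    proof (cases "s = r")
      case True
      then have "s \<odot>\<^bsub>M\<^esub> x = \<zero>\<^bsub>M\<^esub> \<oplus>\<^bsub>M\<^esub> r \<odot>\<^bsub>M\<^esub> x" using x rs by simp
      then show ?thesis using z x by blast
    next
      case False
      then have "s \<odot>\<^bsub>M\<^esub> x \<in> seq_submodule R M rs" using s x S(2) by auto
      moreover have "s \<odot>\<^bsub>M\<^esub> x = s \<odot>\<^bsub>M\<^esub> x \<oplus>\<^bsub>M\<^esub> r \<odot>\<^bsub>M\<^esub> \<zero>\<^bsub>M\<^esub>" using s x rs by auto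
      ultimately show ?thesis by blast
    qed
  qed (use rs in auto)
qed

lemma prime_power_mem:
  assumes "primeideal P (poly_ring n)" and x: "x \<in> polys n" and "x ^ e \<in> P"
  shows "x \<in> (P :: 'k::comm_ring_1 mpoly set)"
proof -
  interpret P: primeideal P "poly_ring n" by fact
  show ?thesis using assms(3)
  proof (induction e)
    case 0
    then have "polys n = P" using P.one_imp_carrier by simp
    then show ?case using P.I_notcarr by simp
  next
    case (Suc e)
    then show ?case using P.I_prime[OF x poly_carrier_power[OF x, of e]] by auto
  qed
qed

lemma ring_poly_ring: "ring (poly_ring n :: 'k::comm_ring_1 mpoly ring)"
  using cring_poly_ring by (rule cring.axioms(1))

text \<open>The module \<open>M\<close> is identified with \<open>W / V\<close> by means of an explicit surjection. The factors
  of the filtration are quotients of submodules of a quotient, that is, modules of cosets of cosets;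
  a presentation moves every question about them back to polynomials.\<close>
locale presentation =
  fixes n :: nat and W V :: "'k::field mpoly set" and M :: "('k mpoly, 'b, 'd) module_scheme" (structure) and \<phi>
  assumes module: "Module.module (poly_ring n) M"
    and W: "ideal W (poly_ring n)" and V: "ideal V (poly_ring n)" and VW: "V \<subseteq> W"
    and image: "\<phi> ` W = carrier M"
    and add: "x \<in> W \<Longrightarrow> y \<in> W \<Longrightarrow> \<phi> (x + y) = \<phi> x \<oplus> \<phi> y"
    and smult: "r \<in> polys n \<Longrightarrow> x \<in> W \<Longrightarrow> \<phi> (r * x) = r \<odot> \<phi> x"
    and kernel: "x \<in> W \<Longrightarrow> \<phi> x = \<zero> \<longleftrightarrow> x \<in> V"
begin

sublocale M: Module.module "poly_ring n" M by (rule module)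

lemma \<phi>_closed: "x \<in> W \<Longrightarrow> \<phi> x \<in> carrier M"
  using image by blast

definition lift :: "'b set \<Rightarrow> 'k mpoly set"
  where "lift N = {x \<in> W. \<phi> x \<in> N}"

lemma ideal_lift:
  assumes N: "submodule N (poly_ring n) M" shows "ideal (lift N) (poly_ring n)"
proof (rule poly_idealI)
  have "\<phi> 0 = \<zero>" using kernel poly_idealD(2)[OF W] poly_idealD(2)[OF V] by blast
  moreover have "\<zero> \<in> N"
    using submodule_abelian_subgroup[OF module N]
    by (auto intro: additive_subgroup.zero_closed abelian_subgroup.axioms(1))
  ultimately show "0 \<in> lift N" using poly_idealD(2)[OF W] by (simp add: lift_def)
qed (use poly_idealD[OF W] add smult M.submoduleE[OF N] in \<open>auto simp: lift_def\<close>)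

lemma submodule_image:
  assumes J: "ideal J (poly_ring n)" "J \<subseteq> W" shows "submodule (\<phi> ` J) (poly_ring n) M"
proof (rule M.submoduleI)
  have 0: "\<phi> 0 = \<zero>" using kernel poly_idealD(2)[OF W] poly_idealD(2)[OF V] by blast
  show "\<phi> ` J \<subseteq> carrier M" using J \<phi>_closed by auto
  show "\<zero> \<in> \<phi> ` J" using 0 poly_idealD(2)[OF J(1)] by (metis imageI)
  show "\<ominus> a \<in> \<phi> ` J" if a: "a \<in> \<phi> ` J" for a
  proof -
    obtain x where x: "x \<in> J" "a = \<phi> x" using a by blast
    have mx: "- x \<in> J" using poly_idealD(6)[OF J(1) x(1)] .
    have "\<phi> (- x) \<oplus> \<phi> x = \<phi> (- x + x)" using mx x J(2) by (intro add[symmetric]) auto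
    then have "\<phi> (- x) \<oplus> \<phi> x = \<zero>" using 0 by simp
    then have "\<ominus> a = \<phi> (- x)" using x mx J(2) \<phi>_closed by (intro M.M.minus_equality) auto
    then show ?thesis using mx by blast
  qed
  show "a \<oplus> b \<in> \<phi> ` J" if a: "a \<in> \<phi> ` J" "b \<in> \<phi> ` J" for a b
  proof -
    obtain x y where xy: "x \<in> J" "y \<in> J" "a = \<phi> x" "b = \<phi> y" using a by blast
    then have "\<phi> (x + y) = a \<oplus> b" using J(2) by (simp add: add subset_iff)
    then show ?thesis using poly_idealD(3)[OF J(1) xy(1,2)] by (metis imageI)
  qed
  show "r \<odot> a \<in> \<phi> ` J" if r: "r \<in> polys n" and a: "a \<in> \<phi> ` J" for r a
  proof -
    obtain x where x: "x \<in> J" "a = \<phi> x" using a by blast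
    then have "\<phi> (r * x) = r \<odot> a" using J(2) r by (simp add: smult subset_iff)
    then show ?thesis using poly_idealD(4)[OF J(1) r x(1)] by (metis imageI)
  qed
qed

lemma lift_zero: "lift {\<zero>} = V"
  using kernel VW by (auto simp: lift_def)

lemma image_lift: "N \<subseteq> carrier M \<Longrightarrow> \<phi> ` lift N = N"
  using image by (auto simp: lift_def)

lemma lift_image:
  assumes J: "ideal J (poly_ring n)" "V \<subseteq> J" "J \<subseteq> W" shows "lift (\<phi> ` J) = J"
proof
  show "lift (\<phi> ` J) \<subseteq> J"
  proof
    fix x assume "x \<in> lift (\<phi> ` J)"
    then obtain y where y: "x \<in> W" "y \<in> J" "\<phi> x = \<phi> y" by (auto simp: lift_def)
    have my: "- y \<in> W" using poly_idealD(6)[OF J(1) y(2)] J(3) by blast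
    have yW: "y \<in> W" using y(2) J(3) by blast
    have "\<phi> (x + - y) = \<phi> x \<oplus> \<phi> (- y)" by (rule add[OF y(1) my])
    also have "\<dots> = \<phi> (y + - y)" unfolding y(3) by (rule add[OF yW my, symmetric])
    also have "\<dots> = \<zero>" using kernel poly_idealD(2)[OF W] poly_idealD(2)[OF V] by simp
    finally have "x - y \<in> V" using kernel[OF poly_idealD(5)[OF W y(1) yW]] by simp
    then have "(x - y) + y \<in> J" using J(2) y by (intro poly_idealD(3)[OF J(1)]) auto
    then show "x \<in> J" by simp
  qed
  show "J \<subseteq> lift (\<phi> ` J)" using J(3) by (auto simp: lift_def)
qed

lemma presentation_submodule:
  assumes N: "submodule N (poly_ring n) M" shows "presentation n (lift N) V (M\<lparr>carrier := N\<rparr>) \<phi>"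
proof -
  have "\<zero> \<in> N"
    using submodule_abelian_subgroup[OF module N]
    by (auto intro: additive_subgroup.zero_closed abelian_subgroup.axioms(1))
  moreover have "\<phi> x = \<zero>" if "x \<in> V" for x using kernel that VW by blast
  ultimately have VN: "V \<subseteq> lift N" using VW by (auto simp: lift_def)
  have im: "\<phi> ` lift N = N" using image_lift M.submoduleE(1)[OF N] .
  show ?thesis
  proof (rule presentation.intro)
    show "\<phi> ` lift N = carrier (M\<lparr>carrier := N\<rparr>)" using im by simp
    fix x assume x: "x \<in> lift N"
    then have xW: "x \<in> W" by (simp add: lift_def)
    show "\<phi> x = \<zero>\<^bsub>M\<lparr>carrier := N\<rparr>\<^esub> \<longleftrightarrow> x \<in> V" using kernel[OF xW] by simp
    show "\<phi> (r * x) = r \<odot>\<^bsub>M\<lparr>carrier := N\<rparr>\<^esub> \<phi> x" if "r \<in> polys n" for r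
      using smult[OF that xW] by simp
    show "\<phi> (x + y) = \<phi> x \<oplus>\<^bsub>M\<lparr>carrier := N\<rparr>\<^esub> \<phi> y" if "y \<in> lift N" for y
      using add[OF xW, of y] that by (simp add: lift_def)
  qed (fact submodule.submodule_is_module[OF N module] ideal_lift[OF N] V VN)+
qed

lemma presentation_quotient:
  assumes N: "submodule N (poly_ring n) M"
  shows "presentation n W (lift N) (quot_module M N) (\<lambda>x. N +> \<phi> x)"
proof (rule presentation.intro)
  show "Module.module (poly_ring n) (quot_module M N)" by (rule quot_module_module[OF module N])
  show "(\<lambda>x. N +> \<phi> x) ` W = carrier (quot_module M N)"
    unfolding quot_module_carrier[OF module N] image[symmetric] image_image ..
  show "ideal W (poly_ring n)" "ideal (lift N) (poly_ring n)" "lift N \<subseteq> W"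
    using W ideal_lift[OF N] by (auto simp: lift_def)
  fix x assume x: "x \<in> W"
  show "N +> \<phi> x = \<zero>\<^bsub>quot_module M N\<^esub> \<longleftrightarrow> x \<in> lift N"
    using x quot_module_eq_zero[OF module N \<phi>_closed[OF x]] by (simp add: lift_def)
  show "N +> \<phi> (r * x) = r \<odot>\<^bsub>quot_module M N\<^esub> (N +> \<phi> x)" if "r \<in> polys n" for r
    unfolding smult[OF that x] by (rule quot_module_smult[OF module N that \<phi>_closed[OF x], symmetric])
  show "N +> \<phi> (x + y) = (N +> \<phi> x) \<oplus>\<^bsub>quot_module M N\<^esub> (N +> \<phi> y)" if "y \<in> W" for y
    unfolding add[OF x that] by (rule quot_module_add[OF module N \<phi>_closed[OF x] \<phi>_closed[OF that], symmetric])
qed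

lemma annihilator_eq: "annihilator (poly_ring n) M = {r \<in> polys n. \<forall>x\<in>W. r * x \<in> V}"
proof -
  have "(\<forall>m\<in>carrier M. r \<odot> m = \<zero>) \<longleftrightarrow> (\<forall>x\<in>W. r * x \<in> V)"
    if r: "r \<in> polys n" for r
  proof -
    have "r \<odot> \<phi> x = \<zero> \<longleftrightarrow> r * x \<in> V" if "x \<in> W" for x
      using smult[OF r that] kernel[OF poly_idealD(4)[OF W r that]] by simp
    then show ?thesis unfolding image[symmetric] by simp
  qed
  then show ?thesis unfolding annihilator_def by blast
qed

lemma nonzerodivisor_quot_iff:
  assumes N: "submodule N (poly_ring n) M" and r: "r \<in> polys n"
  shows "nonzerodivisor_on (quot_module M N) r \<longleftrightarrow> (\<forall>x\<in>W. r * x \<in> lift N \<longrightarrow> x \<in> lift N)"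
proof -
  interpret Q: presentation n W "lift N" "quot_module M N" "\<lambda>x. N +> \<phi> x"
    by (rule presentation_quotient[OF N])
  have "r \<odot>\<^bsub>quot_module M N\<^esub> (N +> \<phi> x) = \<zero>\<^bsub>quot_module M N\<^esub> \<longleftrightarrow> r * x \<in> lift N"
    if "x \<in> W" for x
    using Q.smult[OF r that] Q.kernel[OF poly_idealD(4)[OF W r that]] by simp
  then show ?thesis unfolding nonzerodivisor_on_def Q.image[symmetric] by (simp add: Q.kernel)
qed

lemma lift_seq_snoc:
  assumes rs: "set rs \<subseteq> polys n" "r \<in> polys n"
  shows "lift (seq_submodule (poly_ring n) M (rs @ [r])) =
    {a + r * w | a w. a \<in> lift (seq_submodule (poly_ring n) M rs) \<and> w \<in> W}" (is "?L = ?R")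
proof -
  let ?s = "seq_submodule (poly_ring n) M"
  have N: "submodule (?s rs) (poly_ring n) M" by (rule seq_submodule_props(1)[OF module rs(1)])
  have N': "submodule (?s (rs @ [r])) (poly_ring n) M" by (rule seq_submodule_props(1)[OF module]) (use rs in auto)
  have ideal_R: "?R \<subseteq> W"
    using poly_idealD(3,4)[OF W] rs(2) by (auto simp: lift_def)
  show ?thesis
  proof
    show "?R \<subseteq> ?L"
    proof
      fix y assume "y \<in> ?R"
      then obtain a w where a: "y = a + r * w" "a \<in> lift (?s rs)" "w \<in> W" by blast
      then have "\<phi> y = \<phi> a \<oplus> r \<odot> \<phi> w"
        using rs poly_idealD(4)[OF W] by (auto simp: lift_def add smult)
      then show "y \<in> ?L" using a \<phi>_closed \<open>y \<in> ?R\<close> ideal_R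
        by (auto simp: lift_def seq_submodule_snoc[OF module rs])
    qed
    show "?L \<subseteq> ?R"
    proof
      fix y assume y: "y \<in> ?L"
      then have yW: "y \<in> W" by (simp add: lift_def)
      obtain a x where a: "\<phi> y = a \<oplus> r \<odot> x" "a \<in> ?s rs" "x \<in> carrier M"
        using y by (auto simp: lift_def seq_submodule_snoc[OF module rs])
      obtain w where w: "w \<in> W" "x = \<phi> w" using a(3) image by blast
      have rw: "r * w \<in> W" using poly_idealD(4)[OF W rs(2) w(1)] .
      have d: "y - r * w \<in> W" using poly_idealD(5)[OF W yW rw] .
      have aM: "a \<in> carrier M" using M.submoduleE(1)[OF N] a(2) by blast
      have "\<phi> (y - r * w) \<oplus> \<phi> (r * w) = a \<oplus> \<phi> (r * w)"
        using add[OF d rw] a(1) w smult[OF rs(2) w(1)] by simp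
      then have "\<phi> (y - r * w) = a" using aM \<phi>_closed[OF d] \<phi>_closed[OF rw] by simp
      then have "y - r * w \<in> lift (?s rs)" using a(2) d by (simp add: lift_def)
      moreover have "y = (y - r * w) + r * w" by simp
      ultimately show "y \<in> ?R" using w(1) by blast
    qed
  qed
qed

text \<open>A longer regular sequence would satisfy the hypotheses of \<open>no_long_chain\<close>, and the submodule
  it generates would be all of \<open>M\<close>.\<close>
lemma regular_sequence_length:
  assumes "k \<le> n" and nil: "\<And>j y. j \<in> {1..k} \<Longrightarrow> y \<in> W \<Longrightarrow> Xvar j ^ t * y \<in> V"
    and reg: "regular_sequence (poly_ring n) M rs"
  shows "length rs \<le> n - k"
proof (rule ccontr)
  assume "\<not> length rs \<le> n - k"
  then have len: "n - k < length rs" by simp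
  let ?s = "seq_submodule (poly_ring n) M"
  have rs: "set rs \<subseteq> polys n" using reg by (simp add: regular_sequence_def)
  have rst: "set (take i rs) \<subseteq> polys n" for i using rs set_take_subset by fast
  define x where "x i = rs ! i" for i
  have sm: "submodule (?s (take i rs)) (poly_ring n) M" for i by (rule seq_submodule_props(1)[OF module rst])
  have snoc: "take (Suc i) rs = take i rs @ [x i]" if "i \<le> n - k" for i
    using that len by (simp add: x_def take_Suc_conv_app_nth)
  have xc: "x i \<in> polys n" if "i \<le> n - k" for i
    using that len rs nth_mem[of i rs] by (auto simp: x_def)
  have "W \<subseteq> lift (?s (take (Suc (n - k)) rs))"
  proof (rule no_long_chain[OF assms(1), where x = x and t = t and V = "\<lambda>i. lift (?s (take i rs))"])
    fix i y assume i: "i \<le> n - k"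
    have z: "0 \<in> W" "0 \<in> lift (?s (take i rs))" using poly_idealD(2) W ideal_lift[OF sm] by blast+
    show "lift (?s (take i rs)) \<subseteq> lift (?s (take (Suc i) rs))"
      using seq_submodule_mono[OF module _ rst, of "take i rs" "Suc i"] snoc[OF i] by (auto simp: lift_def)
    show "x i \<in> polys n" by (rule xc[OF i])
    assume y: "y \<in> W"
    show "x i * y \<in> lift (?s (take (Suc i) rs))"
    proof -
      have "x i * y = 0 + x i * y" by simp
      then show ?thesis unfolding snoc[OF i] lift_seq_snoc[OF rst xc[OF i]] using y z by blast
    qed
    have "nonzerodivisor_on (quot_module M (?s (take i rs))) (x i)"
      using reg i len by (simp add: regular_sequence_def x_def)
    then show "y \<in> lift (?s (take i rs))" if "x i * y \<in> lift (?s (take i rs))"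
      using that y nonzerodivisor_quot_iff[OF sm xc[OF i]] by blast
  qed (use nil W ideal_lift[OF sm] in \<open>auto simp: seq_submodule_Nil[OF module] lift_zero\<close>)
  then have "carrier M \<subseteq> ?s (take (Suc (n - k)) rs)" unfolding image[symmetric] lift_def by blast
  also have "\<dots> \<subseteq> ?s rs" using set_take_subset[of _ rs] by (intro seq_submodule_mono[OF module _ rs]) auto
  finally have "?s rs = carrier M"
    by (rule antisym[OF M.submoduleE(1)[OF seq_submodule_props(1)[OF module rs]]])
  moreover have "?s rs \<noteq> carrier M" using reg unfolding regular_sequence_def by (elim conjE)
  ultimately show False by (rule notE[rotated])
qed

text \<open>The family \<open>D\<close> is what the submodules \<open>(X\<^sub>k\<^sub>+\<^sub>1, \<dots>, X\<^sub>j) M\<close> pull back to.\<close>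
lemma variables_regular:
  assumes "k \<le> n" and base: "D k = V"
    and step: "\<And>j. k \<le> j \<Longrightarrow> j < n \<Longrightarrow> D (Suc j) = {a + Xvar (Suc j) * w | a w. a \<in> D j \<and> w \<in> W}"
    and reg: "\<And>j p. k \<le> j \<Longrightarrow> j < n \<Longrightarrow> p \<in> W \<Longrightarrow> Xvar (Suc j) * p \<in> D j \<Longrightarrow> p \<in> D j"
    and proper: "D n \<noteq> W"
  shows "regular_sequence (poly_ring n) M (map Xvar [Suc k..<Suc n])"
proof -
  let ?s = "seq_submodule (poly_ring n) M" and ?rs = "map Xvar [Suc k..<Suc n] :: 'k mpoly list"
  have rs: "set ?rs \<subseteq> polys n"
  proof
    fix p assume "p \<in> set ?rs"
    then obtain i where "p = Xvar i" "i \<in> {1..n}" by (auto simp del: upt_Suc)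
    then show "p \<in> polys n" using Xvar_carrier by simp
  qed
  have rst: "set (take i ?rs) \<subseteq> polys n" for i using rs set_take_subset by fast
  have len: "length ?rs = n - k" by (simp del: upt_Suc)
  have nth: "?rs ! i = Xvar (Suc (k + i))" if "i < n - k" for i
    using that len by (simp del: upt_Suc)
  have Xc: "Xvar (Suc (k + i)) \<in> polys n" if "i < n - k" for i
    using that by (intro Xvar_carrier) auto
  have lift: "lift (?s (take i ?rs)) = D (k + i)" if "i \<le> n - k" for i
    using that
  proof (induction i)
    case 0
    then show ?case by (simp add: seq_submodule_Nil[OF module] lift_zero base)
  next
    case (Suc i)
    then have "take (Suc i) ?rs = take i ?rs @ [Xvar (Suc (k + i))]"
      using nth[of i] len by (simp add: take_Suc_conv_app_nth del: upt_Suc)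
    then show ?case
      using Suc step[of "k + i"] lift_seq_snoc[OF rst Xc, of i i] by simp
  qed
  have sm: "submodule (?s (take i ?rs)) (poly_ring n) M" for i by (rule seq_submodule_props(1)[OF module rst])
  have "nonzerodivisor_on (quot_module M (?s (take i ?rs))) (?rs ! i)" if "i < length ?rs" for i
  proof -
    have i: "i < n - k" using that len by simp
    show ?thesis
      unfolding nth[OF i] nonzerodivisor_quot_iff[OF sm Xc[OF i]]
      using reg[of "k + i"] lift[of i] i by auto
  qed
  moreover have "?s ?rs \<noteq> carrier M"
  proof
    assume "?s ?rs = carrier M"
    then have "lift (?s ?rs) = W" using \<phi>_closed by (auto simp: lift_def)
    then show False using lift[of "n - k"] proper assms(1) len by (simp del: upt_Suc)
  qed
  ultimately show ?thesis using rs by (simp add: regular_sequence_def del: upt_Suc)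
qed

lemma Xvar_irrelevant:
  assumes "i \<in> {1..n}" shows "(Xvar i :: 'k mpoly) \<in> irrelevant_ideal (poly_ring n) (poly_grading n)"
proof -
  have "(\<Sum>l = 1..n. lookup (single i (1::nat)) l) = 1"
    using assms by (simp add: lookup_single when_def sum.delta)
  then have "(Xvar i :: 'k mpoly) \<in> poly_grading n 1"
    using Xvar_carrier[OF assms] by (simp add: poly_grading_def Xvar_def del: of_nat_sum)
  then have "(Xvar i :: 'k mpoly) \<in> (\<Union>i\<in>{0<..}. poly_grading n i)"
    by (intro UN_I[of 1]) auto
  moreover have "(\<Union>i\<in>{0<..}. poly_grading n i :: 'k mpoly set) \<subseteq> polys n"
    by (auto simp: poly_grading_def)
  ultimately show ?thesis unfolding irrelevant_ideal_def using ring.genideal_self[OF ring_poly_ring] by blast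
qed

text \<open>Starting from any element outside \<open>V\<close>, multiply by the largest power of each variable in
  turn that does not lead into \<open>V\<close>.\<close>
lemma socle_element:
  assumes "V \<noteq> W" and nil: "\<And>j y. j \<in> {1..k} \<Longrightarrow> y \<in> W \<Longrightarrow> Xvar j ^ t * y \<in> V" and "k \<le> n"
  shows "\<exists>p\<in>W - V. \<forall>i\<in>{1..k}. Xvar i * p \<in> V"
proof -
  have "\<exists>p\<in>W - V. \<forall>i\<in>{1..j}. Xvar i * p \<in> V" if "j \<le> k" for j
    using that
  proof (induction j)
    case 0
    then show ?case using assms(1) VW by auto
  next
    case (Suc j)
    then obtain p where p: "p \<in> W - V" "\<forall>i\<in>{1..j}. Xvar i * p \<in> V" by auto
    let ?X = "Xvar (Suc j) :: 'k mpoly"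
    have X: "?X \<in> polys n" using Suc.prems assms(3) by (intro Xvar_carrier) auto
    define e where "e = (LEAST e. ?X ^ e * p \<in> V)"
    have e: "?X ^ e * p \<in> V" unfolding e_def
      by (rule LeastI[of _ t]) (use nil[of "Suc j" p] p Suc.prems in auto)
    then obtain e' where e': "e = Suc e'" using p by (cases e) auto
    let ?p = "?X ^ e' * p"
    have "?p \<in> W" using p poly_idealD(4)[OF W, of "?X ^ e'"] X by auto
    moreover have "?p \<notin> V" using not_less_Least[of e' "\<lambda>e. ?X ^ e * p \<in> V"] e' by (auto simp: e_def[symmetric])
    moreover have "Xvar i * ?p \<in> V" if "i \<in> {1..Suc j}" for i
    proof (cases "i = Suc j")
      case True
      then show ?thesis using e e' by (simp add: mult.assoc)
    next
      case False
      then have "Xvar i * p \<in> V" using that p(2) by auto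
      then have "?X ^ e' * (Xvar i * p) \<in> V" using poly_idealD(4)[OF V, of "?X ^ e'"] X by auto
      then show ?thesis by (simp add: mult.left_commute)
    qed
    ultimately show ?case by blast
  qed
  then show ?thesis by blast
qed

text \<open>Let \<open>f\<close> annihilate the module and \<open>p\<close> be killed by \<open>X\<^sub>1, \<dots>, X\<^sub>k\<close>. Then the part of \<open>f\<close> in the
  other variables kills \<open>p\<close> as well, so it is zero by torsion-freeness.\<close>
lemma annihilator_subset_var_ideal:
  assumes "V \<noteq> W" "k \<le> n" and nil: "\<And>j y. j \<in> {1..k} \<Longrightarrow> y \<in> W \<Longrightarrow> Xvar j ^ t * y \<in> V"
    and tf: "\<And>g p. g \<in> polys n \<Longrightarrow> g \<noteq> 0 \<Longrightarrow>
      (\<And>w. w \<in> keys g \<Longrightarrow> keys w \<subseteq> {Suc k..n}) \<Longrightarrow>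
      p \<in> W \<Longrightarrow> g * p \<in> V \<Longrightarrow> p \<in> V"
  shows "annihilator (poly_ring n) M \<subseteq> var_ideal n k"
proof
  fix f assume f: "f \<in> annihilator (poly_ring n) M"
  then have fc: "f \<in> polys n" by (simp add: annihilator_eq)
  obtain p where p: "p \<in> W" "p \<notin> V" "\<forall>i\<in>{1..k}. Xvar i * p \<in> V"
    using socle_element[OF assms(1) nil assms(2)] by blast
  define U where "U = {u :: expo. \<exists>l\<in>{1..k}. 0 < lookup u l}"
  have dec: "f = restr U f + restr (- U) f"
    by (rule poly_mapping_eqI) (simp add: lookup_add lookup_restr when_def)
  have in_ideal: "restr U f \<in> var_ideal n k"
    using restr_carrier[OF fc] unfolding var_ideal_def by (auto simp: keys_restr U_def)
  have "restr U f * p \<in> V"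
    by (rule power_multiples_mem[where J = "{1..k}" and t = 1])
       (use V restr_carrier[OF fc] p in \<open>auto simp: keys_restr U_def Suc_le_eq\<close>)
  moreover have "f * p \<in> V" using f p by (simp add: annihilator_eq)
  moreover have "restr (- U) f * p = f * p - restr U f * p" by (subst (2) dec) (simp add: distrib_right)
  ultimately have gp: "restr (- U) f * p \<in> V" using poly_idealD(5)[OF V] by simp
  have "restr (- U) f = 0"
  proof (rule ccontr)
    assume "restr (- U) f \<noteq> 0"
    moreover have "keys w \<subseteq> {Suc k..n}" if w: "w \<in> keys (restr (- U) f)" for w
    proof
      fix i assume i: "i \<in> keys w"
      have "w \<in> expos n" "w \<notin> U" using w fc by (auto simp: keys_restr carrier_poly_ring)
      then have "i \<in> {1..n}" "\<not> (i \<in> {1..k} \<and> 0 < lookup w i)"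
        using i unfolding U_def expos_def by auto
      then show "i \<in> {Suc k..n}" using i by (auto simp: in_keys_iff)
    qed
    ultimately show False using tf[OF restr_carrier[OF fc] _ _ p(1) gp] p(2) by blast
  qed
  then show "f \<in> var_ideal n k" using dec in_ideal by simp
qed

text \<open>Primes containing the annihilator contain \<open>X\<^sub>1, \<dots>, X\<^sub>k\<close>, which bounds the dimension by
  \<open>n - k\<close>; the bound is attained by \<open>(X\<^sub>1, \<dots>, X\<^sub>k) \<subset> \<dots> \<subset> (X\<^sub>1, \<dots>, X\<^sub>n)\<close>, all of which contain the
  annihilator.\<close>
lemma module_dim_eq:
  assumes "V \<noteq> W" "k \<le> n" and nil: "\<And>j y. j \<in> {1..k} \<Longrightarrow> y \<in> W \<Longrightarrow> Xvar j ^ t * y \<in> V"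
    and tf: "\<And>g p. g \<in> polys n \<Longrightarrow> g \<noteq> 0 \<Longrightarrow>
      (\<And>w. w \<in> keys g \<Longrightarrow> keys w \<subseteq> {Suc k..n}) \<Longrightarrow>
      p \<in> W \<Longrightarrow> g * p \<in> V \<Longrightarrow> p \<in> V"
  shows "module_dim (poly_ring n) M = enat (n - k)"
proof -
  let ?S = "poly_ring n :: 'k mpoly ring"
  define J where "J = annihilator ?S M"
  have J_var: "J \<subseteq> var_ideal n k" unfolding J_def by (rule annihilator_subset_var_ideal[OF assms(1,2) nil tf])
  have J_X: "Xvar j ^ t \<in> J" if "j \<in> {1..k}" for j
    using that nil Xvar_carrier[of j n] assms(2) by (auto simp: J_def annihilator_eq)
  have "ideal J ?S"
  proof (rule poly_idealI)
    show "r * x \<in> J" if "r \<in> carrier ?S" "x \<in> J" for r x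
      using that poly_idealD(4)[OF V that(1)] by (auto simp: J_def annihilator_eq mult.assoc)
  qed (use poly_idealD(2,3)[OF V] in \<open>auto simp: J_def annihilator_eq distrib_right\<close>)
  then interpret J: ideal J ?S .
  let ?h = "(+>\<^bsub>?S\<^esub>) J"
  interpret h: ring_hom_ring ?S "?S Quot J" ?h by (rule J.rcos_ring_hom_ring)
  have Qc: "cring (?S Quot J)" by (rule J.quotient_is_cring[OF cring_poly_ring])
  have carrQ: "carrier (?S Quot J) = ?h ` carrier ?S" by (auto simp: FactRing_def A_RCOSETS_def')
  have upper: "m \<le> n - k"
    if P: "\<forall>i\<le>m. primeideal (P i) (?S Quot J)" "\<forall>i<m. P i \<subset> P (Suc i)" for m P
  proof (rule prime_chain_length[OF assms(2), where P = "\<lambda>i. {r \<in> carrier ?S. ?h r \<in> P i}"])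
    show prime: "primeideal {r \<in> carrier ?S. ?h r \<in> P i} ?S" if "i \<le> m" for i
      using h.primeideal_vimage[OF cring_poly_ring] P(1) that by blast
    show "{r \<in> carrier ?S. ?h r \<in> P i} \<subset> {r \<in> carrier ?S. ?h r \<in> P (Suc i)}" if i: "i < m" for i
    proof
      show "{r \<in> carrier ?S. ?h r \<in> P i} \<subseteq> {r \<in> carrier ?S. ?h r \<in> P (Suc i)}" using P(2) i by auto
      obtain y where y: "y \<in> P (Suc i)" "y \<notin> P i" using P(2) i by blast
      have "ideal (P (Suc i)) (?S Quot J)" using P(1) i by (simp add: primeideal_def)
      then have "y \<in> carrier (?S Quot J)" using y(1) by (rule ideal.Icarr)
      then have "y \<in> ?h ` carrier ?S" by (simp only: carrQ)
      then show "{r \<in> carrier ?S. ?h r \<in> P i} \<noteq> {r \<in> carrier ?S. ?h r \<in> P (Suc i)}" using y by blast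
    qed
    show "Xvar j \<in> {r \<in> carrier ?S. ?h r \<in> P 0}" if j: "j \<in> {1..k}" for j
    proof -
      let ?P = "{r \<in> carrier ?S. ?h r \<in> P 0}"
      have X: "Xvar j \<in> carrier ?S" using j assms(2) by (intro Xvar_carrier) auto
      have "?h (Xvar j ^ t) = \<zero>\<^bsub>?S Quot J\<^esub>"
        using J.a_rcos_const[OF J_X[OF j]] by (simp add: FactRing_def)
      moreover have "\<zero>\<^bsub>?S Quot J\<^esub> \<in> P 0"
        using P(1) by (auto simp: primeideal_def ideal_def intro: additive_subgroup.zero_closed)
      ultimately have "?h (Xvar j ^ t) \<in> P 0" by (simp only:)
      then have "Xvar j ^ t \<in> ?P" using poly_carrier_power[OF X, of t] by (intro CollectI conjI)
      then show ?thesis by (rule prime_power_mem[OF prime[OF le0] X])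
    qed
  qed
  have vi: "ideal (var_ideal n j) ?S" for j by (rule ideal_var_ideal)
  have chain: "var_ideal n k \<subseteq> (var_ideal n (k + i) :: 'k mpoly set)" if "i \<le> n - k" for i
    using that
  proof (induction i)
    case (Suc i)
    then have "k + i < n" "i \<le> n - k" by simp_all
    note Suc.IH[OF this(2)]
    also have "var_ideal n (k + i) \<subseteq> (var_ideal n (Suc (k + i)) :: 'k mpoly set)"
      by (rule psubset_imp_subset[OF var_ideal_strict[OF \<open>k + i < n\<close>]])
    finally show ?case by (simp only: add_Suc_right)
  qed simp
  have mem: "r \<in> var_ideal n (k + i)"
    if rc: "r \<in> carrier ?S" and i: "i \<le> n - k" and hr: "?h r \<in> ?h ` var_ideal n (k + i)" for r i
  proof -
    obtain s where s: "s \<in> var_ideal n (k + i)" "?h r = ?h s" using hr by blast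
    have "r \<in> J +>\<^bsub>?S\<^esub> s" using J.a_rcos_self[OF rc] unfolding s(2) .
    then obtain h where h: "h \<in> J" "r = h + s" by (auto simp: a_r_coset_def')
    then have "h \<in> var_ideal n (k + i)" using J_var chain[OF i] by blast
    then show ?thesis unfolding h(2) by (rule poly_idealD(3)[OF vi _ s(1)])
  qed
  have prime: "primeideal (?h ` var_ideal n (k + i)) (?S Quot J)" if i: "i \<le> n - k" for i
  proof (rule primeidealI[OF _ Qc])
    interpret P: primeideal "var_ideal n (k + i) :: 'k mpoly set" ?S by (rule primeideal_var_ideal)
    show "ideal (?h ` var_ideal n (k + i)) (?S Quot J)"
      by (rule ring.ring_ideal_imp_quot_ideal[OF ring_poly_ring J.is_ideal vi])
    show "carrier (?S Quot J) \<noteq> ?h ` var_ideal n (k + i)"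
    proof
      assume eq: "carrier (?S Quot J) = ?h ` var_ideal n (k + i)"
      have "carrier ?S \<subseteq> var_ideal n (k + i)"
      proof
        fix r assume rc: "r \<in> carrier ?S"
        have "?h r \<in> carrier (?S Quot J)" unfolding carrQ by (rule imageI[OF rc])
        then show "r \<in> var_ideal n (k + i)" unfolding eq by (rule mem[OF rc i])
      qed
      then have "carrier ?S = var_ideal n (k + i)" using poly_idealD(1)[OF vi] by (rule antisym)
      then show False using P.I_notcarr by (rule notE[rotated])
    qed
    fix a b assume "a \<in> carrier (?S Quot J)" "b \<in> carrier (?S Quot J)"
      and ab: "a \<otimes>\<^bsub>?S Quot J\<^esub> b \<in> ?h ` var_ideal n (k + i)"
    then obtain r s where r: "r \<in> carrier ?S" "s \<in> carrier ?S" "a = ?h r" "b = ?h s"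
      unfolding carrQ by (elim imageE)
    have rs: "r \<otimes>\<^bsub>?S\<^esub> s \<in> carrier ?S" using r by simp
    have "?h (r \<otimes>\<^bsub>?S\<^esub> s) \<in> ?h ` var_ideal n (k + i)"
      using ab unfolding r(3,4) h.hom_mult[OF r(1,2)] .
    then have "r \<otimes>\<^bsub>?S\<^esub> s \<in> var_ideal n (k + i)" by (rule mem[OF rs i])
    then have "r \<in> var_ideal n (k + i) \<or> s \<in> var_ideal n (k + i)" by (rule P.I_prime[OF r(1,2)])
    then show "a \<in> ?h ` var_ideal n (k + i) \<or> b \<in> ?h ` var_ideal n (k + i)"
      unfolding r(3,4) by (elim disjE) (simp_all only: imageI simp_thms)
  qed
  have strict: "?h ` var_ideal n (k + i) \<subset> ?h ` var_ideal n (k + Suc i)" if i: "i < n - k" for i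
  proof
    have s: "var_ideal n (k + i) \<subset> (var_ideal n (k + Suc i) :: 'k mpoly set)" 
      unfolding add_Suc_right by (rule var_ideal_strict) (use i in simp)
    then show "?h ` var_ideal n (k + i) \<subseteq> ?h ` var_ideal n (k + Suc i)"
      by (intro image_mono psubset_imp_subset)
    obtain y :: "'k mpoly" where y: "y \<in> var_ideal n (k + Suc i)" "y \<notin> var_ideal n (k + i)" using s by blast
    then have "y \<in> carrier ?S" using poly_idealD(1)[OF vi] by blast
    then have "?h y \<notin> ?h ` var_ideal n (k + i)" using mem[of y i] y(2) i by (meson less_imp_le)
    then show "?h ` var_ideal n (k + i) \<noteq> ?h ` var_ideal n (k + Suc i)" using imageI[OF y(1), of ?h] by metis
  qed
  let ?E = "{enat m | m. \<exists>P. (\<forall>i\<le>m. primeideal (P i) (?S Quot J)) \<and> (\<forall>i<m. P i \<subset> P (Suc i))}"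
  have "\<exists>P. (\<forall>i\<le>n - k. primeideal (P i) (?S Quot J)) \<and> (\<forall>i<n - k. P i \<subset> P (Suc i))"
    by (intro exI[of _ "\<lambda>i. ?h ` var_ideal n (k + i)"] conjI allI impI prime strict)
  then have "enat (n - k) \<in> ?E" by blast
  then have "enat (n - k) \<le> Sup ?E" by (rule Sup_upper)
  moreover have "Sup ?E \<le> enat (n - k)"
  proof (rule Sup_least)
    fix e assume "e \<in> ?E"
    then obtain m P where "e = enat m" "\<forall>i\<le>m. primeideal (P i) (?S Quot J)" "\<forall>i<m. P i \<subset> P (Suc i)"
      by (elim CollectE exE conjE)
    then show "e \<le> enat (n - k)" using upper[of m P] by (simp only: enat_ord_simps)
  qed
  ultimately have "Sup ?E = enat (n - k)" by (rule antisym[rotated])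
  then show ?thesis by (simp add: module_dim_def krull_dim_def J_def)
qed

theorem cohen_macaulay_criterion:
  assumes "V \<noteq> W" "k \<le> n" and nil: "\<And>j y. j \<in> {1..k} \<Longrightarrow> y \<in> W \<Longrightarrow> Xvar j ^ t * y \<in> V"
    and tf: "\<And>g p. g \<in> polys n \<Longrightarrow> g \<noteq> 0 \<Longrightarrow>
      (\<And>w. w \<in> keys g \<Longrightarrow> keys w \<subseteq> {Suc k..n}) \<Longrightarrow>
      p \<in> W \<Longrightarrow> g * p \<in> V \<Longrightarrow> p \<in> V"
    and base: "D k = V"
    and step: "\<And>j. k \<le> j \<Longrightarrow> j < n \<Longrightarrow> D (Suc j) = {a + Xvar (Suc j) * w | a w. a \<in> D j \<and> w \<in> W}"
    and reg: "\<And>j p. k \<le> j \<Longrightarrow> j < n \<Longrightarrow> p \<in> W \<Longrightarrow> Xvar (Suc j) * p \<in> D j \<Longrightarrow> p \<in> D j"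
    and proper: "D n \<noteq> W"
  shows "cohen_macaulay (poly_ring n) (poly_grading n) M" "module_dim (poly_ring n) M = enat (n - k)"
proof -
  show dim: "module_dim (poly_ring n) M = enat (n - k)"
    by (rule module_dim_eq[OF assms(1,2) nil tf])
  let ?I = "irrelevant_ideal (poly_ring n) (poly_grading n) :: 'k mpoly set"
  let ?E = "{enat (length rs) | rs. regular_sequence (poly_ring n) M rs \<and> set rs \<subseteq> ?I}"
  have "set (map Xvar [Suc k..<Suc n]) \<subseteq> ?I"
  proof
    fix p :: "'k mpoly" assume "p \<in> set (map Xvar [Suc k..<Suc n])"
    then obtain i where "p = Xvar i" "i \<in> {1..n}" by (auto simp del: upt_Suc)
    then show "p \<in> ?I" using Xvar_irrelevant by simp
  qed
  then have "enat (n - k) \<in> ?E"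
    using variables_regular[OF assms(2) base step reg proper]
    by (intro CollectI exI[of _ "map Xvar [Suc k..<Suc n]"]) (simp del: upt_Suc)
  then have "enat (n - k) \<le> Sup ?E" by (rule Sup_upper)
  moreover have "Sup ?E \<le> enat (n - k)"
  proof (rule Sup_least)
    fix e assume "e \<in> ?E"
    then obtain rs where "e = enat (length rs)" "regular_sequence (poly_ring n) M rs"
      by (elim CollectE exE conjE)
    then show "e \<le> enat (n - k)"
      using regular_sequence_length[OF assms(2) nil] by (simp only: enat_ord_simps)
  qed
  ultimately have "Sup ?E = enat (n - k)" by (rule antisym[rotated])
  then show "cohen_macaulay (poly_ring n) (poly_grading n) M"
    by (simp add: cohen_macaulay_def depth_in_def dim)
qed

end

section \<open>Gradings and the filtration\<close>

definition expo_degree :: "nat \<Rightarrow> expo \<Rightarrow> int"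
  where "expo_degree n u = int (\<Sum>j = 1..n. lookup u j)"

definition component :: "nat \<Rightarrow> int \<Rightarrow> 'k::comm_ring_1 mpoly \<Rightarrow> 'k mpoly"
  where "component n i p = restr {u. expo_degree n u = i} p"

definition homogeneous :: "nat \<Rightarrow> 'k::comm_ring_1 mpoly set \<Rightarrow> bool"
  where "homogeneous n I \<longleftrightarrow> (\<forall>p\<in>I. \<forall>i. component n i p \<in> I)"

lemma component_add: "component n i (p + q) = component n i p + component n i q"
  by (simp add: component_def restr_add)

lemmas component_hom = additive_hom[of "component n i" for n i, OF component_add]

lemma poly_grading_alt:
  "poly_grading n i = {p \<in> polys n. \<forall>u\<in>keys p. expo_degree n u = i}"
  by (simp add: poly_grading_def expo_degree_def)

lemma component_grading: "p \<in> polys n \<Longrightarrow> component n i p \<in> poly_grading n i"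
  using restr_carrier by (auto simp: poly_grading_alt component_def keys_restr)

lemma component_of_graded:
  assumes "p \<in> poly_grading n i" shows "component n j p = (if i = j then p else 0)"
proof (cases "i = j")
  case True
  then have "component n j p = p"
    unfolding component_def using assms by (intro restr_id) (auto simp: poly_grading_alt)
  then show ?thesis using True by simp
next
  case False
  then have "component n j p = 0"
    unfolding component_def using assms by (intro restr_zero) (auto simp: poly_grading_alt)
  then show ?thesis using False by simp
qed

lemma component_sum:
  assumes "finite B" "expo_degree n ` keys p \<subseteq> B" shows "(\<Sum>i\<in>B. component n i p) = p"
proof (rule poly_mapping_eqI)
  fix u
  have "(\<Sum>i\<in>B. lookup (component n i p) u) =
      (\<Sum>i\<in>B. if i = expo_degree n u then lookup p u else 0)"
    by (rule sum.cong) (auto simp: component_def lookup_restr when_def)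
  also have "\<dots> = lookup p u"
  proof (cases "u \<in> keys p")
    case True
    then have "expo_degree n u \<in> B" using assms(2) by blast
    then show ?thesis using assms(1) by (simp add: sum.delta)
  next
    case False
    then show ?thesis using assms(1) by (simp add: in_keys_iff)
  qed
  finally show "lookup (\<Sum>i\<in>B. component n i p) u = lookup p u"
    by (simp add: lookup_sum)
qed

lemma poly_grading_closed:
  "p \<in> poly_grading n i \<Longrightarrow> q \<in> poly_grading n i \<Longrightarrow> p + q \<in> poly_grading n i"
  "p \<in> poly_grading n i \<Longrightarrow> - p \<in> poly_grading n i" "0 \<in> poly_grading n i"
  "p \<in> poly_grading n i \<Longrightarrow> r \<in> poly_grading n j \<Longrightarrow> p * r \<in> poly_grading n (i + j)"
proof -
  assume p: "p \<in> poly_grading n i"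
  show "- p \<in> poly_grading n i" using p by (auto simp: poly_grading_alt in_keys_iff)
  show "p + q \<in> poly_grading n i" if "q \<in> poly_grading n i"
    using p that Poly_Mapping.keys_add[of p q] by (auto simp: poly_grading_alt)
  show "p * r \<in> poly_grading n (i + j)" if r: "r \<in> poly_grading n j"
  proof -
    have "expo_degree n u = i + j" if "u \<in> keys (p * r)" for u
    proof -
      obtain v w where "u = v + w" "v \<in> keys p" "w \<in> keys r"
        using keys_mult[of p r] \<open>u \<in> _\<close> by blast
      then show ?thesis using p r by (auto simp: poly_grading_alt expo_degree_def lookup_add sum.distrib)
    qed
    then show ?thesis using p r by (simp add: poly_grading_alt)
  qed
qed (simp add: poly_grading_alt)

context presentation
begin

lemma finsum_image:
  assumes "finite B" "\<And>i. i \<in> B \<Longrightarrow> g i \<in> W"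
  shows "finsum M (\<lambda>i. \<phi> (g i)) B = \<phi> (sum g B)"
  using assms
proof (induction B rule: finite_induct)
  case empty
  have "\<phi> 0 = \<zero>" using kernel poly_idealD(2)[OF W] poly_idealD(2)[OF V] by simp
  then show ?case by simp
next
  case (insert i B)
  have "sum g B \<in> W" by (rule poly_ideal_sum[OF W]) (use insert in auto)
  then show ?case using insert \<phi>_closed by (simp add: add Pi_def)
qed

lemma finsum_support:
  assumes "finite B" "{i. f i \<noteq> \<zero>} \<subseteq> B" "\<And>i. f i \<in> carrier M"
  shows "finsum M f {i. f i \<noteq> \<zero>} = finsum M f B"
  by (rule M.M.add.finprod_mono_neutral_cong_left) (use assms in auto)

lemma \<phi>_eq_iff:
  assumes "x \<in> W" "y \<in> W" shows "\<phi> x = \<phi> y \<longleftrightarrow> x - y \<in> V"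
proof -
  have d: "x - y \<in> W" by (rule poly_idealD(5)[OF W assms])
  have "\<phi> x = \<phi> (x - y) \<oplus> \<phi> y" using add[OF d assms(2)] by simp
  moreover have "\<phi> (x - y) \<oplus> \<phi> y = \<phi> y \<longleftrightarrow> \<phi> (x - y) = \<zero>"
    using \<phi>_closed[OF d] \<phi>_closed[OF assms(2)] by simp
  ultimately show ?thesis using kernel[OF d] by simp
qed

text \<open>The components of a class are the classes of the components of any representative; they are well
  defined because \<open>V\<close> contains the components of its elements.\<close>
lemma direct_sum_image:
  assumes hW: "homogeneous n W" and hV: "homogeneous n V"
  shows "is_direct_sum M (\<lambda>i. \<phi> ` (W \<inter> poly_grading n i))"
  unfolding is_direct_sum_def
proof (intro conjI allI ballI)
  have \<phi>0: "\<phi> 0 = \<zero>" using kernel poly_idealD(2)[OF W] poly_idealD(2)[OF V] by simp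
  fix i
  show "additive_subgroup (\<phi> ` (W \<inter> poly_grading n i)) M"
  proof (rule additive_subgroupI, rule M.M.add.subgroupI)
    show "\<phi> ` (W \<inter> poly_grading n i) \<subseteq> carrier M" using \<phi>_closed by auto
    have "0 \<in> W \<inter> poly_grading n i" using poly_idealD(2)[OF W] poly_grading_closed(3) by blast
    then show "\<phi> ` (W \<inter> poly_grading n i) \<noteq> {}" by blast
    fix a assume "a \<in> \<phi> ` (W \<inter> poly_grading n i)"
    then obtain p where p: "p \<in> W" "p \<in> poly_grading n i" "a = \<phi> p" by blast
    have mp: "- p \<in> W" "- p \<in> poly_grading n i" using poly_idealD(6)[OF W p(1)] poly_grading_closed(2)[OF p(2)] .
    have "\<phi> (- p) \<oplus> \<phi> p = \<zero>" using add[OF mp(1) p(1)] \<phi>0 by simp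
    then have "\<ominus> a = \<phi> (- p)" unfolding p(3)
      by (rule M.M.minus_equality[OF _ \<phi>_closed[OF p(1)] \<phi>_closed[OF mp(1)]])
    then show "\<ominus> a \<in> \<phi> ` (W \<inter> poly_grading n i)" using mp by simp
    fix b assume "b \<in> \<phi> ` (W \<inter> poly_grading n i)"
    then obtain q where q: "q \<in> W" "q \<in> poly_grading n i" "b = \<phi> q" by blast
    have "a \<oplus> b = \<phi> (p + q)" using add[OF p(1) q(1)] p(3) q(3) by simp
    then show "a \<oplus> b \<in> \<phi> ` (W \<inter> poly_grading n i)"
      using poly_idealD(3)[OF W p(1) q(1)] poly_grading_closed(1)[OF p(2) q(2)] by simp
  qed
next
  have \<phi>0: "\<phi> 0 = \<zero>" using kernel poly_idealD(2)[OF W] poly_idealD(2)[OF V] by simp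
  fix x assume "x \<in> carrier M"
  then obtain p where p: "p \<in> W" "x = \<phi> p" using image by blast
  have pc: "p \<in> polys n" using p(1) poly_idealD(1)[OF W] by blast
  have cW: "component n i p \<in> W" for i using hW p(1) by (simp add: homogeneous_def)
  let ?f = "\<lambda>i. \<phi> (component n i p)"
  let ?B = "expo_degree n ` keys p"
  have supp: "{i. ?f i \<noteq> \<zero>} \<subseteq> ?B"
  proof
    fix i assume i: "i \<in> {i. ?f i \<noteq> \<zero>}"
    show "i \<in> ?B"
    proof (rule ccontr)
      assume "i \<notin> ?B"
      then have "component n i p = 0" unfolding component_def by (intro restr_zero) auto
      then show False using i \<phi>0 by simp
    qed
  qed
  show "\<exists>!f. (\<forall>i. f i \<in> \<phi> ` (W \<inter> poly_grading n i)) \<and> finite {i. f i \<noteq> \<zero>} \<and>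
      x = (\<Oplus>i\<in>{i. f i \<noteq> \<zero>}. f i)"
  proof (rule ex1I[of _ ?f])
    have "finsum M ?f {i. ?f i \<noteq> \<zero>} = finsum M ?f ?B"
      by (rule finsum_support[OF _ supp]) (use \<phi>_closed[OF cW] in auto)
    also have "\<dots> = \<phi> (\<Sum>i\<in>?B. component n i p)" by (rule finsum_image) (use cW in auto)
    also have "\<dots> = x" using component_sum[of ?B n p] p(2) by simp
    finally have "x = finsum M ?f {i. ?f i \<noteq> \<zero>}" ..
    moreover have "finite {i. ?f i \<noteq> \<zero>}" by (rule finite_subset[OF supp]) simp
    ultimately show "(\<forall>i. ?f i \<in> \<phi> ` (W \<inter> poly_grading n i)) \<and> finite {i. ?f i \<noteq> \<zero>} \<and>
        x = (\<Oplus>i\<in>{i. ?f i \<noteq> \<zero>}. ?f i)"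
      using cW component_grading[OF pc] by blast
    fix f assume f: "(\<forall>i. f i \<in> \<phi> ` (W \<inter> poly_grading n i)) \<and> finite {i. f i \<noteq> \<zero>} \<and>
        x = (\<Oplus>i\<in>{i. f i \<noteq> \<zero>}. f i)"
    then have "\<forall>i. \<exists>q. q \<in> W \<and> q \<in> poly_grading n i \<and> f i = \<phi> q" by blast
    then obtain g where g: "\<And>i. g i \<in> W" "\<And>i. g i \<in> poly_grading n i" "\<And>i. f i = \<phi> (g i)" by metis
    let ?A = "{i. f i \<noteq> \<zero>}"
    have fin: "finite ?A" using f by blast
    have "x = finsum M f ?A" using f by blast
    also have "\<dots> = \<phi> (sum g ?A)" unfolding g(3) by (rule finsum_image) (use fin g in auto)
    finally have "\<phi> p = \<phi> (sum g ?A)" using p(2) by simp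
    moreover have "sum g ?A \<in> W" by (rule poly_ideal_sum[OF W g(1)])
    ultimately have d: "p - sum g ?A \<in> V" by (rule iffD1[OF \<phi>_eq_iff[OF p(1)], rotated])
    show "f = ?f"
    proof
      fix j
      have dj: "component n j (p - sum g ?A) \<in> V" using hV d by (simp only: homogeneous_def)
      have "component n j (p - sum g ?A) = component n j p - (\<Sum>i\<in>?A. if i = j then g i else 0)"
        by (simp add: component_hom component_of_graded[OF g(2)])
      also have "(\<Sum>i\<in>?A. if i = j then g i else 0) = (if j \<in> ?A then g j else 0)"
        using fin by (simp add: sum.delta)
      finally have *: "component n j p - (if j \<in> ?A then g j else 0) \<in> V" using dj by (simp only:)
      show "f j = ?f j"
      proof (cases "j \<in> ?A")
        case True
        then have "component n j p - g j \<in> V" using * by simp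
        then have "?f j = \<phi> (g j)" by (rule iffD2[OF \<phi>_eq_iff[OF cW g(1)]])
        then show ?thesis by (simp only: g(3))
      next
        case False
        then have "component n j p \<in> V" using * by simp
        then have "?f j = \<zero>" by (rule iffD2[OF kernel[OF cW]])
        then show ?thesis using False by simp
      qed
    qed
  qed
qed

end

lemma module_regular: "Module.module (poly_ring n) (regular_module (poly_ring n) :: ('k::comm_ring_1 mpoly, 'k mpoly) module)"
proof (rule moduleI)
  show "cring (poly_ring n :: 'k mpoly ring)" by (rule cring_poly_ring)
  show "abelian_group (regular_module (poly_ring n) :: ('k mpoly, 'k mpoly) module)"
  proof (rule abelian_groupI)
    fix x :: "'k mpoly" assume "x \<in> carrier (regular_module (poly_ring n))"
    then show "\<exists>y\<in>carrier (regular_module (poly_ring n)).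
        y \<oplus>\<^bsub>regular_module (poly_ring n)\<^esub> x = \<zero>\<^bsub>regular_module (poly_ring n)\<^esub>"
      by (intro bexI[of _ "- x"]) (auto simp: regular_module_def)
  qed (auto simp: regular_module_def algebra_simps)
qed (auto simp: regular_module_def algebra_simps)

lemma presentation_regular:
  "presentation n (polys n) {0 :: 'k::field mpoly} (regular_module (poly_ring n)) (\<lambda>x. x)"
proof (rule presentation.intro)
  show "ideal (polys n) (poly_ring n :: 'k mpoly ring)"
    by (rule ring.oneideal[OF ring_poly_ring])
  show "ideal {0 :: 'k mpoly} (poly_ring n)" by (rule poly_idealI) auto
qed (simp_all add: module_regular, simp_all add: regular_module_def)

lemma presentation_cyclic:
  assumes I: "ideal (I :: 'k::field mpoly set) (poly_ring n)"
  shows "presentation n (polys n) I (quot_module (regular_module (poly_ring n)) I)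
    (\<lambda>x. I +>\<^bsub>poly_ring n\<^esub> x)"
proof -
  interpret P: presentation n "polys n" "{0 :: 'k mpoly}" "regular_module (poly_ring n)" "\<lambda>x. x"
    by (rule presentation_regular)
  have "submodule ((\<lambda>x. x) ` I) (poly_ring n) (regular_module (poly_ring n))"
    by (rule P.submodule_image[OF I poly_idealD(1)[OF I]])
  then have sm: "submodule I (poly_ring n) (regular_module (poly_ring n))" by simp
  have "P.lift I = I" using poly_idealD(1)[OF I] by (auto simp: P.lift_def)
  then have "presentation n (polys n) I (quot_module (regular_module (poly_ring n)) I)
    (\<lambda>x. I +>\<^bsub>regular_module (poly_ring n)\<^esub> x)"
    using P.presentation_quotient[OF sm] by simp
  then show ?thesis by (simp add: a_r_coset_def r_coset_def regular_module_def)
qed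

text \<open>A ring and its regular module have additive groups of different record types, which is why
  their direct sum decompositions have to be compared through the definitions.\<close>
lemma is_direct_sum_regular: "is_direct_sum (regular_module R) G \<longleftrightarrow> is_direct_sum R G"
  by (simp add: is_direct_sum_def finsum_def finprod_def additive_subgroup_def subgroup_def m_inv_def
      regular_module_def)

lemma homogeneous_carrier: "homogeneous n (polys n)"
  using restr_carrier by (auto simp: homogeneous_def component_def)

lemma graded_ring_poly: "graded_ring (poly_ring n) (poly_grading n :: int \<Rightarrow> 'k::field mpoly set)"
proof -
  interpret P: presentation n "polys n" "{0 :: 'k mpoly}" "regular_module (poly_ring n)" "\<lambda>x. x"
    by (rule presentation_regular)
  have "homogeneous n {0 :: 'k mpoly}" by (simp add: homogeneous_def component_hom)
  then have "is_direct_sum (regular_module (poly_ring n))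
      (\<lambda>i. (\<lambda>x. x) ` (polys n \<inter> (poly_grading n i :: 'k mpoly set)))"
    by (rule P.direct_sum_image[OF homogeneous_carrier])
  moreover have "(\<lambda>x. x) ` (polys n \<inter> poly_grading n i) = (poly_grading n i :: 'k mpoly set)" for i
    by (auto simp: poly_grading_alt)
  ultimately have "is_direct_sum (poly_ring n) (poly_grading n :: int \<Rightarrow> 'k mpoly set)"
    by (simp add: is_direct_sum_regular)
  moreover have "(1 :: 'k mpoly) \<in> poly_grading n 0" by (simp add: poly_grading_alt expo_degree_def)
  ultimately show ?thesis
    using cring_poly_ring poly_grading_closed(4) by (auto simp: graded_ring_def)
qed

text \<open>Repetitions are removed from the chain; \<open>\<sigma>\<close> records at which steps it grows.\<close>
lemma strict_subchain:
  fixes G :: "nat \<Rightarrow> 'a set"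
  assumes "\<forall>i<l. G i \<subseteq> G (Suc i)"
  shows "\<exists>r N \<sigma>. N 0 = G 0 \<and> N r = G l \<and> (\<forall>i\<le>r. \<exists>j\<le>l. N i = G j) \<and>
    (\<forall>i<r. \<sigma> i < l \<and> N i = G (\<sigma> i) \<and> N (Suc i) = G (Suc (\<sigma> i)) \<and> N i \<subset> N (Suc i)) \<and>
    (\<forall>i. Suc i < r \<longrightarrow> \<sigma> i < \<sigma> (Suc i :: nat))"
  using assms
proof (induction l)
  case 0
  show ?case by (rule exI[of _ 0], rule exI[of _ G], rule exI[of _ id]) auto
next
  case (Suc l)
  have "\<forall>i<l. G i \<subseteq> G (Suc i)" using Suc.prems by simp
  from Suc.IH[OF this] obtain r :: nat and N and \<sigma> :: "nat \<Rightarrow> nat" where N: "N 0 = G 0" "N r = G l" "\<forall>i\<le>r. \<exists>j\<le>l. N i = G j"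
    "\<forall>i<r. \<sigma> i < l \<and> N i = G (\<sigma> i) \<and> N (Suc i) = G (Suc (\<sigma> i)) \<and> N i \<subset> N (Suc i)"
    "\<forall>i. Suc i < r \<longrightarrow> \<sigma> i < \<sigma> (Suc i)" by (elim exE conjE)
  show ?case
  proof (cases "G l = G (Suc l)")
    case True
    have "\<forall>i\<le>r. \<exists>j\<le>Suc l. N i = G j" using N(3) le_SucI by blast
    moreover have "\<forall>i<r. \<sigma> i < Suc l \<and> N i = G (\<sigma> i) \<and> N (Suc i) = G (Suc (\<sigma> i)) \<and> N i \<subset> N (Suc i)"
      using N(4) less_SucI by blast
    moreover have "N r = G (Suc l)" using N(2) True by (rule trans)
    ultimately show ?thesis using N(1,5) by (intro exI[of _ r] exI[of _ N] exI[of _ \<sigma>] conjI)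
  next
    case False
    then have sub: "G l \<subset> G (Suc l)" using Suc.prems by auto
    define N' where "N' = N(Suc r := G (Suc l))"
    define \<sigma>' where "\<sigma>' = \<sigma>(r := l)"
    have "\<exists>j\<le>Suc l. N' i = G j" if "i \<le> Suc r" for i
      using N(3) that by (cases "i = Suc r") (auto simp: N'_def le_Suc_eq)
    moreover have "\<sigma>' i < Suc l \<and> N' i = G (\<sigma>' i) \<and> N' (Suc i) = G (Suc (\<sigma>' i)) \<and> N' i \<subset> N' (Suc i)"
      if "i < Suc r" for i
    proof (cases "i = r")
      case True
      then show ?thesis using N(2) sub by (simp add: N'_def \<sigma>'_def)
    next
      case False
      then have "i < r" using that by simp
      then have "N' i = N i" "N' (Suc i) = N (Suc i)" "\<sigma>' i = \<sigma> i" by (simp_all add: N'_def \<sigma>'_def)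
      then show ?thesis using N(4)[rule_format, OF \<open>i < r\<close>] less_SucI by metis
    qed
    moreover have "\<sigma>' i < \<sigma>' (Suc i)" if "Suc i < Suc r" for i
      using N(4,5) that by (cases "Suc i = r") (auto simp: \<sigma>'_def)
    moreover have "N' 0 = G 0" "N' (Suc r) = G (Suc l)" using N(1) by (auto simp: N'_def)
    ultimately show ?thesis
      by (intro exI[of _ "Suc r"] exI[of _ N'] exI[of _ \<sigma>']) (intro conjI allI impI, blast+)
  qed
qed

context reduction_system
begin

lemma homogeneous_F: "homogeneous n (F k :: 'k::field mpoly set)"
  unfolding homogeneous_def
proof (intro ballI allI)
  fix p :: "'k mpoly" and i assume p: "p \<in> F k"
  have "NF k (component n i p) = component n i (NF k p)"
  proof (rule additive_eqI[of "\<lambda>p. NF k (component n i p)" "\<lambda>p. component n i (NF k p)" p])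
    fix u :: expo and c :: 'k
    have "expo_degree n v = expo_degree n u" if "nf k u = Some v" for v
      unfolding expo_degree_def using nf_degree[OF that] by simp
    then show "NF k (component n i (single u c)) = component n i (NF k (single u c))"
      by (cases "nf k u") (auto simp: component_def restr_single NF_single NF_hom component_hom[unfolded component_def])
  qed (simp_all add: component_add NF_add)
  then show "component n i p \<in> F k"
    using p restr_carrier by (auto simp: F_def component_hom) (simp add: component_def restr_carrier)
qed

lemma step_cohen_macaulay:
  assumes "k \<le> n" "F (Suc k) \<noteq> (F k :: 'k::field mpoly set)"
    and P: "presentation n (F k :: 'k mpoly set) (F (Suc k)) M \<phi>"
  shows "cohen_macaulay (poly_ring n) (poly_grading n) M" "module_dim (poly_ring n) M = enat (n - k)"
proof -
  interpret P: presentation n "F k :: 'k mpoly set" "F (Suc k)" M \<phi> by (rule P)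
  have nil: "Xvar j ^ T * y \<in> F (Suc k)" if "j \<in> {1..k}" "y \<in> F k" for j and y :: "'k mpoly"
    by (rule F_nilpotent) (use that assms(1) in auto)
  have tf: "p \<in> F (Suc k)" if "g \<in> polys n" "g \<noteq> 0"
    "\<And>w. w \<in> keys g \<Longrightarrow> keys w \<subseteq> {Suc k..n}" "p \<in> F k" "g * p \<in> F (Suc k)"
    for g p :: "'k mpoly" by (rule F_torsion_free[OF that])
  have step: "D k (Suc j) = {a + Xvar (Suc j) * w | a w. a \<in> D k j \<and> w \<in> (F k :: 'k mpoly set)}"
    if "k \<le> j" "j < n" for j by (rule D_step[OF that])
  have reg: "p \<in> D k j" if "k \<le> j" "j < n" "p \<in> F k" "Xvar (Suc j) * p \<in> D k j" for j and p :: "'k mpoly"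
    by (rule D_regular[OF that(3,1,2,4)])
  have proper: "D k n \<noteq> (F k :: 'k mpoly set)" by (rule D_proper[OF assms(2,1)])
  note criterion = P.cohen_macaulay_criterion[where k = k and t = T and D = "D k"]
  show "cohen_macaulay (poly_ring n) (poly_grading n) M"
    by (rule criterion(1)) (fact assms(2) assms(1) nil tf D_base step reg proper)+
  show "module_dim (poly_ring n) M = enat (n - k)"
    by (rule criterion(2)) (fact assms(2) assms(1) nil tf D_base step reg proper)+
qed

text \<open>The chain \<open>F q \<subseteq> F (q - 1) \<subseteq> \<dots> \<subseteq> F 0\<close>, freed of repetitions, is the filtration. Its step
  from \<open>F (k + 1)\<close> to \<open>F k\<close> has dimension \<open>n - k\<close>, and \<open>k\<close> decreases along the chain.\<close>
theorem quotient_seq_CM_F: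
  assumes "q \<le> Suc n" shows "quotient_seq_CM n (F q :: 'k::field mpoly set)"
proof -
  let ?S = "poly_ring n :: 'k mpoly ring"
  let ?I = "F q :: 'k mpoly set"
  let ?Q = "quot_module (regular_module ?S) ?I"
  let ?\<psi> = "\<lambda>x. ?I +>\<^bsub>?S\<^esub> x"
  let ?MG = "quot_grading ?S (poly_grading n) ?I"
  interpret P: presentation n "carrier ?S" ?I ?Q ?\<psi> by (rule presentation_cyclic[OF ideal_F])
  have sub: "?I \<subseteq> F k" if "k \<le> q" for k using F_antimono[OF that] .
  have lift: "P.lift (?\<psi> ` F k) = F k" if "k \<le> q" for k
    by (rule P.lift_image[OF ideal_F sub[OF that] F_subset])
  have sm: "submodule (?\<psi> ` F k) ?S ?Q" for k by (rule P.submodule_image[OF ideal_F F_subset])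
  have P1: "presentation n (F k) ?I (?Q\<lparr>carrier := ?\<psi> ` F k\<rparr>) ?\<psi>" if "k \<le> q" for k
    using P.presentation_submodule[OF sm[of k]] unfolding lift[OF that] .
  have MG: "?MG i = ?\<psi> ` poly_grading n i" for i by (simp add: quot_grading_def)
  have inter: "?MG i \<inter> ?\<psi> ` F k = ?\<psi> ` (F k \<inter> poly_grading n i)" if "k \<le> q" for i k
  proof
    show "?MG i \<inter> ?\<psi> ` F k \<subseteq> ?\<psi> ` (F k \<inter> poly_grading n i)"
    proof
      fix y assume "y \<in> ?MG i \<inter> ?\<psi> ` F k"
      then obtain p where p: "p \<in> poly_grading n i" "y = ?\<psi> p" "?\<psi> p \<in> ?\<psi> ` F k" unfolding MG by blast
      then have "p \<in> P.lift (?\<psi> ` F k)" by (simp add: P.lift_def poly_grading_alt)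
      then have "p \<in> F k" unfolding lift[OF that] .
      then show "y \<in> ?\<psi> ` (F k \<inter> poly_grading n i)" using p by blast
    qed
    show "?\<psi> ` (F k \<inter> poly_grading n i) \<subseteq> ?MG i \<inter> ?\<psi> ` F k" unfolding MG by blast
  qed
  have graded: "graded_submodule ?S ?Q ?MG (?\<psi> ` F k)" if "k \<le> q" for k
    unfolding graded_submodule_def inter[OF that]
    using sm presentation.direct_sum_image[OF P1[OF that] homogeneous_F homogeneous_F] by blast
  have step: "cohen_macaulay ?S (poly_grading n) (quot_module (?Q\<lparr>carrier := ?\<psi> ` F k\<rparr>) (?\<psi> ` F (Suc k)))"
      "module_dim ?S (quot_module (?Q\<lparr>carrier := ?\<psi> ` F k\<rparr>) (?\<psi> ` F (Suc k))) = enat (n - k)"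
    if k: "Suc k \<le> q" and ne: "?\<psi> ` F (Suc k) \<noteq> ?\<psi> ` F k" for k
  proof -
    have kq: "k \<le> q" using k by simp
    interpret P1: presentation n "F k" ?I "?Q\<lparr>carrier := ?\<psi> ` F k\<rparr>" ?\<psi> by (rule P1[OF kq])
    have FF: "F (Suc k) \<subseteq> (F k :: 'k mpoly set)" by (rule F_antimono) simp
    have sm1: "submodule (?\<psi> ` F (Suc k)) ?S (?Q\<lparr>carrier := ?\<psi> ` F k\<rparr>)"
      by (rule P1.submodule_image[OF ideal_F FF])
    have "P1.lift (?\<psi> ` F (Suc k)) = F (Suc k)"
      by (rule P1.lift_image[OF ideal_F sub[OF k] FF])
    then have "presentation n (F k) (F (Suc k)) (quot_module (?Q\<lparr>carrier := ?\<psi> ` F k\<rparr>) (?\<psi> ` F (Suc k)))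
        (\<lambda>x. ?\<psi> ` F (Suc k) +>\<^bsub>?Q\<lparr>carrier := ?\<psi> ` F k\<rparr>\<^esub> ?\<psi> x)"
      using P1.presentation_quotient[OF sm1] by simp
    moreover have "F (Suc k) \<noteq> (F k :: 'k mpoly set)" using ne by metis
    moreover have "k \<le> n" using k assms by simp
    ultimately show "cohen_macaulay ?S (poly_grading n) (quot_module (?Q\<lparr>carrier := ?\<psi> ` F k\<rparr>) (?\<psi> ` F (Suc k)))"
      "module_dim ?S (quot_module (?Q\<lparr>carrier := ?\<psi> ` F k\<rparr>) (?\<psi> ` F (Suc k))) = enat (n - k)"
      using step_cohen_macaulay by blast+
  qed
  define G where "G i = ?\<psi> ` (F (q - i) :: 'k mpoly set)" for i
  have "\<forall>i<q. G i \<subseteq> G (Suc i)"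
    unfolding G_def by (intro allI impI image_mono F_antimono) simp
  from strict_subchain[of q G, OF this]
  obtain r N and \<sigma> :: "nat \<Rightarrow> nat" where N: "N 0 = G 0" "N r = G q" "\<forall>i\<le>r. \<exists>j\<le>q. N i = G j"
    "\<forall>i<r. \<sigma> i < q \<and> N i = G (\<sigma> i) \<and> N (Suc i) = G (Suc (\<sigma> i)) \<and> N i \<subset> N (Suc i)"
    "\<forall>i. Suc i < r \<longrightarrow> \<sigma> i < \<sigma> (Suc i)" by (elim exE conjE)
  have NI: "cohen_macaulay ?S (poly_grading n) (quot_module (?Q\<lparr>carrier := N (Suc i)\<rparr>) (N i))"
    "module_dim ?S (quot_module (?Q\<lparr>carrier := N (Suc i)\<rparr>) (N i)) = enat (n - (q - Suc (\<sigma> i)))"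
    if i: "i < r" for i
  proof -
    let ?k = "q - Suc (\<sigma> i)"
    have \<sigma>: "\<sigma> i < q" "N i = G (\<sigma> i)" "N (Suc i) = G (Suc (\<sigma> i))" "N i \<noteq> N (Suc i)" using N(4) i by auto
    have k: "q - \<sigma> i = Suc ?k" "Suc ?k \<le> q" using \<sigma>(1) by auto
    have eq: "N i = ?\<psi> ` F (Suc ?k)" "N (Suc i) = ?\<psi> ` F ?k" using \<sigma>(2,3) k(1) by (simp_all only: G_def)
    then have "?\<psi> ` F (Suc ?k) \<noteq> ?\<psi> ` F ?k" using \<sigma>(4) by simp
    from step[OF k(2) this] show "cohen_macaulay ?S (poly_grading n) (quot_module (?Q\<lparr>carrier := N (Suc i)\<rparr>) (N i))"
      "module_dim ?S (quot_module (?Q\<lparr>carrier := N (Suc i)\<rparr>) (N i)) = enat (n - ?k)"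
      unfolding eq .
  qed
  have dims: "module_dim ?S (quot_module (?Q\<lparr>carrier := N (Suc i)\<rparr>) (N i)) <
      module_dim ?S (quot_module (?Q\<lparr>carrier := N (Suc (Suc i))\<rparr>) (N (Suc i)))" if i: "Suc i < r" for i
  proof -
    have "i < r" using i by simp
    have "\<sigma> i < \<sigma> (Suc i)" "\<sigma> (Suc i) < q" using N(4,5) i by auto
    then have "n - (q - Suc (\<sigma> i)) < n - (q - Suc (\<sigma> (Suc i)))" using assms by linarith
    then show ?thesis unfolding NI(2)[OF i] NI(2)[OF \<open>i < r\<close>] by simp
  qed
  have N0: "N 0 = {\<zero>\<^bsub>?Q\<^esub>}"
  proof -
    have "?\<psi> x = \<zero>\<^bsub>?Q\<^esub>" if "x \<in> ?I" for x using P.kernel that F_subset by blast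
    moreover have "0 \<in> ?I" by (rule poly_idealD(2)[OF ideal_F])
    ultimately have "?\<psi> ` ?I = {\<zero>\<^bsub>?Q\<^esub>}" by blast
    then show ?thesis using N(1) by (simp add: G_def)
  qed
  have Nr: "N r = carrier ?Q" using N(2) P.image by (simp add: G_def F_0)
  have gradedN: "graded_submodule ?S ?Q ?MG (N i)" if "i \<le> r" for i
  proof -
    from N(3)[rule_format, OF that] obtain j where j: "N i = G j" by (elim exE conjE)
    show ?thesis unfolding j G_def by (rule graded) simp
  qed
  have gm: "graded_module ?S (poly_grading n) ?Q ?MG"
    unfolding graded_module_def
  proof (intro conjI allI ballI)
    show "graded_ring ?S (poly_grading n)" by (rule graded_ring_poly)
    show "Module.module ?S ?Q" by (rule P.module)
    have "is_direct_sum ?Q (\<lambda>i. ?\<psi> ` (carrier ?S \<inter> poly_grading n i))"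
      by (rule P.direct_sum_image[OF homogeneous_carrier homogeneous_F])
    moreover have "carrier ?S \<inter> poly_grading n i = (poly_grading n i :: 'k mpoly set)" for i
      by (auto simp: poly_grading_alt)
    moreover have "?MG = (\<lambda>i. ?\<psi> ` poly_grading n i)" by (simp add: MG fun_eq_iff)
    ultimately show "is_direct_sum ?Q ?MG" by simp
    fix i j :: int and r :: "'k mpoly" and x assume r: "r \<in> poly_grading n i" and "x \<in> ?MG j"
    then obtain p where p: "p \<in> poly_grading n j" "x = ?\<psi> p" unfolding MG by (elim imageE)
    have "r \<odot>\<^bsub>?Q\<^esub> x = ?\<psi> (r * p)"
      using P.smult[of r p] p r by (simp add: poly_grading_alt)
    then show "r \<odot>\<^bsub>?Q\<^esub> x \<in> ?MG (i + j)" unfolding MG using poly_grading_closed(4)[OF r p(1)] by simp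
  qed
  have fg: "finitely_generated ?S ?Q"
    unfolding finitely_generated_def
  proof (intro exI[of _ "{?\<psi> 1}"] conjI)
    show B: "{?\<psi> 1} \<subseteq> carrier ?Q" using P.\<phi>_closed[of 1] by simp
    note gen = gen_submodule_props[OF P.module B]
    show "gen_submodule ?S ?Q {?\<psi> 1} = carrier ?Q"
    proof
      show "gen_submodule ?S ?Q {?\<psi> 1} \<subseteq> carrier ?Q" by (rule P.M.submoduleE(1)[OF gen(1)])
      show "carrier ?Q \<subseteq> gen_submodule ?S ?Q {?\<psi> 1}"
      proof
        fix x assume "x \<in> carrier ?Q"
        then obtain p where p: "p \<in> carrier ?S" "x = ?\<psi> p" unfolding P.image[symmetric] by (elim imageE)
        have "x = p \<odot>\<^bsub>?Q\<^esub> ?\<psi> 1" using P.smult[OF p(1), of 1] p(2) by simp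
        then show "x \<in> gen_submodule ?S ?Q {?\<psi> 1}"
          using P.M.submoduleE(4)[OF gen(1) p(1), of "?\<psi> 1"] gen(2) by simp
      qed
    qed
  qed simp
  show ?thesis
    unfolding quotient_seq_CM_def sequentially_cohen_macaulay_def
  proof (intro conjI exI[of _ r] exI[of _ N] allI impI)
    show "N i \<subset> N (Suc i)" if "i < r" for i using N(4)[rule_format, OF that] by (elim conjE)
  qed (fact gm fg N0 Nr gradedN NI(1) dims)+
qed

end

section \<open>The ideal of a binomial system and its saturation\<close>

lemma expo_of_vec:
  assumes "nonneg_vec n a" shows "\<exists>u\<in>expos n. vec u = a"
proof -
  have nn: "0 \<le> a i" for i using assms by (simp add: nonneg_vec_def)
  have "finite {i. nat (a i) \<noteq> 0}"
    by (rule finite_subset[of _ "{1..n}"]) (use assms in \<open>auto simp: nonneg_vec_def Zvec_def\<close>)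
  then have "vec (Abs_poly_mapping (\<lambda>i. nat (a i))) = a"
    using nn by (simp add: vec_def fun_eq_iff)
  then show ?thesis using assms nonneg_vec_vec by metis
qed

lemma prod_monomials:
  "(\<Prod>i\<in>B. single (f i) (1 :: 'k::comm_ring_1)) = (single (sum f B) 1 :: 'k mpoly)"
  by (induction B rule: infinite_finite_induct) (simp_all add: mult_single)

lemma Xmon_vec:
  assumes "u \<in> expos n" shows "Xmon n (vec u) = (single u 1 :: 'k::comm_ring_1 mpoly)"
proof -
  have "(\<Sum>i = 1..n. single i (lookup u i)) = u"
  proof (rule poly_mapping_eqI)
    fix j
    have "lookup u j = 0" if "j \<notin> {1..n}"
    proof -
      have "j \<notin> keys u" using assms that by (auto simp: expos_def)
      then show ?thesis by (simp add: in_keys_iff)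
    qed
    then show "lookup (\<Sum>i = 1..n. single i (lookup u i)) j = lookup u j"
      by (auto simp: lookup_sum lookup_single when_def sum.delta)
  qed
  then show ?thesis by (simp add: Xmon_def vec_def Xvar_power prod_monomials)
qed

context reduction_system
begin

text \<open>One inclusion holds because \<open>X\<^sub>n\<close> acts injectively on the normal forms of rule \<open>n\<close>. For the
  other one, a monomial of degree at least \<open>n * T\<close> is divisible by the \<open>T\<close>-th power of a variable,
  and all these powers map \<open>F n\<close> into \<open>F (n + 1)\<close>.\<close>
lemma saturation_F:
  assumes "1 \<le> n" shows "saturation n (F (Suc n)) = (F n :: 'k::field mpoly set)"
proof
  let ?S = "poly_ring n :: 'k mpoly ring"
  define P where "P = Idl\<^bsub>?S\<^esub> (Xvar ` {1..n})"
  have sat: "saturation n (F (Suc n)) = {f \<in> carrier ?S. \<exists>k::nat. \<forall>g\<in>P [^]\<^bsub>ideals_set ?S\<^esub> k. f * g \<in> F (Suc n)}"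
    by (simp add: saturation_def P_def Let_def)
  have XS: "Xvar ` {1..n} \<subseteq> carrier ?S" using Xvar_carrier by blast
  have pow_Suc: "P [^]\<^bsub>ideals_set ?S\<^esub> Suc k = ideal_prod ?S (P [^]\<^bsub>ideals_set ?S\<^esub> k) P" for k
    by (simp add: ideals_set_def)
  have pow_0: "P [^]\<^bsub>ideals_set ?S\<^esub> (0::nat) = carrier ?S" by (simp add: ideals_set_def)
  show "saturation n (F (Suc n)) \<subseteq> (F n :: 'k mpoly set)"
  proof
    fix f :: "'k mpoly" assume "f \<in> saturation n (F (Suc n))"
    then obtain k :: nat where f: "f \<in> carrier ?S" and k: "\<And>g. g \<in> P [^]\<^bsub>ideals_set ?S\<^esub> k \<Longrightarrow> f * g \<in> F (Suc n)"
      unfolding sat by blast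
    have XP: "Xvar n \<in> P"
      unfolding P_def using ring.genideal_self[OF ring_poly_ring XS] assms by auto
    have "Xvar n ^ k \<in> P [^]\<^bsub>ideals_set ?S\<^esub> k" for k :: nat
    proof (induction k)
      case 0
      show ?case unfolding pow_0 by simp
    next
      case (Suc k)
      have "Xvar n ^ k \<otimes>\<^bsub>?S\<^esub> Xvar n \<in> ideal_prod ?S (P [^]\<^bsub>ideals_set ?S\<^esub> k) P"
        by (rule ideal_prod.prod[OF Suc.IH XP])
      then show ?case unfolding pow_Suc by (simp add: mult.commute)
    qed
    then have "f * Xvar n ^ k \<in> F (Suc n)" by (rule k)
    then have "Xvar n ^ k * f \<in> F n" using F_antimono[of n "Suc n"] by (auto simp: mult.commute)
    then have "NF n (Xvar n ^ k * f) = 0" by (simp add: F_def)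
    moreover have "Xvar n ^ k \<in> carrier ?S" by (rule poly_carrier_power, rule Xvar_carrier) (use assms in simp)
    then have "NF n (Xvar n ^ k * f) = Xvar n ^ k * NF n f"
      using NF_mult_free[OF f, of "Xvar n ^ k" n] assms by (auto simp: Xvar_power)
    moreover have "Xvar n ^ k \<noteq> (0 :: 'k mpoly)" unfolding Xvar_power using keys_single by (metis keys_zero insert_not_empty zero_neq_one)
    ultimately have "NF n f = 0" by (metis mult_eq_0_iff)
    then show "f \<in> F n" using f by (simp add: F_def)
  qed
  \<comment> \<open>\<open>H k\<close> contains the \<open>k\<close>-th power of the irrelevant ideal and is described by degrees alone\<close>
  define H where "H k = {p \<in> carrier ?S. \<forall>u\<in>keys p. k \<le> (\<Sum>j = 1..n. lookup u j)}" for k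
  have H_add: "p + q \<in> H k" if "p \<in> H k" "q \<in> H k" for p q k
    using that Poly_Mapping.keys_add[of p q] by (auto simp: H_def)
  have H_mult: "p * q \<in> H (k + l)" if "p \<in> H k" "q \<in> H l" for p q k l
  proof -
    have "k + l \<le> (\<Sum>j = 1..n. lookup u j)" if u: "u \<in> keys (p * q)" for u
    proof -
      obtain v w where v: "u = v + w" "v \<in> keys p" "w \<in> keys q"
        using u keys_mult[of p q] by blast
      then have "k \<le> (\<Sum>j = 1..n. lookup v j)" "l \<le> (\<Sum>j = 1..n. lookup w j)"
        using \<open>p \<in> H k\<close> \<open>q \<in> H l\<close> by (auto simp: H_def)
      then show ?thesis by (simp add: v(1) lookup_add sum.distrib)
    qed
    then show ?thesis using that by (simp add: H_def)
  qed
  have H0: "H 0 = carrier ?S" by (auto simp: H_def)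
  have "P \<subseteq> H 1" unfolding P_def
  proof (rule ring.genideal_minimal[OF ring_poly_ring])
    show "ideal (H 1) ?S"
    proof (rule poly_idealI)
      show "r * x \<in> H 1" if "r \<in> carrier ?S" "x \<in> H 1" for r x
        using H_mult[of r 0 x 1] that by (simp add: H0)
    qed (auto simp: H_add, auto simp: H_def)
    show "Xvar ` {1..n} \<subseteq> H 1"
    proof
      fix p :: "'k mpoly" assume "p \<in> Xvar ` {1..n}"
      then obtain i where i: "i \<in> {1..n}" "p = Xvar i" by blast
      have "(\<Sum>j = 1..n. lookup (single i (1::nat)) j) = 1"
        using i by (simp add: lookup_single when_def sum.delta)
      then show "p \<in> H 1" using Xvar_carrier[OF i(1)] by (simp add: H_def i(2) Xvar_def)
    qed
  qed
  have pow: "P [^]\<^bsub>ideals_set ?S\<^esub> k \<subseteq> H k" for k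
  proof (induction k)
    case 0
    show ?case unfolding pow_0 H0 ..
  next
    case (Suc k)
    show ?case unfolding pow_Suc
    proof
      fix s assume "s \<in> ideal_prod ?S (P [^]\<^bsub>ideals_set ?S\<^esub> k) P"
      then show "s \<in> H (Suc k)"
      proof (induction s rule: ideal_prod.induct)
        case (prod i j)
        then have "i \<in> H k" "j \<in> H 1" using Suc.IH \<open>P \<subseteq> H 1\<close> by auto
        then show ?case using H_mult[of i k j 1] by simp
      next
        case (sum s1 s2)
        then show ?case using H_add by simp
      qed
    qed
  qed
  show "(F n :: 'k mpoly set) \<subseteq> saturation n (F (Suc n))"
  proof
    fix f :: "'k mpoly" assume f: "f \<in> F n"
    have "f * g \<in> F (Suc n)" if g: "g \<in> P [^]\<^bsub>ideals_set ?S\<^esub> (n * T)" for g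
    proof -
      have gH: "g \<in> H (n * T)" using pow g by blast
      have "g * f \<in> F (Suc n)"
      proof (rule power_multiples_mem[OF ideal_F, where J = "{1..n}" and t = T])
        show "g \<in> carrier ?S" using gH by (simp add: H_def)
        show "Xvar j ^ T * f \<in> F (Suc n)" if "j \<in> {1..n}" for j
          by (rule F_nilpotent[OF f]) (use that in auto)
        fix u assume "u \<in> keys g"
        then have u: "n * T \<le> (\<Sum>j = 1..n. lookup u j)" using gH by (simp add: H_def)
        show "\<exists>j\<in>{1..n}. T \<le> lookup u j"
        proof (rule ccontr)
          assume "\<not> (\<exists>j\<in>{1..n}. T \<le> lookup u j)"
          then have "(\<Sum>j = 1..n. lookup u j) < (\<Sum>j = 1..n. T)"
            using assms by (intro sum_strict_mono) (auto simp: not_le)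
          then show False using u by simp
        qed
      qed
      then show ?thesis by (simp add: mult.commute)
    qed
    then show "f \<in> saturation n (F (Suc n))" unfolding sat using f F_subset by blast
  qed
qed

end

context admissible_binomial_system
begin

sublocale R: reduction_system n "2 * d" nf
  by unfold_locales (fact nf_expos nf_degree nf_idem nf_step nf_free nf_nilpotent nf_zero nf_Suc_normal)+

lemma split_trunc:
  assumes u: "u \<in> expos n" and t: "trunc d (Suc n) (vec u) \<in> Nvec n d"
  shows "\<exists>w\<in>expos n. \<exists>a\<in>expos n. vec a = trunc d (Suc n) (vec u) \<and> u = w + a"
proof -
  obtain a where a: "a \<in> expos n" "vec a = trunc d (Suc n) (vec u)"
    using expo_of_vec t by (auto simp: Nvec_iff)
  have "vec a i \<le> vec u i" for i
  proof (cases "i < Suc n")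
    case True
    then show ?thesis unfolding a(2) using u by (intro trunc_le) (auto simp: nonneg_vec_vec)
  next
    case False
    then have "vec a i = 0" using t unfolding a(2) by (simp add: Nvec_def Zvec_def)
    then show ?thesis by (simp add: vec_def)
  qed
  then have "u = (u - a) + a"
    by (intro poly_mapping_eqI) (simp add: lookup_add lookup_minus vec_def)
  then show ?thesis using a u expos_add by metis
qed

text \<open>Rule \<open>n + 1\<close> reduces the generators to zero. Conversely each single reduction is
  a multiple of a generator, up to monomials in the ideal of \<open>A\<close>, so every polynomial is congruent to
  its normal form.\<close>
lemma Fideal_eq_F: "Fideal n A C \<rho> = (R.F (Suc n) :: 'k::field mpoly set)"
proof
  let ?S = "poly_ring n :: 'k mpoly ring"
  let ?I = "Fideal n A C \<rho> :: 'k mpoly set"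
  define gens :: "'k mpoly set" where "gens = {Xmon n a | a. a \<in> A} \<union> {Xmon n c - Xmon n (\<lambda>i. c i + \<rho> i) | c. c \<in> C}"
  have I_def: "?I = Idl\<^bsub>?S\<^esub> gens" by (simp add: Fideal_def gens_def)
  have monoA: "\<exists>u\<in>expos n. vec u = a \<and> Xmon n a = (single u 1 :: 'k mpoly)" if "a \<in> A" for a
    using expo_of_vec[of n a] Xmon_vec that Nvec(1) by (metis Nvec_iff subsetD)
  have monoC: "\<exists>u\<in>expos n. vec u = c \<and> shiftable u \<and>
      Xmon n c - Xmon n (\<lambda>i. c i + \<rho> i) = single u 1 - (single (shift u) 1 :: 'k mpoly)"
    if c: "c \<in> C" for c
  proof -
    obtain u where u: "u \<in> expos n" "vec u = c" using expo_of_vec[of n c] c Nvec(2) by (metis Nvec_iff subsetD)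
    have s: "shiftable u" using shift_Nvec[OF c] by (simp add: shiftable_def u(2) Nvec_iff)
    have "Xmon n (\<lambda>i. c i + \<rho> i) = (single (shift u) 1 :: 'k mpoly)"
      using Xmon_vec[OF shift_expos[OF s]] by (simp add: vec_shift[OF s] u(2))
    moreover have "Xmon n c = (single u 1 :: 'k mpoly)" using Xmon_vec[OF u(1)] u(2) by simp
    ultimately show ?thesis using u s by auto
  qed
  have gens_F: "gens \<subseteq> R.F (Suc n)"
  proof
    fix p assume "p \<in> gens"
    then consider a where "a \<in> A" "p = Xmon n a" | c where "c \<in> C" "p = Xmon n c - Xmon n (\<lambda>i. c i + \<rho> i)"
      unfolding gens_def by blast
    then show "p \<in> R.F (Suc n)"
    proof cases
      case 1
      then obtain u where u: "u \<in> expos n" "vec u = a" "p = single u 1" using monoA by blast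
      have tA: "trunc d (Suc n) (vec u) \<in> A" using trunc_full[of a n d] 1 u Nvec(1) by auto
      then have "\<not> (shiftable u \<and> trunc d (Suc n) (vec (shift u)) \<in> C\<rho>)"
        using target_source'[OF u(1), of "Suc n"] disjoint by blast
      then have "nf (Suc n) u = None" using tA by (auto simp: nf_def in_colon_def)
      then show ?thesis using u by (simp add: R.F_def R.NF_single poly_carrier_single)
    next
      case 2
      then obtain u where u: "u \<in> expos n" "vec u = c" "shiftable u"
        "p = single u 1 - single (shift u) 1" using monoC by metis
      have "trunc d (Suc n) (vec u) \<in> C" using trunc_full[of c n d] 2 u Nvec(2) by auto
      moreover have "trunc d (Suc n) (vec (shift u)) \<in> C\<rho>"
        using trunc_full[of "\<lambda>i. c i + \<rho> i" n d] shift_mem[of c] Nvec(3) 2 by (auto simp: vec_shift[OF u(3)] u(2))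
      ultimately have "nf (Suc n) u = nf (Suc n) (shift u)"
        using u by (intro nf_shift_eq) (auto simp: in_colon_def)
      then have "R.NF (Suc n) p = 0" by (simp add: u(4) R.NF_hom R.NF_single)
      moreover have "p \<in> carrier ?S" unfolding u(4)
        using u(1) shift_expos[OF u(3)] by (intro poly_carrier_intros poly_carrier_single)
      ultimately show ?thesis by (simp add: R.F_def)
    qed
  qed
  then show "?I \<subseteq> R.F (Suc n)"
    unfolding I_def by (rule ring.genideal_minimal[OF ring_poly_ring R.ideal_F])
  have gens_carrier: "gens \<subseteq> carrier ?S" using gens_F R.F_subset by blast
  have I: "ideal ?I ?S" unfolding I_def by (rule ring.genideal_ideal[OF ring_poly_ring gens_carrier])
  have gens_I: "gens \<subseteq> ?I" unfolding I_def by (rule ring.genideal_self[OF ring_poly_ring gens_carrier])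
  have single_mult: "single (w + u) x = single w x * (single u 1 :: 'k mpoly)" for w u x
    by (simp add: mult_single)
  have inA: "single u x \<in> ?I" if u: "u \<in> expos n" and t: "trunc d (Suc n) (vec u) \<in> A" for u x
  proof -
    obtain w a where wa: "w \<in> expos n" "a \<in> expos n" "vec a = trunc d (Suc n) (vec u)" "u = w + a"
      using split_trunc[OF u] t Nvec(1) by blast
    have "vec a \<in> A" using t wa(3) by simp
    then have "Xmon n (vec a) \<in> gens" unfolding gens_def by blast
    then have "single a 1 \<in> gens" unfolding Xmon_vec[OF wa(2)] .
    then have "single a 1 \<in> ?I" using gens_I by (rule rev_subsetD)
    then show ?thesis unfolding wa(4) single_mult
      by (rule poly_idealD(4)[OF I poly_carrier_single[OF wa(1)]])
  qed
  have reduce: "single u x - R.NF (Suc n) (single u x) \<in> ?I" if u: "u \<in> expos n" for u x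
  proof -
    consider "\<not> in_colon (A \<union> C) (Suc n) u" | "trunc d (Suc n) (vec u) \<in> A" | "trunc d (Suc n) (vec u) \<in> C"
      by (auto simp: in_colon_def)
    then show ?thesis
    proof cases
      case 1
      then have "nf (Suc n) u = Some u" by (simp add: nf_def)
      then show ?thesis using poly_idealD(2)[OF I] by (simp add: R.NF_single)
    next
      case 2
      then have "\<not> (shiftable u \<and> trunc d (Suc n) (vec (shift u)) \<in> C\<rho>)"
        using target_source'[OF u, of "Suc n"] disjoint by blast
      then have "nf (Suc n) u = None" using 2 by (auto simp: nf_def in_colon_def)
      then show ?thesis using inA[OF u 2] by (simp add: R.NF_single)
    next
      case 3
      obtain w c where wc: "w \<in> expos n" "c \<in> expos n" "vec c = trunc d (Suc n) (vec u)" "u = w + c"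
        using split_trunc[OF u] 3 Nvec(2) by blast
      have cC: "vec c \<in> C" using 3 wc(3) by simp
      obtain c' where c': "vec c' = vec c" "shiftable c'"
        "Xmon n (vec c) - Xmon n (\<lambda>i. vec c i + \<rho> i) = single c' 1 - (single (shift c') 1 :: 'k mpoly)"
        using monoC[OF cC] by blast
      have "c' = c" using c'(1) by (simp add: vec_inj)
      then have s: "shiftable c" using c'(2) by simp
      have "Xmon n (vec c) - Xmon n (\<lambda>i. vec c i + \<rho> i) \<in> gens" unfolding gens_def using cC by blast
      then have g: "single c 1 - (single (shift c) 1 :: 'k mpoly) \<in> gens"
        unfolding c'(3) unfolding \<open>c' = c\<close> .
      have su: "shiftable u" "shift u = w + shift c" using shift_add[OF s wc(1)] wc(4) by auto
      have "single w x * (single c 1 - (single (shift c) 1 :: 'k mpoly)) \<in> ?I"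
        by (rule poly_idealD(4)[OF I poly_carrier_single[OF wc(1)] subsetD[OF gens_I g]])
      then have diff: "single u x - (single (shift u) x :: 'k mpoly) \<in> ?I"
        unfolding su(2) unfolding wc(4) single_mult by (simp only: right_diff_distrib)
      show ?thesis
      proof (cases "trunc d (Suc n) (vec (shift u)) \<in> C\<rho>")
        case True
        then have "nf (Suc n) u = Some (shift u)" using 3 su(1) by (simp add: nf_def in_colon_def)
        then show ?thesis using diff by (simp add: R.NF_single)
      next
        case False
        then have "nf (Suc n) u = None" using 3 by (simp add: nf_def in_colon_def)
        moreover have "trunc d (Suc n) (vec (shift u)) \<in> A \<union> C\<rho>"
          using source_shift_trunc[of "vec u" "Suc n"] u su(1) 3
          by (simp add: nonneg_vec_vec shiftable_def vec_shift[OF su(1)])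
        then have "(single (shift u) x :: 'k mpoly) \<in> ?I"
          using False by (intro inA shift_expos[OF su(1)]) auto
        then have "single u x - single (shift u) x + (single (shift u) x :: 'k mpoly) \<in> ?I"
          by (rule poly_idealD(3)[OF I diff])
        ultimately show ?thesis by (simp add: R.NF_single)
      qed
    qed
  qed
  show "R.F (Suc n) \<subseteq> ?I"
  proof
    fix p :: "'k mpoly" assume p: "p \<in> R.F (Suc n)"
    have "p - R.NF (Suc n) p \<in> ?I"
    proof (rule poly_induct_single[of p "\<lambda>p. p - R.NF (Suc n) p \<in> ?I"])
      fix u x assume "u \<in> keys p"
      then have "u \<in> expos n" using p R.F_subset by (auto simp: carrier_poly_ring)
      then show "single u x - R.NF (Suc n) (single u x) \<in> ?I" by (rule reduce)
    next
      show "0 - R.NF (Suc n) 0 \<in> ?I" using poly_idealD(2)[OF I] by (simp add: R.NF_hom)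
    next
      fix p q assume "p - R.NF (Suc n) p \<in> ?I" "q - R.NF (Suc n) q \<in> ?I"
      then have "(p - R.NF (Suc n) p) + (q - R.NF (Suc n) q) \<in> ?I" by (rule poly_idealD(3)[OF I])
      then show "p + q - R.NF (Suc n) (p + q) \<in> ?I" by (simp add: R.NF_add algebra_simps)
    qed
    then show "p \<in> ?I" using p by (simp add: R.F_def)
  qed
qed

end

theorem theorem3p25:
  fixes n d :: nat
    and A C :: "(nat \<Rightarrow> int) set"
    and \<rho> :: "nat \<Rightarrow> int"
  assumes "n \<ge> 1" and "d \<ge> 1"
    and "binomial_system n d A C \<rho>"
    and "admissible n C \<rho>"
  shows "quotient_seq_CM n (saturation n (Fideal n A C \<rho> :: 'k::field_char_0 mpoly set)) \<and>
    quotient_seq_CM n (Fideal n A C \<rho> :: 'k::field_char_0 mpoly set)"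
proof -
  interpret admissible_binomial_system n d A C \<rho>
    by unfold_locales (use assms in auto)
  show ?thesis
    unfolding Fideal_eq_F R.saturation_F[OF assms(1)] by (intro conjI R.quotient_seq_CM_F) simp_all
qed

end
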